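(* For each fixed $\tau>0$, $$\mathbb P\left(\mathrm{Sch}_\tau[0,\lambda]=0\right)=\exp\left\{-\frac{\lambda^2}{4\tau}(1+o(1))\right\},$$ where $o(1)\to0$ for fixed $\tau$ as $\lambda\to\infty$.
   Context: Let $\mathcal B,\mathcal B_2,\mathcal B_3$ be independent standard real Brownian motions, $\mathcal W=\frac1{\sqrt2}(\mathcal B_2+i\mathcal B_3)$, and let $\varphi^\lambda(t)$, $\lambda\in\mathbb R$, be the solutions, all driven by the same $\mathcal B,\mathcal W$, of $d\varphi^\lambda=\lambda\,dt+d\mathcal B+\mathrm{Re}[e^{-i\varphi^\lambda}d\mathcal W]$, $\varphi^\lambda(0)=0$ (in the version for which $\lambda\mapsto\varphi^\lambda(t)$ is strictly increasing and real-analytic for $t>0$). $\mathrm{Sch}_\tau=\{\lambda\in\mathbb R:\varphi^{\lambda/\tau}(\tau)\in2\pi\mathbb Z\}$, and $\mathrm{Sch}_\tau[a,b]$ denotes the number of points of $\mathrm{Sch}_\tau$ in $[a,b]$. *)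

theory Defs
  imports "HOL-Probability.Probability"
begin

section \<open>Brownian motion\<close>

definition brownian_motion :: "'a measure \<Rightarrow> (real \<Rightarrow> 'a \<Rightarrow> real) \<Rightarrow> bool" where
  "brownian_motion M B \<longleftrightarrow>
     prob_space M \<and>
     (\<forall>t\<ge>0. B t \<in> borel_measurable M) \<and>
     (AE \<omega> in M. B 0 \<omega> = 0) \<and>
     (AE \<omega> in M. continuous_on {0..} (\<lambda>t. B t \<omega>)) \<and>
     (\<forall>s t. 0 \<le> s \<and> s < t \<longrightarrow>
        distributed M lborel (\<lambda>\<omega>. B t \<omega> - B s \<omega>) (normal_density 0 (sqrt (t - s)))) \<and>
     (\<forall>t :: nat \<Rightarrow> real. 0 \<le> t 0 \<and> mono t \<longrightarrow>
        prob_space.indep_vars M (\<lambda>_. borel) (\<lambda>k \<omega>. B (t (Suc k)) \<omega> - B (t k) \<omega>) UNIV)"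

text \<open>The processes are independent as random elements of the space of paths on \<open>{0..}\<close>.\<close>

definition independent_brownian_motions ::
    "'a measure \<Rightarrow> (real \<Rightarrow> 'a \<Rightarrow> real) list \<Rightarrow> bool" where
  "independent_brownian_motions M Bs \<longleftrightarrow>
     (\<forall>B \<in> set Bs. brownian_motion M B) \<and>
     prob_space.indep_vars M (\<lambda>_. Pi\<^sub>M {0..} (\<lambda>_. borel))
       (\<lambda>i \<omega>. \<lambda>t\<in>{0..}. (Bs ! i) t \<omega>) {..<length Bs}"

text \<open>The filtration generated by the processes, augmented by the null sets of \<open>M\<close>.\<close>

definition aug_filtration ::
    "'a measure \<Rightarrow> (real \<Rightarrow> 'a \<Rightarrow> real) list \<Rightarrow> real \<Rightarrow> 'a measure" where
  "aug_filtration M Bs t = sigma (space M)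
     ({B s -` A \<inter> space M | B s A. B \<in> set Bs \<and> 0 \<le> s \<and> s \<le> t \<and> A \<in> sets borel} \<union> null_sets M)"

section \<open>The Ito integral\<close>

text \<open>A simple process on \<open>{0..T}\<close> takes the value \<open>H k\<close> on \<open>{t k<..t (Suc k)}\<close> for \<open>k < n\<close>,
  where \<open>H k\<close> is bounded and measurable at time \<open>t k\<close>.\<close>

definition simple_process ::
    "'a measure \<Rightarrow> (real \<Rightarrow> 'a measure) \<Rightarrow> real \<Rightarrow> nat \<Rightarrow> (nat \<Rightarrow> real) \<Rightarrow> (nat \<Rightarrow> 'a \<Rightarrow> complex) \<Rightarrow> bool"
where
  "simple_process M F T n t H \<longleftrightarrow>
     t 0 = 0 \<and> t n = T \<and> (\<forall>k<n. t k \<le> t (Suc k)) \<and>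
     (\<forall>k<n. H k \<in> borel_measurable (F (t k)) \<and> (\<exists>C. \<forall>\<omega>\<in>space M. cmod (H k \<omega>) \<le> C))"

definition simple_value ::
    "nat \<Rightarrow> (nat \<Rightarrow> real) \<Rightarrow> (nat \<Rightarrow> 'a \<Rightarrow> complex) \<Rightarrow> real \<Rightarrow> 'a \<Rightarrow> complex" where
  "simple_value n t H s \<omega> = (\<Sum>k<n. H k \<omega> * indicator {t k<..t (Suc k)} s)"

definition simple_integral ::
    "nat \<Rightarrow> (nat \<Rightarrow> real) \<Rightarrow> (nat \<Rightarrow> 'a \<Rightarrow> complex) \<Rightarrow> (real \<Rightarrow> 'a \<Rightarrow> complex) \<Rightarrow> 'a \<Rightarrow> complex" where
  "simple_integral n t H W \<omega> = (\<Sum>k<n. H k \<omega> * (W (t (Suc k)) \<omega> - W (t k) \<omega>))"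

text \<open>\<open>I\<close> is (a version of) the integral of the process \<open>X\<close> against \<open>W\<close> over \<open>{0..T}\<close>, for \<open>X\<close> in
  the closure of the simple processes in \<open>L\<^sup>2\<close> of time and chance: the mean square limit of the
  integrals of simple processes that approximate \<open>X\<close>.\<close>

definition has_ito_integral ::
    "'a measure \<Rightarrow> (real \<Rightarrow> 'a measure) \<Rightarrow> (real \<Rightarrow> 'a \<Rightarrow> complex) \<Rightarrow> real \<Rightarrow>
     (real \<Rightarrow> 'a \<Rightarrow> complex) \<Rightarrow> ('a \<Rightarrow> complex) \<Rightarrow> bool" where
  "has_ito_integral M F W T X I \<longleftrightarrow>
     I \<in> borel_measurable M \<and>
     (\<exists>n t H. (\<forall>m. simple_process M F T (n m) (t m) (H m)) \<and>
        (\<lambda>m. \<integral>\<^sup>+\<omega>. (\<integral>\<^sup>+s\<in>{0..T}. ennreal ((cmod (simple_value (n m) (t m) (H m) s \<omega> - X s \<omega>))\<^sup>2) \<partial>lborel) \<partial>M)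
           \<longlonglongrightarrow> 0 \<and>
        (\<lambda>m. \<integral>\<^sup>+\<omega>. ennreal ((cmod (simple_integral (n m) (t m) (H m) W \<omega> - I \<omega>))\<^sup>2) \<partial>M)
           \<longlonglongrightarrow> 0)"

section \<open>The phase equation and the point process\<close>

definition real_analytic :: "(real \<Rightarrow> real) \<Rightarrow> bool" where
  "real_analytic f \<longleftrightarrow>
     (\<forall>x. \<exists>r>0. \<exists>a :: nat \<Rightarrow> real. \<forall>y. \<bar>y - x\<bar> < r \<longrightarrow> (\<lambda>n. a n * (y - x) ^ n) sums f y)"

text \<open>\<open>\<phi> l t \<omega>\<close> is the phase with parameter \<open>l\<close> at time \<open>t\<close>.\<close>

locale schroedinger_phase =
  fixes M :: "'a measure"
    and B B2 B3 :: "real \<Rightarrow> 'a \<Rightarrow> real"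
    and \<phi> :: "real \<Rightarrow> real \<Rightarrow> 'a \<Rightarrow> real"
    and F :: "real \<Rightarrow> 'a measure"
    and W :: "real \<Rightarrow> 'a \<Rightarrow> complex"
  defines "F \<equiv> aug_filtration M [B, B2, B3]"
    and "W \<equiv> (\<lambda>t \<omega>. (complex_of_real (B2 t \<omega>) + \<i> * complex_of_real (B3 t \<omega>)) / complex_of_real (sqrt 2))"
  assumes independent: "independent_brownian_motions M [B, B2, B3]"
    and adapted: "\<And>l t. 0 \<le> t \<Longrightarrow> \<phi> l t \<in> borel_measurable (F t)"
    and continuous: "\<And>l. AE \<omega> in M. continuous_on {0..} (\<lambda>t. \<phi> l t \<omega>)"
    and initial: "\<And>l. AE \<omega> in M. \<phi> l 0 \<omega> = 0"
    and sde: "\<And>l t. 0 \<le> t \<Longrightarrow>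
       \<exists>I. has_ito_integral M F W t (\<lambda>s \<omega>. exp (- \<i> * complex_of_real (\<phi> l s \<omega>))) I \<and>
           (AE \<omega> in M. \<phi> l t \<omega> = l * t + B t \<omega> + Re (I \<omega>))"
    and regular: "AE \<omega> in M. \<forall>t>0. strict_mono (\<lambda>l. \<phi> l t \<omega>) \<and> real_analytic (\<lambda>l. \<phi> l t \<omega>)"

definition Sch :: "(real \<Rightarrow> real \<Rightarrow> 'a \<Rightarrow> real) \<Rightarrow> real \<Rightarrow> 'a \<Rightarrow> real set" where
  "Sch \<phi> \<tau> \<omega> = {l. \<exists>k::int. \<phi> (l / \<tau>) \<tau> \<omega> = 2 * pi * of_int k}"

text \<open>The counting measure is used rather than \<open>card\<close>, which is 0 on infinite sets.\<close>

definition Sch_count ::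
    "(real \<Rightarrow> real \<Rightarrow> 'a \<Rightarrow> real) \<Rightarrow> real \<Rightarrow> real \<Rightarrow> real \<Rightarrow> 'a \<Rightarrow> ennreal" where
  "Sch_count \<phi> \<tau> a b \<omega> = emeasure (count_space UNIV) (Sch \<phi> \<tau> \<omega> \<inter> {a..b})"

text \<open>Monotonicity in \<open>l\<close> holds only almost surely, so the event that a count vanishes is measurable
  up to a null set of \<open>M\<close>; hence its probability is taken in the completion of \<open>M\<close>.\<close>

definition Sch_gap_prob ::
    "'a measure \<Rightarrow> (real \<Rightarrow> real \<Rightarrow> 'a \<Rightarrow> real) \<Rightarrow> real \<Rightarrow> real \<Rightarrow> real" where
  "Sch_gap_prob M \<phi> \<tau> l = \<P>(\<omega> in completion M. Sch_count \<phi> \<tau> 0 l \<omega> = 0)"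

end

theory Submission
  imports Defs "HOL-Real_Asymp.Real_Asymp"
begin

text \<open>With \<open>\<nu> = l / \<tau>\<close>, the interval from \<open>0\<close> to \<open>l\<close> contains no point exactly when the phases with
  parameters \<open>0\<close> and \<open>\<nu>\<close> lie at time \<open>\<tau>\<close> strictly between the same two consecutive multiples of
  \<open>2 * \<pi>\<close> (\<open>Sch_count_eq_0_iff\<close>). The relative phase \<open>\<alpha>\<close>, the difference of the two, starts at
  \<open>0\<close>, stays nonnegative, and is a diffusion with drift \<open>\<nu>\<close> and variance \<open>1 - cos \<alpha>\<close> per unit of
  time. The gap event forces \<open>\<alpha> < 2 * \<pi>\<close> at time \<open>\<tau>\<close>, so the noise has to compensate a drift of
  \<open>\<nu>\<close> almost all the time. This is cheapest where the variance has its maximum 2, that is at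
  \<open>\<alpha> = \<pi>\<close>. There the cost per unit of time is \<open>\<nu>\<^sup>2 / 4\<close>, in total
  \<open>\<nu>\<^sup>2 * \<tau> / 4 = l\<^sup>2 / (4 * \<tau>)\<close>.

  Both bounds follow the expectation of a positive test function along the process. For the upper bound
  the generator maps the function to at most a negative multiple of itself, for the lower bound to at
  least such a multiple, and the expectation then decays at least or at most exponentially
  (\<open>expectation_growth\<close>). For the upper bound \<open>prob_gap_small_upper\<close>, the test function is a bounded
  version of \<open>exp (- \<nu> * \<alpha> / 2)\<close>. For the lower bound \<open>prob_gap_lower\<close>, it is a bump around the
  optimal path of \<open>\<alpha>\<close>: at first around the path of the pure drift from \<open>0\<close> to \<open>\<pi>\<close>, which takes a
  short time \<open>\<pi> / \<nu>\<close>, then around \<open>\<pi>\<close>, where it is tilted by \<open>exp (- \<nu> * \<alpha> / 2)\<close>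
  (\<open>tilted_bump_subsolution\<close>). In both stages it is multiplied by a bump in the mean of the two phases
  (\<open>cosbump_subsolution\<close>) that steers the mean to \<open>\<pi>\<close> modulo \<open>2 * \<pi>\<close>, so that the two phases end
  between consecutive multiples of \<open>2 * \<pi>\<close> rather than merely close to each other. The noises of
  mean and difference are uncorrelated, so the two factors do not interact. All corrections are
  linear in \<open>\<nu>\<close> or smaller, hence negligible against \<open>\<nu>\<^sup>2\<close>.

  In place of Ito's formula, the expectation of a test function is followed over short time steps. By the
  isometry, the phase moves during a step of length \<open>h\<close> as if the direction of its noise were frozen,
  up to an error with mean 0 given the past and mean square of order \<open>h\<^sup>2\<close> (\<open>phase_increment\<close>). A second
  order expansion then gives the generator with an error of order \<open>h * sqrt h\<close> in each step
  (\<open>one_step\<close>), and these errors sum up to something that vanishes with \<open>h\<close>.\<close>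


section \<open>Independence of past and increments\<close>

lemma sets_vimage_algebra_subsetI:
  assumes X: "X \<in> Om \<rightarrow> space N"
    and gen: "\<And>A. A \<in> G \<Longrightarrow> \<exists>S\<in>sets N. A = X -` S \<inter> Om"
  shows "sigma_sets Om G \<subseteq> {X -` S \<inter> Om |S. S \<in> sets N}"
proof -
  have "G \<subseteq> sets (vimage_algebra Om X N)"
    using gen sets_vimage_algebra2[OF X] by blast
  then have "sigma_sets Om G \<subseteq> sets (vimage_algebra Om X N)"
    using sets.sigma_sets_subset[of G "vimage_algebra Om X N"] by simp
  then show ?thesis using sets_vimage_algebra2[OF X] by simp
qed

context prob_space
begin

text \<open>The past of the path is generated by its values at finitely many times, which are sums of
  increments over a partition that ends at \<open>s\<close>.\<close>

lemma indep_past_increment_single: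
  assumes B: "brownian_motion M B" and st: "0 \<le> s" "s < t"
  shows "indep_set
     (sigma_sets (space M) {(\<lambda>\<omega>. B r \<omega> - B 0 \<omega>) -` A \<inter> space M | r A. 0 \<le> r \<and> r \<le> s \<and> A \<in> sets borel})
     (sigma_sets (space M) {(\<lambda>\<omega>. B t \<omega> - B s \<omega>) -` A \<inter> space M | A. A \<in> sets borel})"
proof -
  have meas: "\<And>r. 0 \<le> r \<Longrightarrow> B r \<in> borel_measurable M"
    using B unfolding brownian_motion_def by auto
  have inc: "\<And>\<sigma>. 0 \<le> \<sigma> 0 \<Longrightarrow> mono \<sigma> \<Longrightarrow>
      indep_vars (\<lambda>_. borel) (\<lambda>k \<omega>. B (\<sigma> (Suc k)) \<omega> - B (\<sigma> k) \<omega>) UNIV"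
    using B unfolding brownian_motion_def by auto
  define V where "V J \<omega> = (\<lambda>r\<in>J. B r \<omega> - B 0 \<omega>)" for J :: "real set" and \<omega>
  have V_meas: "V J \<in> measurable M (PiM J (\<lambda>_. borel))" if "J \<subseteq> {0..s}" for J
    unfolding V_def using that meas by (intro measurable_restrict) (auto intro!: borel_measurable_diff)
  define G where "G = {V J -` S \<inter> space M | J S. finite J \<and> J \<subseteq> {0..s} \<and> S \<in> sets (PiM J (\<lambda>_. borel :: real measure))}"
  have G_events: "G \<subseteq> events"
    unfolding G_def using V_meas by (auto intro: measurable_sets)
  have G_indep: "prob (E \<inter> ((\<lambda>\<omega>. B t \<omega> - B s \<omega>) -` A \<inter> space M)) =
      prob E * prob ((\<lambda>\<omega>. B t \<omega> - B s \<omega>) -` A \<inter> space M)"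
    if E: "E \<in> G" and A: "A \<in> sets borel" for E A
  proof -
    obtain J S where J: "finite J" "J \<subseteq> {0..s}" "S \<in> sets (PiM J (\<lambda>_. borel :: real measure))"
      and E_eq: "E = V J -` S \<inter> space M" using E unfolding G_def by auto
    define xs where "xs = sorted_list_of_set (insert 0 (insert s J))"
    define n where "n = length xs"
    have set_xs: "set xs = insert 0 (insert s J)" unfolding xs_def using J(1) by (subst set_sorted_list_of_set) auto
    have sorted: "sorted xs" unfolding xs_def by simp
    have n: "n > 0" using set_xs unfolding n_def by (cases xs) auto
    define \<sigma> where "\<sigma> k = (if k < n then xs ! k else t)" for k
    have xs_bd: "0 \<le> xs ! k \<and> xs ! k \<le> s" if "k < n" for k
    proof -
      have "xs ! k \<in> set xs" using that unfolding n_def by simp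
      then show ?thesis using set_xs J(2) st by auto
    qed
    have mono: "mono \<sigma>"
      unfolding mono_def \<sigma>_def using sorted xs_bd st
      by (force simp: sorted_iff_nth_mono n_def)
    have idx: "\<exists>j<n. xs ! j = r" if "r \<in> insert 0 (insert s J)" for r
      using that set_xs unfolding n_def by (metis in_set_conv_nth)
    have s0: "\<sigma> 0 = 0"
    proof -
      obtain j where j: "j < n" "xs ! j = 0" using idx[of 0] by auto
      have "xs ! 0 \<le> xs ! j" using j n unfolding n_def by (intro sorted_nth_mono[OF sorted]) auto
      then show ?thesis using j xs_bd[OF n] n unfolding \<sigma>_def by auto
    qed
    have sn: "\<sigma> (n - 1) = s"
    proof -
      obtain j where j: "j < n" "xs ! j = s" using idx[of s] by auto
      have "xs ! j \<le> xs ! (n - 1)" using j n unfolding n_def by (intro sorted_nth_mono[OF sorted]) auto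
      then show ?thesis using j xs_bd[of "n - 1"] n unfolding \<sigma>_def by auto
    qed
    define D where "D k \<omega> = B (\<sigma> (Suc k)) \<omega> - B (\<sigma> k) \<omega>" for k \<omega>
    have D_indep: "indep_vars (\<lambda>_. borel) D UNIV"
      using inc[of \<sigma>] s0 mono unfolding D_def by simp
    have D_last: "D (n - 1) = (\<lambda>\<omega>. B t \<omega> - B s \<omega>)"
      using sn n unfolding D_def \<sigma>_def by auto
    have D_sum: "(\<Sum>k<j. D k \<omega>) = B (\<sigma> j) \<omega> - B 0 \<omega>" for j \<omega>
      unfolding D_def by (subst sum_lessThan_telescope[of "\<lambda>k. B (\<sigma> k) \<omega>"]) (simp add: s0)
    define j where "j r = (SOME j. j < n \<and> xs ! j = r)" for r
    have j: "j r < n \<and> xs ! j r = r" if "r \<in> J" for r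
      unfolding j_def using someI_ex[OF idx[of r]] that by auto
    define f where "f y = (\<lambda>r\<in>J. \<Sum>k<j r. y k)" for y :: "nat \<Rightarrow> real"
    have Vf: "V J \<omega> = f (restrict (\<lambda>k. D k \<omega>) {..<n - 1})" for \<omega>
    proof -
      have "(\<Sum>k<j r. restrict (\<lambda>k. D k \<omega>) {..<n - 1} k) = B r \<omega> - B 0 \<omega>" if r: "r \<in> J" for r
      proof -
        have "(\<Sum>k<j r. restrict (\<lambda>k. D k \<omega>) {..<n - 1} k) = (\<Sum>k<j r. D k \<omega>)"
          using j[OF r] by (intro sum.cong) auto
        also have "\<dots> = B r \<omega> - B 0 \<omega>"
          unfolding D_sum using j[OF r] by (simp add: \<sigma>_def)
        finally show ?thesis .
      qed
      then show ?thesis unfolding V_def f_def by (auto simp: restrict_def fun_eq_iff)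
    qed
    have f_meas: "f \<in> measurable (PiM {..<n - 1} (\<lambda>_. borel)) (PiM J (\<lambda>_. borel))"
      unfolding f_def
    proof (intro measurable_restrict borel_measurable_sum)
      fix r k assume "r \<in> J" "k \<in> {..<j r}"
      then have "k \<in> {..<n - 1}" using j[of r] by auto
      then show "(\<lambda>y. y k) \<in> measurable (PiM {..<n - 1} (\<lambda>_. borel)) borel"
        by (rule measurable_component_singleton)
    qed
    have "indep_var (PiM {..<n - 1} (\<lambda>_. borel)) (\<lambda>\<omega>. restrict (\<lambda>k. D k \<omega>) {..<n - 1})
        (PiM {n - 1} (\<lambda>_. borel)) (\<lambda>\<omega>. restrict (\<lambda>k. D k \<omega>) {n - 1})"
      by (rule indep_var_restrict[OF D_indep]) auto
    then have *: "prob (X \<inter> Y) = prob X * prob Y"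
      if "X \<in> {(\<lambda>\<omega>. restrict (\<lambda>k. D k \<omega>) {..<n - 1}) -` S \<inter> space M | S. S \<in> sets (PiM {..<n - 1} (\<lambda>_. borel))}"
        "Y \<in> {(\<lambda>\<omega>. restrict (\<lambda>k. D k \<omega>) {n - 1}) -` S \<inter> space M | S. S \<in> sets (PiM {n - 1} (\<lambda>_. borel))}"
      for X Y using that unfolding indep_var_eq indep_sets2_eq by blast
    show ?thesis
    proof (rule *)
      have "E = (\<lambda>\<omega>. restrict (\<lambda>k. D k \<omega>) {..<n - 1}) -` (f -` S \<inter> space (PiM {..<n - 1} (\<lambda>_. borel))) \<inter> space M"
        unfolding E_eq Vf by (auto simp: space_PiM)
      then show "E \<in> {(\<lambda>\<omega>. restrict (\<lambda>k. D k \<omega>) {..<n - 1}) -` S \<inter> space M | S. S \<in> sets (PiM {..<n - 1} (\<lambda>_. borel))}"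
        using measurable_sets[OF f_meas J(3)] by blast
      have "(\<lambda>y. y (n - 1)) -` A \<inter> space (PiM {n - 1} (\<lambda>_. borel)) \<in> sets (PiM {n - 1} (\<lambda>_. borel :: real measure))"
        by (rule measurable_sets[OF _ A]) (auto intro: measurable_component_singleton)
      moreover have "(\<lambda>\<omega>. B t \<omega> - B s \<omega>) -` A \<inter> space M = (\<lambda>\<omega>. restrict (\<lambda>k. D k \<omega>) {n - 1}) -`
          ((\<lambda>y. y (n - 1)) -` A \<inter> space (PiM {n - 1} (\<lambda>_. borel))) \<inter> space M"
        unfolding D_last[symmetric] by (auto simp: space_PiM)
      ultimately show "(\<lambda>\<omega>. B t \<omega> - B s \<omega>) -` A \<inter> space M \<in>
          {(\<lambda>\<omega>. restrict (\<lambda>k. D k \<omega>) {n - 1}) -` S \<inter> space M | S. S \<in> sets (PiM {n - 1} (\<lambda>_. borel))}"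
        by blast
    qed
  qed
  have stable: "Int_stable G"
  proof (rule Int_stableI)
    fix a b assume "a \<in> G" "b \<in> G"
    then obtain J S J' S' where J: "finite J" "J \<subseteq> {0..s}" "S \<in> sets (PiM J (\<lambda>_. borel :: real measure))"
      "a = V J -` S \<inter> space M" and J': "finite J'" "J' \<subseteq> {0..s}" "S' \<in> sets (PiM J' (\<lambda>_. borel :: real measure))"
      "b = V J' -` S' \<inter> space M" unfolding G_def by auto
    let ?K = "J \<union> J'" and ?N = "PiM (J \<union> J') (\<lambda>_. borel :: real measure)"
    define U where "U = ((\<lambda>x. restrict x J) -` S \<inter> space ?N) \<inter> ((\<lambda>x. restrict x J') -` S' \<inter> space ?N)"
    have "U \<in> sets ?N" unfolding U_def
      by (intro sets.Int measurable_sets[OF measurable_restrict_subset J(3)]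
            measurable_sets[OF measurable_restrict_subset J'(3)]) auto
    moreover have "a \<inter> b = V ?K -` U \<inter> space M"
    proof -
      have r: "restrict (V ?K \<omega>) J = V J \<omega>" "restrict (V ?K \<omega>) J' = V J' \<omega>" for \<omega>
        unfolding V_def by (auto simp: fun_eq_iff)
      have "V ?K \<omega> \<in> space ?N" for \<omega>
        unfolding V_def by (simp add: space_PiM)
      then show ?thesis unfolding J(4) J'(4) U_def by (auto simp: r)
    qed
    ultimately show "a \<inter> b \<in> G" unfolding G_def
      using J J' by (auto intro!: exI[of _ ?K] exI[of _ U])
  qed
  have "indep_set (sigma_sets (space M) G)
    (sigma_sets (space M) {(\<lambda>\<omega>. B t \<omega> - B s \<omega>) -` A \<inter> space M | A. A \<in> sets borel})"
  proof (rule indep_set_sigma_sets[OF _ stable])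
    show "indep_set G {(\<lambda>\<omega>. B t \<omega> - B s \<omega>) -` A \<inter> space M | A. A \<in> sets borel}"
      unfolding indep_sets2_eq using G_events G_indep meas st
      by (auto intro!: measurable_sets[of _ M borel] borel_measurable_diff)
    show "Int_stable {(\<lambda>\<omega>. B t \<omega> - B s \<omega>) -` A \<inter> space M | A. A \<in> sets borel}"
    proof (rule Int_stableI, safe)
      fix A A' :: "real set" assume "A \<in> sets borel" "A' \<in> sets borel"
      then show "\<exists>A''. (\<lambda>\<omega>. B t \<omega> - B s \<omega>) -` A \<inter> space M \<inter> ((\<lambda>\<omega>. B t \<omega> - B s \<omega>) -` A' \<inter> space M) =
         (\<lambda>\<omega>. B t \<omega> - B s \<omega>) -` A'' \<inter> space M \<and> A'' \<in> sets borel"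
        by (intro exI[of _ "A \<inter> A'"]) auto
    qed
  qed
  moreover have "sigma_sets (space M) {(\<lambda>\<omega>. B r \<omega> - B 0 \<omega>) -` A \<inter> space M | r A. 0 \<le> r \<and> r \<le> s \<and> A \<in> sets borel}
      \<subseteq> sigma_sets (space M) G"
  proof (rule sigma_sets_mono', safe)
    fix r and A :: "real set" assume r: "0 \<le> r" "r \<le> s" "A \<in> sets borel"
    have "(\<lambda>y. y r) -` A \<inter> space (PiM {r} (\<lambda>_. borel)) \<in> sets (PiM {r} (\<lambda>_. borel :: real measure))"
      by (rule measurable_sets[OF _ r(3)]) (auto intro: measurable_component_singleton)
    moreover have "(\<lambda>\<omega>. B r \<omega> - B 0 \<omega>) -` A \<inter> space M =
       V {r} -` ((\<lambda>y. y r) -` A \<inter> space (PiM {r} (\<lambda>_. borel))) \<inter> space M"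
      unfolding V_def by (auto simp: space_PiM)
    ultimately show "(\<lambda>\<omega>. B r \<omega> - B 0 \<omega>) -` A \<inter> space M \<in> G"
      unfolding G_def mem_Collect_eq
      using r by (intro exI[of _ "{r}"] exI[of _ "(\<lambda>y. y r) -` A \<inter> space (PiM {r} (\<lambda>_. borel))"] conjI) simp_all
  qed
  ultimately show ?thesis unfolding indep_sets2_eq by blast
qed


text \<open>The paths are independent of each other, and each path has an increment that is independent of its own
  past, so intersections of one event per path multiply. Null sets multiply with everything; together
  with them the intersections of past events form a \<open>\<pi>\<close>-system whose \<open>\<sigma>\<close>-algebra
  contains the augmented past.\<close>

lemma indep_past_increments:
  assumes ind: "independent_brownian_motions M Bs" and st: "0 \<le> s" "s < t"
  shows "indep_set (sets (aug_filtration M Bs s))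
     (sigma_sets (space M) {(\<lambda>\<omega>. (Bs ! i) t \<omega> - (Bs ! i) s \<omega>) -` A \<inter> space M | i A. i < length Bs \<and> A \<in> sets borel})"
proof -
  let ?n = "length Bs"
  let ?P = "PiM {0::real..} (\<lambda>_. borel :: real measure)"
  define path where "path i \<omega> = (\<lambda>r\<in>{0..}. (Bs ! i) r \<omega>)" for i \<omega>
  have bm: "brownian_motion M (Bs ! i)" if "i < ?n" for i
    using ind that unfolding independent_brownian_motions_def by auto
  have meas: "(Bs ! i) r \<in> borel_measurable M" if "i < ?n" "0 \<le> r" for i r
    using bm[OF that(1)] that(2) unfolding brownian_motion_def by auto
  have paths: "indep_vars (\<lambda>_. ?P) path {..<?n}"
    using ind unfolding independent_brownian_motions_def path_def by simp
  define Past where "Past i = sigma_sets (space M) {(\<lambda>\<omega>. (Bs ! i) r \<omega> - (Bs ! i) 0 \<omega>) -` A \<inter> space M | r A. 0 \<le> r \<and> r \<le> s \<and> A \<in> sets borel}" for i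
  define Inc where "Inc i = sigma_sets (space M) {(\<lambda>\<omega>. (Bs ! i) t \<omega> - (Bs ! i) s \<omega>) -` A \<inter> space M | A. A \<in> sets borel}" for i
  have past_inc: "indep_set (Past i) (Inc i)" if "i < ?n" for i
    unfolding Past_def Inc_def by (rule indep_past_increment_single[OF bm[OF that] st])
  have sa_Past: "sigma_algebra (space M) (Past i)" and sa_Inc: "sigma_algebra (space M) (Inc i)" for i
    unfolding Past_def Inc_def by (auto intro!: sigma_algebra_sigma_sets)
  have path_space: "path i \<in> space M \<rightarrow> space ?P" for i
    unfolding path_def by (auto simp: space_PiM)
  define Paths where "Paths i = {path i -` S \<inter> space M | S. S \<in> sets ?P}" for i
  have diff: "\<exists>S\<in>sets ?P. (\<lambda>\<omega>. (Bs ! i) r' \<omega> - (Bs ! i) r \<omega>) -` A \<inter> space M = path i -` S \<inter> space M"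
    if "0 \<le> r" "0 \<le> r'" "A \<in> sets borel" for i r r' and A :: "real set"
  proof -
    have "(\<lambda>x. x r' - x r) -` A \<inter> space ?P \<in> sets ?P"
      by (rule measurable_sets[OF _ that(3)])
         (intro borel_measurable_diff measurable_component_singleton; use that in simp)
    moreover have "(\<lambda>\<omega>. (Bs ! i) r' \<omega> - (Bs ! i) r \<omega>) -` A \<inter> space M = path i -` ((\<lambda>x. x r' - x r) -` A \<inter> space ?P) \<inter> space M"
      using path_space[of i] that unfolding path_def by auto
    ultimately show ?thesis by blast
  qed
  have Past_Paths: "Past i \<subseteq> Paths i" for i
    unfolding Past_def Paths_def
    by (rule sets_vimage_algebra_subsetI[OF path_space]) (use diff[of 0] in blast)
  have Inc_Paths: "Inc i \<subseteq> Paths i" for i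
    unfolding Inc_def Paths_def
    by (rule sets_vimage_algebra_subsetI[OF path_space]) (use diff[of s t] st in force)
  have Paths_events: "Paths i \<subseteq> events" if "i < ?n" for i
  proof -
    have "path i \<in> measurable M ?P"
      unfolding path_def using meas[OF that] by (intro measurable_restrict) auto
    then show ?thesis unfolding Paths_def by (auto intro: measurable_sets)
  qed
  have Paths_Int: "a \<inter> b \<in> Paths i" if "a \<in> Paths i" "b \<in> Paths i" for a b i
  proof -
    from that(1)[unfolded Paths_def mem_Collect_eq]
    obtain S where S: "a = path i -` S \<inter> space M \<and> S \<in> sets ?P" by (rule exE)
    from that(2)[unfolded Paths_def mem_Collect_eq]
    obtain S' where S': "b = path i -` S' \<inter> space M \<and> S' \<in> sets ?P" by (rule exE)
    have "a \<inter> b = path i -` (S \<inter> S') \<inter> space M" using S S' by blast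
    moreover have "S \<inter> S' \<in> sets ?P" using S S' by blast
    ultimately show ?thesis unfolding Paths_def by (intro CollectI exI conjI)
  qed
  have prod: "prob (space M \<inter> (\<Inter>i<?n. A i)) = (\<Prod>i<?n. prob (A i))"
    if A: "\<And>i. i < ?n \<Longrightarrow> A i \<in> Paths i" for A
  proof (cases "?n = 0")
    case True then show ?thesis by (simp add: prob_space)
  next
    case False
    have "\<forall>i<?n. \<exists>S. S \<in> sets ?P \<and> A i = path i -` S \<inter> space M"
      using A unfolding Paths_def by (simp add: conj_commute)
    then obtain S where S: "\<And>i. i < ?n \<Longrightarrow> S i \<in> sets ?P" "\<And>i. i < ?n \<Longrightarrow> A i = path i -` S i \<inter> space M"
      by metis
    have "space M \<inter> (\<Inter>i<?n. A i) = (\<Inter>i<?n. path i -` S i \<inter> space M)" using S(2) False by auto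
    moreover have "prob (\<Inter>i<?n. path i -` S i \<inter> space M) = (\<Prod>i<?n. prob (path i -` S i \<inter> space M))"
    proof (rule indep_varsD[OF paths])
      show "{..<?n} \<noteq> {}" using False by (metis lessThan_iff empty_iff neq0_conv)
    qed (use S(1) in simp_all)
    ultimately have "prob (space M \<inter> (\<Inter>i<?n. A i)) = (\<Prod>i<?n. prob (path i -` S i \<inter> space M))"
      by (simp only:)
    also have "\<dots> = (\<Prod>i<?n. prob (A i))" using S(2) by (intro prod.cong) simp_all
    finally show ?thesis .
  qed
  define G1 where "G1 = {space M \<inter> (\<Inter>i<?n. A i) | A. \<forall>i<?n. A i \<in> Past i} \<union> null_sets M"
  define G2 where "G2 = {space M \<inter> (\<Inter>i<?n. A i) | A. \<forall>i<?n. A i \<in> Inc i}"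
  have ev1: "space M \<inter> (\<Inter>i<?n. A i) \<in> events" if "\<forall>i<?n. A i \<in> Paths i" for A
  proof (cases "?n = 0")
    case False
    then show ?thesis using that Paths_events by (intro sets.Int sets.finite_INT) auto
  qed simp
  have G1_events: "G1 \<subseteq> events"
  proof
    fix a assume "a \<in> G1"
    then consider A where "a = space M \<inter> (\<Inter>i<?n. A i)" "\<forall>i<?n. A i \<in> Past i" | "a \<in> null_sets M"
      unfolding G1_def by blast
    then show "a \<in> events"
    proof cases
      case 1
      then show ?thesis using ev1[of A] Past_Paths by (simp add: subset_iff)
    qed auto
  qed
  have G2_events: "G2 \<subseteq> events"
  proof
    fix a assume "a \<in> G2"
    then obtain A where "a = space M \<inter> (\<Inter>i<?n. A i)" "\<forall>i<?n. A i \<in> Inc i" unfolding G2_def by blast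
    then show "a \<in> events" using ev1[of A] Inc_Paths by (simp add: subset_iff)
  qed
  have stable_gen: "Int_stable {space M \<inter> (\<Inter>i<?n. A i) | A. \<forall>i<?n. A i \<in> C i}"
    if C: "\<And>i. sigma_algebra (space M) (C i)" for C
  proof (rule Int_stableI, safe)
    fix A B assume *: "\<forall>i<?n. A i \<in> C i" "\<forall>i<?n. B i \<in> C i"
    have "A i \<inter> B i \<in> C i" if "i < ?n" for i
    proof -
      interpret sigma_algebra "space M" "C i" by (rule C)
      show ?thesis using * that by auto
    qed
    then show "\<exists>A'. space M \<inter> (\<Inter>i<?n. A i) \<inter> (space M \<inter> (\<Inter>i<?n. B i)) = space M \<inter> (\<Inter>i<?n. A' i) \<and> (\<forall>i<?n. A' i \<in> C i)"
      by (intro exI[of _ "\<lambda>i. A i \<inter> B i"] conjI) (blast, simp)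
  qed
  have G2_stable: "Int_stable G2" unfolding G2_def by (rule stable_gen[OF sa_Inc])
  have G1_stable: "Int_stable G1"
  proof (rule Int_stableI)
    fix a b assume ab: "a \<in> G1" "b \<in> G1"
    then have ev: "a \<in> events" "b \<in> events" using G1_events by auto
    show "a \<inter> b \<in> G1"
    proof (cases "a \<in> null_sets M \<or> b \<in> null_sets M")
      case True
      then have "a \<inter> b \<in> null_sets M" using null_set_Int1[of b M a, OF _ ev(1)] null_set_Int2[of a M b, OF _ ev(2)] by blast
      then show ?thesis unfolding G1_def by (rule UnI2)
    next
      case False
      then have "a \<inter> b \<in> {space M \<inter> (\<Inter>i<?n. A i) | A. \<forall>i<?n. A i \<in> Past i}"
        using ab unfolding G1_def by (intro Int_stableD[OF stable_gen[OF sa_Past]]) simp_all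
      then show ?thesis unfolding G1_def by (rule UnI1)
    qed
  qed
  have prod12: "prob (a \<inter> b) = prob a * prob b" if ab: "a \<in> G1" "b \<in> G2" for a b
  proof -
    obtain B where B: "b = space M \<inter> (\<Inter>i<?n. B i)" "\<forall>i<?n. B i \<in> Inc i" using ab(2) unfolding G2_def by blast
    show ?thesis
    proof (cases "a \<in> null_sets M")
      case True
      moreover have "b \<in> events" using ab G2_events by blast
      ultimately have "a \<inter> b \<in> null_sets M" by (rule null_set_Int2)
      then show ?thesis using measure_eq_0_null_sets[OF True] measure_eq_0_null_sets[of "a \<inter> b" M] by simp
    next
      case False
      with ab(1) obtain A where A: "a = space M \<inter> (\<Inter>i<?n. A i)" "\<forall>i<?n. A i \<in> Past i" unfolding G1_def by blast
      have "a \<inter> b = space M \<inter> (\<Inter>i<?n. A i \<inter> B i)" unfolding A(1) B(1) by blast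
      moreover have "prob (space M \<inter> (\<Inter>i<?n. A i \<inter> B i)) = (\<Prod>i<?n. prob (A i \<inter> B i))"
        by (rule prod) (use A(2) B(2) Past_Paths Inc_Paths Paths_Int in blast)
      ultimately have "prob (a \<inter> b) = (\<Prod>i<?n. prob (A i \<inter> B i))" by simp
      also have "\<dots> = (\<Prod>i<?n. prob (A i) * prob (B i))"
      proof (intro prod.cong refl)
        fix i assume "i \<in> {..<?n}"
        then show "prob (A i \<inter> B i) = prob (A i) * prob (B i)"
          using past_inc[of i] A(2) B(2) unfolding indep_sets2_eq by blast
      qed
      also have "\<dots> = prob a * prob b"
      proof -
        have "prob a = (\<Prod>i<?n. prob (A i))"
          unfolding A(1) by (rule prod) (use A(2) Past_Paths in blast)
        moreover have "prob b = (\<Prod>i<?n. prob (B i))"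
          unfolding B(1) by (rule prod) (use B(2) Inc_Paths in blast)
        ultimately show ?thesis by (simp add: prod.distrib)
      qed
      finally show ?thesis .
    qed
  qed
  have "indep_set G1 G2"
    by (rule iffD2[OF indep_sets2_eq]) (use G1_events G2_events prod12 in simp)
  then have *: "indep_set (sigma_sets (space M) G1) (sigma_sets (space M) G2)"
    by (rule indep_set_sigma_sets[OF _ G1_stable G2_stable])
  have sub1: "sets (aug_filtration M Bs s) \<subseteq> sigma_sets (space M) G1"
  proof -
    have "A \<in> sigma_sets (space M) G1" if A: "A \<in> null_sets M" for A
      using that unfolding G1_def by (intro sigma_sets.Basic) auto
    note null = this
    interpret S: sigma_algebra "space M" "sigma_sets (space M) G1"
      using G1_events sets.space_closed by (intro sigma_algebra_sigma_sets) blast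
    \<comment> \<open>the values differ from the increments since time 0 only on the null set where the path does not start at 0\<close>
    have gen: "(Bs ! i) r -` A \<inter> space M \<in> sigma_sets (space M) G1"
      if i: "i < ?n" and r: "0 \<le> r" "r \<le> s" and A: "A \<in> sets borel" for i r and A :: "real set"
    proof -
      define E where "E = (\<lambda>\<omega>. (Bs ! i) r \<omega> - (Bs ! i) 0 \<omega>) -` A \<inter> space M"
      define N where "N = {\<omega> \<in> space M. (Bs ! i) 0 \<omega> \<noteq> 0}"
      have mN: "N \<in> events" unfolding N_def using meas[OF i, of 0] by measurable
      have N: "N \<in> null_sets M"
        using bm[OF i] mN unfolding brownian_motion_def N_def by (simp add: AE_iff_null)
      have "E \<in> Past i" unfolding E_def Past_def using r A by (intro sigma_sets.Basic) blast
      define A' where "A' j = (if j = i then E else space M)" for j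
      have "\<forall>j<?n. A' j \<in> Past j"
        unfolding A'_def using \<open>E \<in> Past i\<close> sa_Past by (auto simp: Past_def intro!: sigma_sets_top)
      moreover have "E = space M \<inter> (\<Inter>j<?n. A' j)"
        unfolding A'_def E_def using i by (auto split: if_splits)
      ultimately have E: "E \<in> sigma_sets (space M) G1"
        unfolding G1_def by (intro sigma_sets.Basic UnI1 CollectI exI[of _ A']) simp
      have "(Bs ! i) r -` A \<inter> N \<in> events"
        using measurable_sets[OF meas[OF i r(1)] A] mN sets.Int[of _ M N]
        by (simp add: N_def Int_assoc Int_def conj_commute conj_left_commute cong: conj_cong)
      then have "(Bs ! i) r -` A \<inter> N \<in> null_sets M"
        by (rule null_sets_subset[OF N]) simp
      moreover have "(Bs ! i) r -` A \<inter> space M = (E - N) \<union> ((Bs ! i) r -` A \<inter> N)"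
        unfolding E_def N_def by auto
      ultimately show ?thesis using E null N by (simp add: S.Diff S.Un)
    qed
    have "(\<Union>B\<in>set Bs. {B r -` A \<inter> space M | r A. 0 \<le> r \<and> r \<le> s \<and> A \<in> sets borel}) \<union> null_sets M \<subseteq> sigma_sets (space M) G1"
      using gen null by (auto simp: in_set_conv_nth)
    moreover have "(\<Union>B\<in>set Bs. {B r -` A \<inter> space M | r A. 0 \<le> r \<and> r \<le> s \<and> A \<in> sets borel}) =
      {B r -` A \<inter> space M | B r A. B \<in> set Bs \<and> 0 \<le> r \<and> r \<le> s \<and> A \<in> sets borel}" by blast
    ultimately have gens: "{B r -` A \<inter> space M | B r A. B \<in> set Bs \<and> 0 \<le> r \<and> r \<le> s \<and> A \<in> sets borel} \<union> null_sets M
        \<subseteq> sigma_sets (space M) G1" by simp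
    have "sets (aug_filtration M Bs s) = sigma_sets (space M)
        ({B r -` A \<inter> space M | B r A. B \<in> set Bs \<and> 0 \<le> r \<and> r \<le> s \<and> A \<in> sets borel} \<union> null_sets M)"
      unfolding aug_filtration_def
      by (rule sets_measure_of) (use gens S.sets_into_space in blast)
    also have "\<dots> \<subseteq> sigma_sets (space M) G1"
      using gens by (rule S.sigma_sets_subset)
    finally show ?thesis .
  qed
  have sub2: "sigma_sets (space M) {(\<lambda>\<omega>. (Bs ! i) t \<omega> - (Bs ! i) s \<omega>) -` A \<inter> space M | i A. i < ?n \<and> A \<in> sets borel}
      \<subseteq> sigma_sets (space M) G2"
  proof (rule sigma_sets_mono', safe)
    fix i and A :: "real set" assume i: "i < ?n" and A: "A \<in> sets borel"
    define A' where "A' j = (if j = i then (\<lambda>\<omega>. (Bs ! i) t \<omega> - (Bs ! i) s \<omega>) -` A \<inter> space M else space M)" for j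
    have "\<forall>j<?n. A' j \<in> Inc j"
      unfolding A'_def Inc_def using A by (auto intro!: sigma_sets_top sigma_sets.Basic)
    moreover have "(\<lambda>\<omega>. (Bs ! i) t \<omega> - (Bs ! i) s \<omega>) -` A \<inter> space M = space M \<inter> (\<Inter>j<?n. A' j)"
      unfolding A'_def using i by (auto split: if_splits)
    ultimately show "(\<lambda>\<omega>. (Bs ! i) t \<omega> - (Bs ! i) s \<omega>) -` A \<inter> space M \<in> G2"
      unfolding G2_def mem_Collect_eq by (intro exI[of _ A']) simp
  qed
  show ?thesis
    using * sub1 sub2 unfolding indep_sets2_eq by blast
qed

end

section \<open>Noise adapted to a filtration\<close>

text \<open>All estimates below use Brownian motions only through the moments of their increments given the past.
  Testing against functions \<open>g\<close> of the past expresses this without conditional expectations.\<close>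

locale brownian_noise = prob_space M for M :: "'a measure" +
  fixes F :: "real \<Rightarrow> 'a measure" and b :: "nat \<Rightarrow> real \<Rightarrow> 'a \<Rightarrow> real" and d :: nat
  assumes subalg: "0 \<le> t \<Longrightarrow> subalgebra M (F t)"
    and F_mono: "0 \<le> s \<Longrightarrow> s \<le> t \<Longrightarrow> sets (F s) \<subseteq> sets (F t)"
    and null_F: "0 \<le> t \<Longrightarrow> N \<in> null_sets M \<Longrightarrow> N \<in> sets (F t)"
    and noise_adapted: "i < d \<Longrightarrow> 0 \<le> t \<Longrightarrow> b i t \<in> borel_measurable (F t)"
    and noise_mean: "0 \<le> s \<Longrightarrow> s \<le> t \<Longrightarrow> i < d \<Longrightarrow> g \<in> borel_measurable (F s) \<Longrightarrow> integrable M g \<Longrightarrow>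
      has_bochner_integral M (\<lambda>\<omega>. g \<omega> * complex_of_real (b i t \<omega> - b i s \<omega>)) 0"
    and noise_cov: "0 \<le> s \<Longrightarrow> s \<le> t \<Longrightarrow> i < d \<Longrightarrow> j < d \<Longrightarrow> g \<in> borel_measurable (F s) \<Longrightarrow> integrable M g \<Longrightarrow>
      has_bochner_integral M (\<lambda>\<omega>. g \<omega> * complex_of_real ((b i t \<omega> - b i s \<omega>) * (b j t \<omega> - b j s \<omega>)))
        (if i = j then complex_of_real (t - s) * (\<integral>\<omega>. g \<omega> \<partial>M) else 0)"
    and noise_fourth: "0 \<le> s \<Longrightarrow> s \<le> t \<Longrightarrow> i < d \<Longrightarrow>
      has_bochner_integral M (\<lambda>\<omega>. (b i t \<omega> - b i s \<omega>) ^ 4) (3 * (t - s)\<^sup>2)"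

lemma (in prob_space) gaussian_moments:
  assumes D: "distributed M lborel X (normal_density 0 \<sigma>)" and \<sigma>: "0 < \<sigma>"
  shows "has_bochner_integral M X 0" "has_bochner_integral M (\<lambda>\<omega>. (X \<omega>)\<^sup>2) (\<sigma>\<^sup>2)"
    "has_bochner_integral M (\<lambda>\<omega>. (X \<omega>) ^ 4) (3 * \<sigma> ^ 4)"
proof -
  have *: "has_bochner_integral M (\<lambda>\<omega>. X \<omega> ^ k) c"
    if "has_bochner_integral lborel (\<lambda>x. normal_density 0 \<sigma> x * x ^ k) c" for k c
  proof -
    have "integrable M (\<lambda>\<omega>. X \<omega> ^ k)"
      using distributed_integrable[OF D, of "\<lambda>x. x ^ k"] that
      by (auto simp: has_bochner_integral_iff normal_density_nonneg)
    moreover have "(\<integral>\<omega>. X \<omega> ^ k \<partial>M) = c"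
      using distributed_integral[OF D, of "\<lambda>x. x ^ k"] that
      by (auto simp: has_bochner_integral_iff normal_density_nonneg)
    ultimately show ?thesis by (simp add: has_bochner_integral_iff)
  qed
  show "has_bochner_integral M X 0"
    using *[of 1] normal_moment_odd[OF \<sigma>, of 0 0] by simp
  show "has_bochner_integral M (\<lambda>\<omega>. (X \<omega>)\<^sup>2) (\<sigma>\<^sup>2)"
    using *[of 2] normal_moment_even[OF \<sigma>, of 0 1] by (simp add: power2_eq_square)
  show "has_bochner_integral M (\<lambda>\<omega>. (X \<omega>) ^ 4) (3 * \<sigma> ^ 4)"
  proof -
    have "fact (2 * 2) / ((2 / \<sigma>\<^sup>2)\<^sup>2 * fact 2) = 3 * \<sigma> ^ 4"
      using \<sigma> by (simp add: fact_numeral field_simps power2_eq_square numeral_eq_Suc)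
    then show ?thesis using *[of 4] normal_moment_even[OF \<sigma>, of 0 2] by simp
  qed
qed

text \<open>A function of the past is independent of the increments, so its product with a polynomial in them has
  the product of the means as its mean.\<close>

lemma (in prob_space) brownian_noise_aug_filtration:
  assumes ind: "independent_brownian_motions M Bs"
  shows "brownian_noise M (aug_filtration M Bs) (\<lambda>i. Bs ! i) (length Bs)"
proof
  let ?n = "length Bs" and ?F = "aug_filtration M Bs"
  have bm: "brownian_motion M (Bs ! i)" if "i < ?n" for i
    using ind that unfolding independent_brownian_motions_def by auto
  have meas: "(Bs ! i) r \<in> borel_measurable M" if "i < ?n" "0 \<le> r" for i r
    using bm[OF that(1)] that(2) unfolding brownian_motion_def by auto
  define Gen where "Gen t = {B s -` A \<inter> space M | B s A. B \<in> set Bs \<and> 0 \<le> s \<and> s \<le> t \<and> A \<in> sets (borel :: real measure)} \<union> null_sets M" for t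
  have Gen_events: "Gen t \<subseteq> events" for t
  proof
    fix E assume "E \<in> Gen t"
    then consider (a) B s A where "E = B s -` A \<inter> space M" "B \<in> set Bs" "0 \<le> s" "A \<in> sets (borel :: real measure)"
      | (b) "E \<in> null_sets M" unfolding Gen_def by blast
    then show "E \<in> events"
    proof cases
      case a
      then obtain i where "i < ?n" "B = Bs ! i" by (auto simp: in_set_conv_nth)
      then show ?thesis using a measurable_sets[OF meas[of i s]] by auto
    qed auto
  qed
  have Gen_Pow: "Gen t \<subseteq> Pow (space M)" for t
    using Gen_events sets.space_closed by blast
  have F: "?F t = sigma (space M) (Gen t)" for t unfolding aug_filtration_def Gen_def ..
  have F_sets: "sets (?F t) = sigma_sets (space M) (Gen t)" for t
    unfolding F by (rule sets_measure_of[OF Gen_Pow])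
  have F_space: "space (?F t) = space M" for t unfolding F by (rule space_measure_of[OF Gen_Pow])
  show subalg: "subalgebra M (?F t)" for t
    unfolding subalgebra_def F_space F_sets using sets.sigma_sets_subset[OF Gen_events] by simp
  show "sets (?F s) \<subseteq> sets (?F t)" if "s \<le> t" for s t
    unfolding F_sets
  proof (rule sigma_sets_mono')
    show "Gen s \<subseteq> Gen t" unfolding Gen_def using that by fastforce
  qed
  show "N \<in> sets (?F t)" if "N \<in> null_sets M" for N t
    unfolding F_sets Gen_def by (rule sigma_sets.Basic) (use that in blast)
  show "(Bs ! i) t \<in> borel_measurable (?F t)" if "i < ?n" "0 \<le> t" for i t
  proof (rule measurableI)
    fix A :: "real set" assume "A \<in> sets borel"
    then have "(Bs ! i) t -` A \<inter> space M \<in> Gen t"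
      unfolding Gen_def using that nth_mem[OF that(1)] by blast
    then show "(Bs ! i) t -` A \<inter> space (?F t) \<in> sets (?F t)"
      unfolding F_sets F_space by (rule sigma_sets.Basic)
  qed simp
  have gauss: "distributed M lborel (\<lambda>\<omega>. (Bs ! i) t \<omega> - (Bs ! i) s \<omega>) (normal_density 0 (sqrt (t - s)))"
    if "i < ?n" "0 \<le> s" "s < t" for i s t
    using bm[OF that(1)] that unfolding brownian_motion_def by auto
  have m1: "has_bochner_integral M (\<lambda>\<omega>. (Bs ! i) t \<omega> - (Bs ! i) s \<omega>) 0"
    and m2: "has_bochner_integral M (\<lambda>\<omega>. ((Bs ! i) t \<omega> - (Bs ! i) s \<omega>)\<^sup>2) (t - s)"
    and m4: "has_bochner_integral M (\<lambda>\<omega>. ((Bs ! i) t \<omega> - (Bs ! i) s \<omega>) ^ 4) (3 * (t - s)\<^sup>2)"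
    if "i < ?n" "0 \<le> s" "s < t" for i s t
  proof -
    have "(sqrt (t - s)) ^ 4 = (t - s)\<^sup>2"
      using that by (simp add: power2_eq_square numeral_eq_Suc)
    then show "has_bochner_integral M (\<lambda>\<omega>. (Bs ! i) t \<omega> - (Bs ! i) s \<omega>) 0"
       "has_bochner_integral M (\<lambda>\<omega>. ((Bs ! i) t \<omega> - (Bs ! i) s \<omega>)\<^sup>2) (t - s)"
       "has_bochner_integral M (\<lambda>\<omega>. ((Bs ! i) t \<omega> - (Bs ! i) s \<omega>) ^ 4) (3 * (t - s)\<^sup>2)"
      using gaussian_moments[OF gauss[OF that]] that by simp_all
  qed
  have "has_bochner_integral M (\<lambda>\<omega>. ((Bs ! i) t \<omega> - (Bs ! i) s \<omega>) ^ 4) (3 * (t - s)\<^sup>2)"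
    if "i < ?n" "0 \<le> s" "s \<le> t" for i s t
    using m4[OF that(1,2), of t] that by (cases "s = t") auto
  then show "0 \<le> s \<Longrightarrow> s \<le> t \<Longrightarrow> i < ?n \<Longrightarrow>
     has_bochner_integral M (\<lambda>\<omega>. ((Bs ! i) t \<omega> - (Bs ! i) s \<omega>) ^ 4) (3 * (t - s)\<^sup>2)" for i s t by blast
  define IncGen where "IncGen s t = {(\<lambda>\<omega>. (Bs ! i) t \<omega> - (Bs ! i) s \<omega>) -` A \<inter> space M | i A. i < ?n \<and> A \<in> sets (borel :: real measure)}" for s t
  have IncGen_Pow: "IncGen s t \<subseteq> Pow (space M)" for s t unfolding IncGen_def by blast
  define N where "N s t = sigma (space M) (IncGen s t)" for s t
  have N_sets: "sets (N s t) = sigma_sets (space M) (IncGen s t)" for s t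
    unfolding N_def by (rule sets_measure_of[OF IncGen_Pow])
  have N_space: "space (N s t) = space M" for s t unfolding N_def by (rule space_measure_of[OF IncGen_Pow])
  have inc_N: "(\<lambda>\<omega>. (Bs ! i) t \<omega> - (Bs ! i) s \<omega>) \<in> borel_measurable (N s t)" if "i < ?n" for i s t
  proof (rule measurableI)
    fix A :: "real set" assume "A \<in> sets borel"
    then have "(\<lambda>\<omega>. (Bs ! i) t \<omega> - (Bs ! i) s \<omega>) -` A \<inter> space M \<in> IncGen s t"
      unfolding IncGen_def using that by blast
    then show "(\<lambda>\<omega>. (Bs ! i) t \<omega> - (Bs ! i) s \<omega>) -` A \<inter> space (N s t) \<in> sets (N s t)"
      unfolding N_sets N_space by (rule sigma_sets.Basic)
  qed simp
  have indep: "indep_var borel g borel V"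
    if "0 \<le> s" "s < t" and g: "g \<in> borel_measurable (?F s)" and V: "V \<in> borel_measurable (N s t)"
    for s t and g V :: "'a \<Rightarrow> complex"
  proof -
    have I: "indep_set (sets (?F s)) (sets (N s t))"
      using indep_past_increments[OF ind that(1,2)] unfolding N_sets IncGen_def .
    then have NM: "sets (N s t) \<subseteq> events" unfolding indep_sets2_eq by simp
    have gM: "g \<in> borel_measurable M" by (rule measurable_from_subalg[OF subalg g])
    have VM: "V \<in> borel_measurable M"
      by (rule measurable_from_subalg[OF _ V]) (use NM in \<open>simp add: subalgebra_def N_space\<close>)
    have 1: "sigma_sets (space M) {g -` A \<inter> space M | A. A \<in> sets borel} \<subseteq> sets (?F s)"
    proof -
      have "{g -` A \<inter> space M | A. A \<in> sets borel} \<subseteq> sets (?F s)"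
        using measurable_sets[OF g] F_space[of s] by auto
      then show ?thesis using sets.sigma_sets_subset[of _ "?F s"] F_space[of s] by simp
    qed
    have 2: "sigma_sets (space M) {V -` A \<inter> space M | A. A \<in> sets borel} \<subseteq> sets (N s t)"
    proof -
      have "{V -` A \<inter> space M | A. A \<in> sets borel} \<subseteq> sets (N s t)"
        using measurable_sets[OF V] N_space[of s t] by auto
      then show ?thesis using sets.sigma_sets_subset[of _ "N s t"] N_space[of s t] by simp
    qed
    show ?thesis
      unfolding indep_var_eq using I 1 2 gM VM unfolding indep_sets2_eq by blast
  qed
  have prod_int: "has_bochner_integral M (\<lambda>\<omega>. g \<omega> * complex_of_real (V \<omega>)) ((\<integral>\<omega>. g \<omega> \<partial>M) * complex_of_real c)"
    if "0 \<le> s" "s < t" "g \<in> borel_measurable (?F s)" "integrable M g" and V: "V \<in> borel_measurable (N s t)"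
      and c: "has_bochner_integral M V c" for s t g V c
  proof -
    have *: "has_bochner_integral M (\<lambda>\<omega>. complex_of_real (V \<omega>)) (complex_of_real c)"
      using c by (rule has_bochner_integral_of_real)
    have **: "indep_var borel g borel (\<lambda>\<omega>. complex_of_real (V \<omega>))"
      by (rule indep[OF that(1-3)]) (use V in measurable)
    show ?thesis
      using indep_var_integrable[OF ** that(4)] indep_var_lebesgue_integral[OF ** that(4)] *
      by (simp add: has_bochner_integral_iff)
  qed
  show "has_bochner_integral M (\<lambda>\<omega>. g \<omega> * complex_of_real ((Bs ! i) t \<omega> - (Bs ! i) s \<omega>)) 0"
    if "0 \<le> s" "s \<le> t" "i < ?n" "g \<in> borel_measurable (?F s)" "integrable M g" for s t i g
  proof (cases "s = t")
    case False
    then show ?thesis using prod_int[OF that(1) _ that(4,5) inc_N[OF that(3)] m1[OF that(3,1)], of t] that by simp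
  qed (simp add: has_bochner_integral_zero)
  have paths: "indep_vars (\<lambda>_. PiM {0..} (\<lambda>_. borel)) (\<lambda>i \<omega>. \<lambda>r\<in>{0..}. (Bs ! i) r \<omega>) {..<?n}"
    using ind unfolding independent_brownian_motions_def by simp
  have cov: "has_bochner_integral M (\<lambda>\<omega>. ((Bs ! i) t \<omega> - (Bs ! i) s \<omega>) * ((Bs ! j) t \<omega> - (Bs ! j) s \<omega>)) 0"
    if "i < ?n" "j < ?n" "i \<noteq> j" "0 \<le> s" "s < t" for i j s t
  proof -
    have "indep_vars (\<lambda>_. borel) (\<lambda>k \<omega>. (\<lambda>r\<in>{0..}. (Bs ! k) r \<omega>) t - (\<lambda>r\<in>{0..}. (Bs ! k) r \<omega>) s) {..<?n}"
      using that by (intro indep_vars_compose2[OF paths] borel_measurable_diff measurable_component_singleton) auto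
    then have "indep_vars (\<lambda>_. borel) (\<lambda>k \<omega>. (Bs ! k) t \<omega> - (Bs ! k) s \<omega>) {..<?n}"
      using that by simp
    then have iv: "indep_vars (\<lambda>_. borel) (\<lambda>k \<omega>. (Bs ! k) t \<omega> - (Bs ! k) s \<omega>) {i, j}"
      by (rule indep_vars_subset) (use that in auto)
    have int: "integrable M (\<lambda>\<omega>. (Bs ! k) t \<omega> - (Bs ! k) s \<omega>)" if "k \<in> {i, j}" for k
      using m1[of k s t] that \<open>i < ?n\<close> \<open>j < ?n\<close> \<open>0 \<le> s\<close> \<open>s < t\<close> by (auto simp: has_bochner_integral_iff)
    show ?thesis
      using indep_vars_integrable[OF _ iv int] indep_vars_lebesgue_integral[OF _ iv int] that m1[of i s t]
      by (simp add: has_bochner_integral_iff)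
  qed
  show "has_bochner_integral M (\<lambda>\<omega>. g \<omega> * complex_of_real (((Bs ! i) t \<omega> - (Bs ! i) s \<omega>) * ((Bs ! j) t \<omega> - (Bs ! j) s \<omega>)))
        (if i = j then complex_of_real (t - s) * (\<integral>\<omega>. g \<omega> \<partial>M) else 0)"
    if "0 \<le> s" "s \<le> t" "i < ?n" "j < ?n" "g \<in> borel_measurable (?F s)" "integrable M g" for s t i j g
  proof (cases "s = t")
    case False
    then have st: "s < t" using that by simp
    have V: "(\<lambda>\<omega>. ((Bs ! i) t \<omega> - (Bs ! i) s \<omega>) * ((Bs ! j) t \<omega> - (Bs ! j) s \<omega>)) \<in> borel_measurable (N s t)"
      using inc_N that by (intro borel_measurable_times) auto
    show ?thesis
    proof (cases "i = j")
      case True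
      have "has_bochner_integral M (\<lambda>\<omega>. ((Bs ! i) t \<omega> - (Bs ! i) s \<omega>) * ((Bs ! j) t \<omega> - (Bs ! j) s \<omega>)) (t - s)"
        using m2[OF that(3,1) st] True by (simp add: power2_eq_square)
      from prod_int[OF that(1) st that(5,6) V this] show ?thesis using True by (simp add: mult.commute)
    next
      case ij: False
      from prod_int[OF that(1) st that(5,6) V cov[OF that(3,4) ij that(1) st]] show ?thesis using ij by simp
    qed
  qed (simp add: has_bochner_integral_zero)
qed

section \<open>Complex noise\<close>

lemma norm_sum_squared_le:
  fixes x y :: "'b::real_normed_vector"
  shows "(norm (x + y))\<^sup>2 \<le> 2 * (norm x)\<^sup>2 + 2 * (norm y)\<^sup>2"
proof -
  have "(norm (x + y))\<^sup>2 \<le> (norm x + norm y)\<^sup>2"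
    by (intro power_mono norm_triangle_ineq) simp
  also have "\<dots> \<le> 2 * (norm x)\<^sup>2 + 2 * (norm y)\<^sup>2"
    using sum_squares_bound[of "norm x" "norm y"] by (simp add: power2_sum)
  finally show ?thesis .
qed

lemma ennreal_norm_sum_squared_le:
  fixes x y :: "'b::real_normed_vector"
  shows "ennreal ((norm (x + y))\<^sup>2) \<le> 2 * ennreal ((norm x)\<^sup>2) + 2 * ennreal ((norm y)\<^sup>2)"
proof -
  have "ennreal ((norm (x + y))\<^sup>2) \<le> ennreal (2 * (norm x)\<^sup>2 + 2 * (norm y)\<^sup>2)"
    by (intro ennreal_leI norm_sum_squared_le)
  then show ?thesis by (simp add: ennreal_mult)
qed

lemma borel_measurable_cnj [measurable]:
  "f \<in> borel_measurable N \<Longrightarrow> (\<lambda>x. cnj (f x)) \<in> borel_measurable N"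
  by (rule measurable_compose[OF _ borel_measurable_continuous_onI]) (auto intro: continuous_intros)

text \<open>The isometry of the integral rests on the mean and the second moment of the increments
  given the past.\<close>

locale complex_noise = prob_space M for M :: "'a measure" +
  fixes F :: "real \<Rightarrow> 'a measure" and W :: "real \<Rightarrow> 'a \<Rightarrow> complex"
  assumes subalg: "0 \<le> t \<Longrightarrow> subalgebra M (F t)"
    and F_mono: "0 \<le> s \<Longrightarrow> s \<le> t \<Longrightarrow> sets (F s) \<subseteq> sets (F t)"
    and W_adapted: "0 \<le> t \<Longrightarrow> W t \<in> borel_measurable (F t)"
    and W_mean: "0 \<le> s \<Longrightarrow> s \<le> t \<Longrightarrow> g \<in> borel_measurable (F s) \<Longrightarrow> integrable M g \<Longrightarrow>
      has_bochner_integral M (\<lambda>\<omega>. g \<omega> * (W t \<omega> - W s \<omega>)) 0"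
    and W_var: "0 \<le> s \<Longrightarrow> s \<le> t \<Longrightarrow> g \<in> borel_measurable (F s) \<Longrightarrow> integrable M g \<Longrightarrow>
      has_bochner_integral M (\<lambda>\<omega>. g \<omega> * ((W t \<omega> - W s \<omega>) * cnj (W t \<omega> - W s \<omega>)))
        (complex_of_real (t - s) * (\<integral>\<omega>. g \<omega> \<partial>M))"
begin

lemma F_meas_M: "0 \<le> t \<Longrightarrow> f \<in> borel_measurable (F t) \<Longrightarrow> f \<in> borel_measurable M"
  by (rule measurable_from_subalg[OF subalg])

lemma F_meas_mono:
  assumes "0 \<le> s" "s \<le> t" "f \<in> borel_measurable (F s)"
  shows "f \<in> borel_measurable (F t)"
proof (rule measurable_from_subalg[OF _ assms(3)])
  show "subalgebra (F t) (F s)"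
    using subalg[of s] subalg[of t] F_mono[OF assms(1,2)] assms by (simp add: subalgebra_def)
qed

definition bounded_at :: "real \<Rightarrow> ('a \<Rightarrow> complex) \<Rightarrow> bool" where
  "bounded_at t H \<longleftrightarrow> H \<in> borel_measurable (F t) \<and> (\<exists>C. \<forall>\<omega>\<in>space M. cmod (H \<omega>) \<le> C)"

lemma bounded_atD: "bounded_at t H \<Longrightarrow> H \<in> borel_measurable (F t)"
  by (simp add: bounded_at_def)

lemma bounded_at_mono: "0 \<le> s \<Longrightarrow> s \<le> t \<Longrightarrow> bounded_at s H \<Longrightarrow> bounded_at t H"
  unfolding bounded_at_def using F_meas_mono by blast

lemma bounded_at_integrable_mult:
  assumes "0 \<le> t" "bounded_at t H" "integrable M f"
  shows "integrable M (\<lambda>\<omega>. H \<omega> * f \<omega>)"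
proof -
  obtain C where C: "\<And>\<omega>. \<omega> \<in> space M \<Longrightarrow> cmod (H \<omega>) \<le> C" using assms(2) unfolding bounded_at_def by auto
  show ?thesis
  proof (rule Bochner_Integration.integrable_bound[of M "\<lambda>\<omega>. complex_of_real C * f \<omega>"])
    show "integrable M (\<lambda>\<omega>. complex_of_real C * f \<omega>)" using assms(3) by simp
    show "(\<lambda>\<omega>. H \<omega> * f \<omega>) \<in> borel_measurable M"
      using F_meas_M[OF assms(1) bounded_atD[OF assms(2)]] assms(3) by measurable
    show "AE \<omega> in M. norm (H \<omega> * f \<omega>) \<le> norm (complex_of_real C * f \<omega>)"
    proof (rule AE_I2)
      fix \<omega> assume \<omega>: "\<omega> \<in> space M"
      have "cmod (H \<omega>) \<le> \<bar>C\<bar>" using C[OF \<omega>] by linarith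
      then show "norm (H \<omega> * f \<omega>) \<le> norm (complex_of_real C * f \<omega>)"
        by (simp add: norm_mult mult_right_mono)
    qed
  qed
qed

lemma bounded_at_times:
  assumes "bounded_at t H" "bounded_at t K" shows "bounded_at t (\<lambda>\<omega>. H \<omega> * K \<omega>)"
proof -
  obtain C C' where C: "\<And>\<omega>. \<omega> \<in> space M \<Longrightarrow> cmod (H \<omega>) \<le> C" "\<And>\<omega>. \<omega> \<in> space M \<Longrightarrow> cmod (K \<omega>) \<le> C'"
    using assms unfolding bounded_at_def by auto
  have "cmod (H \<omega> * K \<omega>) \<le> \<bar>C\<bar> * \<bar>C'\<bar>" if "\<omega> \<in> space M" for \<omega>
    unfolding norm_mult using C[OF that] by (intro mult_mono) auto
  then show ?thesis using assms unfolding bounded_at_def by (auto intro!: borel_measurable_times)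
qed

lemma bounded_at_cnj: "bounded_at t H \<Longrightarrow> bounded_at t (\<lambda>\<omega>. cnj (H \<omega>))"
  unfolding bounded_at_def by auto

lemma bounded_at_uminus: "bounded_at t H \<Longrightarrow> bounded_at t (\<lambda>\<omega>. - H \<omega>)"
  unfolding bounded_at_def by auto

lemma integrable_bounded_at: "0 \<le> t \<Longrightarrow> bounded_at t H \<Longrightarrow> integrable M H"
  using bounded_at_integrable_mult[of t H "\<lambda>_. 1"] by simp

lemma W_increment_integrable:
  assumes "0 \<le> s" "s \<le> t"
  shows "integrable M (\<lambda>\<omega>. W t \<omega> - W s \<omega>)"
proof -
  have "has_bochner_integral M (\<lambda>\<omega>. 1 * (W t \<omega> - W s \<omega>)) 0"
    by (rule W_mean[OF assms]) simp_all
  then show ?thesis by (simp only: mult_1_left has_bochner_integral_iff)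
qed

lemma W_increment_measurable:
  "0 \<le> r \<Longrightarrow> r \<le> s \<Longrightarrow> s \<le> t \<Longrightarrow> (\<lambda>\<omega>. W s \<omega> - W r \<omega>) \<in> borel_measurable (F t)"
  by (intro borel_measurable_diff F_meas_mono[of s t] F_meas_mono[of r t] W_adapted) auto

lemma W_mean_cnj:
  assumes "0 \<le> s" "s \<le> t" "g \<in> borel_measurable (F s)" "integrable M g"
  shows "has_bochner_integral M (\<lambda>\<omega>. g \<omega> * cnj (W t \<omega> - W s \<omega>)) 0"
proof -
  have "has_bochner_integral M (\<lambda>\<omega>. cnj (g \<omega>) * (W t \<omega> - W s \<omega>)) 0"
    using assms by (intro W_mean) auto
  then have "has_bochner_integral M (\<lambda>\<omega>. cnj (cnj (g \<omega>) * (W t \<omega> - W s \<omega>))) (cnj 0)"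
    by (rule has_bochner_integral_bounded_linear[OF bounded_linear_cnj])
  then show ?thesis by simp
qed

text \<open>Past increments, being adapted, do not correlate with future ones; only the part of the two time
  intervals that they share contributes.\<close>

lemma W_increments_covariance_ordered:
  assumes a: "0 \<le> a" "a \<le> b" "0 \<le> a'" "a' \<le> b'" and le: "a \<le> a'"
    and H: "bounded_at a H" and H': "bounded_at a' H'"
  shows "has_bochner_integral M (\<lambda>\<omega>. (H \<omega> * (W b \<omega> - W a \<omega>)) * cnj (H' \<omega> * (W b' \<omega> - W a' \<omega>)))
     (complex_of_real (max 0 (min b b' - max a a')) * (\<integral>\<omega>. H \<omega> * cnj (H' \<omega>) \<partial>M))"
proof -
  define K where "K \<omega> = H \<omega> * cnj (H' \<omega>)" for \<omega>
  have K: "bounded_at a' K"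
    unfolding K_def by (intro bounded_at_times bounded_at_cnj H' bounded_at_mono[OF a(1) le H])
  have KX: "(\<lambda>\<omega>. K \<omega> * (W s \<omega> - W r \<omega>)) \<in> borel_measurable (F t)"
    "integrable M (\<lambda>\<omega>. K \<omega> * (W s \<omega> - W r \<omega>))" if "0 \<le> r" "r \<le> s" "s \<le> t" "a' \<le> t" for r s t
  proof -
    show "(\<lambda>\<omega>. K \<omega> * (W s \<omega> - W r \<omega>)) \<in> borel_measurable (F t)"
      by (intro borel_measurable_times W_increment_measurable that bounded_atD bounded_at_mono[OF a(3) that(4) K])
    show "integrable M (\<lambda>\<omega>. K \<omega> * (W s \<omega> - W r \<omega>))"
      by (rule bounded_at_integrable_mult[OF a(3) K W_increment_integrable[OF that(1,2)]])
  qed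
  show ?thesis
  proof (cases "b \<le> a'")
    case True
    have "has_bochner_integral M (\<lambda>\<omega>. (K \<omega> * (W b \<omega> - W a \<omega>)) * cnj (W b' \<omega> - W a' \<omega>)) 0"
      using True a by (intro W_mean_cnj KX) auto
    moreover have "max 0 (min b b' - max a a') = 0" using True le by auto
    ultimately show ?thesis by (simp add: K_def mult_ac)
  next
    case False
    define c where "c = min b b'"
    have c: "a' \<le> c" "c \<le> b" "c \<le> b'" using False a unfolding c_def by auto
    have c0: "0 \<le> c" using c a by simp
    have 1: "has_bochner_integral M (\<lambda>\<omega>. (K \<omega> * (W a' \<omega> - W a \<omega>)) * cnj (W b' \<omega> - W a' \<omega>)) 0"
      using a le by (intro W_mean_cnj KX) auto
    have 2: "has_bochner_integral M (\<lambda>\<omega>. (K \<omega> * (W c \<omega> - W a' \<omega>)) * cnj (W b' \<omega> - W c \<omega>)) 0"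
      using a c c0 by (intro W_mean_cnj KX) auto
    have 3: "has_bochner_integral M (\<lambda>\<omega>. K \<omega> * ((W c \<omega> - W a' \<omega>) * cnj (W c \<omega> - W a' \<omega>)))
        (complex_of_real (c - a') * (\<integral>\<omega>. K \<omega> \<partial>M))"
      using a c by (intro W_var bounded_atD[OF K] integrable_bounded_at[OF _ K]) auto
    have 4: "has_bochner_integral M (\<lambda>\<omega>. (K \<omega> * cnj (W c \<omega> - W a' \<omega>)) * (W b \<omega> - W c \<omega>)) 0"
    proof (rule W_mean[OF c0 c(2)])
      show "(\<lambda>\<omega>. K \<omega> * cnj (W c \<omega> - W a' \<omega>)) \<in> borel_measurable (F c)"
        using bounded_atD[OF bounded_at_mono[OF a(3) c(1) K]] W_increment_measurable[OF a(3) c(1) order_refl]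
        by (intro borel_measurable_times borel_measurable_cnj)
      have "integrable M (\<lambda>\<omega>. cnj (W c \<omega> - W a' \<omega>))"
        using integrable_bounded_linear[OF bounded_linear_cnj W_increment_integrable[OF a(3) c(1)]] .
      then show "integrable M (\<lambda>\<omega>. K \<omega> * cnj (W c \<omega> - W a' \<omega>))"
        by (rule bounded_at_integrable_mult[OF a(3) K])
    qed
    have 5: "K \<omega> * ((W b \<omega> - W a \<omega>) * cnj (W b' \<omega> - W a' \<omega>)) =
        (K \<omega> * (W a' \<omega> - W a \<omega>)) * cnj (W b' \<omega> - W a' \<omega>) +
        (K \<omega> * (W c \<omega> - W a' \<omega>)) * cnj (W b' \<omega> - W c \<omega>) +
        K \<omega> * ((W c \<omega> - W a' \<omega>) * cnj (W c \<omega> - W a' \<omega>)) +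
        (K \<omega> * cnj (W c \<omega> - W a' \<omega>)) * (W b \<omega> - W c \<omega>)" for \<omega>
    proof -
      have "W b \<omega> - W c \<omega> = 0 \<or> W b' \<omega> - W c \<omega> = 0" unfolding c_def by (simp add: min_def)
      then have "K \<omega> * ((W b \<omega> - W c \<omega>) * cnj (W b' \<omega> - W c \<omega>)) = 0" by auto
      then show ?thesis by (simp add: algebra_simps)
    qed
    have "max 0 (min b b' - max a a') = c - a'" using False le a unfolding c_def by auto
    moreover have "has_bochner_integral M (\<lambda>\<omega>. K \<omega> * ((W b \<omega> - W a \<omega>) * cnj (W b' \<omega> - W a' \<omega>)))
       (complex_of_real (c - a') * (\<integral>\<omega>. K \<omega> \<partial>M))"
      unfolding 5 using has_bochner_integral_add[OF has_bochner_integral_add[OF has_bochner_integral_add[OF 1 2] 3] 4]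
      by simp
    ultimately show ?thesis by (simp add: K_def mult_ac)
  qed
qed

lemma W_increments_covariance:
  assumes a: "0 \<le> a" "a \<le> b" "0 \<le> a'" "a' \<le> b'"
    and H: "bounded_at a H" and H': "bounded_at a' H'"
  shows "has_bochner_integral M (\<lambda>\<omega>. (H \<omega> * (W b \<omega> - W a \<omega>)) * cnj (H' \<omega> * (W b' \<omega> - W a' \<omega>)))
     (complex_of_real (max 0 (min b b' - max a a')) * (\<integral>\<omega>. H \<omega> * cnj (H' \<omega>) \<partial>M))"
proof (cases "a \<le> a'")
  case True then show ?thesis by (intro W_increments_covariance_ordered assms)
next
  case False
  have "has_bochner_integral M (\<lambda>\<omega>. (H' \<omega> * (W b' \<omega> - W a' \<omega>)) * cnj (H \<omega> * (W b \<omega> - W a \<omega>)))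
     (complex_of_real (max 0 (min b' b - max a' a)) * (\<integral>\<omega>. H' \<omega> * cnj (H \<omega>) \<partial>M))"
    using False by (intro W_increments_covariance_ordered assms) auto
  then have "has_bochner_integral M (\<lambda>\<omega>. cnj ((H' \<omega> * (W b' \<omega> - W a' \<omega>)) * cnj (H \<omega> * (W b \<omega> - W a \<omega>))))
     (cnj (complex_of_real (max 0 (min b' b - max a' a)) * (\<integral>\<omega>. H' \<omega> * cnj (H \<omega>) \<partial>M)))"
    by (rule has_bochner_integral_bounded_linear[OF bounded_linear_cnj])
  moreover have "cnj (\<integral>\<omega>. H' \<omega> * cnj (H \<omega>) \<partial>M) = (\<integral>\<omega>. H \<omega> * cnj (H' \<omega>) \<partial>M)"
  proof -
    have "cnj (\<integral>\<omega>. H' \<omega> * cnj (H \<omega>) \<partial>M) = (\<integral>\<omega>. cnj (H' \<omega> * cnj (H \<omega>)) \<partial>M)"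
      by (rule Bochner_Integration.integral_cnj[symmetric])
    also have "\<dots> = (\<integral>\<omega>. H \<omega> * cnj (H' \<omega>) \<partial>M)"
      by (rule Bochner_Integration.integral_cong) (auto simp: mult.commute)
    finally show ?thesis .
  qed
  ultimately show ?thesis by (simp add: mult_ac min.commute max.commute)
qed

section \<open>Elementary integrands\<close>

text \<open>The intervals may overlap, so sums and differences of elementary integrands are obtained by appending
  lists, without a common refinement of two partitions.\<close>

definition elementary :: "real \<Rightarrow> real \<Rightarrow> (real \<times> real \<times> ('a \<Rightarrow> complex)) list \<Rightarrow> bool" where
  "elementary T T' L \<longleftrightarrow> (\<forall>(a, b, H)\<in>set L. T \<le> a \<and> a \<le> b \<and> b \<le> T' \<and> bounded_at a H)"

definition eint :: "(real \<times> real \<times> ('a \<Rightarrow> complex)) list \<Rightarrow> 'a \<Rightarrow> complex" where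
  "eint L \<omega> = (\<Sum>(a, b, H)\<leftarrow>L. H \<omega> * (W b \<omega> - W a \<omega>))"

definition evalue :: "(real \<times> real \<times> ('a \<Rightarrow> complex)) list \<Rightarrow> real \<Rightarrow> 'a \<Rightarrow> complex" where
  "evalue L s \<omega> = (\<Sum>(a, b, H)\<leftarrow>L. H \<omega> * indicator {a<..b} s)"

lemma elementary_simps [simp]:
  "elementary T T' []"
  "elementary T T' ((a, b, H) # L) \<longleftrightarrow> (T \<le> a \<and> a \<le> b \<and> b \<le> T' \<and> bounded_at a H) \<and> elementary T T' L"
  "elementary T T' (L @ L') \<longleftrightarrow> elementary T T' L \<and> elementary T T' L'"
  by (simp_all add: elementary_def ball_Un)

lemma eint_simps [simp]:
  "eint [] \<omega> = 0" "eint ((a, b, H) # L) \<omega> = H \<omega> * (W b \<omega> - W a \<omega>) + eint L \<omega>"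
  "eint (L @ L') \<omega> = eint L \<omega> + eint L' \<omega>"
  by (simp_all add: eint_def)

lemma evalue_simps [simp]:
  "evalue [] s \<omega> = 0" "evalue ((a, b, H) # L) s \<omega> = H \<omega> * indicator {a<..b} s + evalue L s \<omega>"
  "evalue (L @ L') s \<omega> = evalue L s \<omega> + evalue L' s \<omega>"
  by (simp_all add: evalue_def)

lemma elementary_mono: "elementary T T' L \<Longrightarrow> S \<le> T \<Longrightarrow> T' \<le> S' \<Longrightarrow> elementary S S' L"
  unfolding elementary_def by fastforce

definition "eneg = map (\<lambda>(a :: real, b :: real, H :: 'a \<Rightarrow> complex). (a, b, \<lambda>\<omega>. - H \<omega>))"

lemma eneg: "elementary T T' L \<Longrightarrow> elementary T T' (eneg L)" "eint (eneg L) \<omega> = - eint L \<omega>"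
  "evalue (eneg L) s \<omega> = - evalue L s \<omega>"
proof -
  show "elementary T T' L \<Longrightarrow> elementary T T' (eneg L)"
    unfolding elementary_def eneg_def using bounded_at_uminus by fastforce
  show "eint (eneg L) \<omega> = - eint L \<omega>" by (induction L) (auto simp: eneg_def)
  show "evalue (eneg L) s \<omega> = - evalue L s \<omega>" by (induction L) (auto simp: eneg_def)
qed

lemma integrable_evalue_mult:
  "integrable lborel (\<lambda>s. evalue L s \<omega> * cnj (evalue L' s \<omega>))"
proof -
  have 1: "integrable lborel (\<lambda>s. (x * indicator {a<..b} s) * cnj (evalue L' s \<omega>))" for x a b
  proof (induction L')
    case (Cons e L')
    obtain a' b' H' where e: "e = (a', b', H')" by (cases e)
    have "(x * indicator {a<..b} s) * cnj (H' \<omega> * indicator {a'<..b'} s) =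
        indicat_real ({a<..b} \<inter> {a'<..b'}) s *\<^sub>R (x * cnj (H' \<omega>))" for s
      by (auto simp: indicator_def)
    moreover have "emeasure lborel ({a<..b} \<inter> {a'<..b'}) < \<infinity>"
      by (rule order.strict_trans1[OF emeasure_mono[of _ "{a..b}"]]) (auto simp: emeasure_lborel_Icc_eq)
    ultimately have "integrable lborel (\<lambda>s. (x * indicator {a<..b} s) * cnj (H' \<omega> * indicator {a'<..b'} s))"
      by (auto intro!: integrable_scaleR_left integrable_real_indicator)
    then show ?case using Cons by (simp add: e distrib_left)
  qed simp
  show ?thesis
  proof (induction L)
    case (Cons e L)
    obtain a b H where e: "e = (a, b, H)" by (cases e)
    show ?case using Bochner_Integration.integrable_add[OF 1[of "H \<omega>" a b] Cons]
      by (simp add: e distrib_right)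
  qed simp
qed

lemma interval_overlap:
  "(\<integral>s. (x * indicator {a<..b} s) * cnj (x' * indicator {a'<..b'} s) \<partial>lborel) =
     complex_of_real (max 0 (min b b' - max a a')) * (x * cnj x')" for a b a' b' :: real
proof -
  let ?I = "{max a a'<..min b b'}"
  have "(\<integral>s. (x * indicator {a<..b} s) * cnj (x' * indicator {a'<..b'} s) \<partial>lborel) =
      (\<integral>s. indicat_real ?I s *\<^sub>R (x * cnj x') \<partial>lborel)"
    by (rule Bochner_Integration.integral_cong) (auto simp: indicator_def)
  also have "\<dots> = measure lborel ?I *\<^sub>R (x * cnj x')"
  proof -
    have "emeasure lborel ?I \<le> emeasure lborel {a..b}" by (rule emeasure_mono) auto
    then have "emeasure lborel ?I < \<infinity>" by (rule order.strict_trans1) (simp add: emeasure_lborel_Icc_eq)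
    then have "has_bochner_integral lborel (\<lambda>s. indicat_real ?I s *\<^sub>R (x * cnj x')) (measure lborel ?I *\<^sub>R (x * cnj x'))"
      by (intro has_bochner_integral_indicator) auto
    then show ?thesis by (rule has_bochner_integral_integral_eq)
  qed
  also have "measure lborel ?I = max 0 (min b b' - max a a')"
    by (cases "max a a' \<le> min b b'") (auto simp: max_def min_def split: if_splits)
  finally show ?thesis by (simp only: scaleR_conv_of_real)
qed

text \<open>Both sides are bilinear in the integrands, which reduces the identity to one interval on each side.\<close>

lemma eint_covariance:
  assumes "elementary 0 T L" "elementary 0 T L'"
  shows "integrable M (\<lambda>\<omega>. eint L \<omega> * cnj (eint L' \<omega>)) \<and>
    integrable M (\<lambda>\<omega>. \<integral>s. evalue L s \<omega> * cnj (evalue L' s \<omega>) \<partial>lborel) \<and>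
    (\<integral>\<omega>. eint L \<omega> * cnj (eint L' \<omega>) \<partial>M) = (\<integral>\<omega>. \<integral>s. evalue L s \<omega> * cnj (evalue L' s \<omega>) \<partial>lborel \<partial>M)"
proof -
  define P where "P f g \<longleftrightarrow> integrable M f \<and> integrable M g \<and> (\<integral>\<omega>. f \<omega> \<partial>M) = (\<integral>\<omega>. g \<omega> \<partial>M)"
    for f g :: "'a \<Rightarrow> complex"
  have P_add: "P (\<lambda>\<omega>. f \<omega> + f' \<omega>) (\<lambda>\<omega>. g \<omega> + g' \<omega>)" if "P f g" "P f' g'" for f g f' g'
    using that unfolding P_def by simp
  have 1: "P (\<lambda>\<omega>. (H \<omega> * (W b \<omega> - W a \<omega>)) * cnj (eint L' \<omega>))
      (\<lambda>\<omega>. \<integral>s. (H \<omega> * indicator {a<..b} s) * cnj (evalue L' s \<omega>) \<partial>lborel)"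
    if e: "elementary 0 T [(a, b, H)]" and "elementary 0 T L'" for a b H L'
    using that(2)
  proof (induction L')
    case (Cons e' L')
    obtain a' b' H' where e': "e' = (a', b', H')" by (cases e')
    let ?l = "complex_of_real (max 0 (min b b' - max a a'))"
    have "has_bochner_integral M (\<lambda>\<omega>. (H \<omega> * (W b \<omega> - W a \<omega>)) * cnj (H' \<omega> * (W b' \<omega> - W a' \<omega>)))
     (?l * (\<integral>\<omega>. H \<omega> * cnj (H' \<omega>) \<partial>M))"
      using e Cons.prems unfolding e' by (intro W_increments_covariance) auto
    moreover have "integrable M (\<lambda>\<omega>. H \<omega> * cnj (H' \<omega>))"
    proof (rule bounded_at_integrable_mult[of a])
      show "integrable M (\<lambda>\<omega>. cnj (H' \<omega>))"
        using Cons.prems unfolding e' by (intro integrable_bounded_at[of a'] bounded_at_cnj) auto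
    qed (use e in auto)
    ultimately have "P (\<lambda>\<omega>. (H \<omega> * (W b \<omega> - W a \<omega>)) * cnj (H' \<omega> * (W b' \<omega> - W a' \<omega>)))
       (\<lambda>\<omega>. ?l * (H \<omega> * cnj (H' \<omega>)))"
      unfolding P_def by (simp add: has_bochner_integral_iff)
    then have *: "P (\<lambda>\<omega>. (H \<omega> * (W b \<omega> - W a \<omega>)) * cnj (H' \<omega> * (W b' \<omega> - W a' \<omega>)))
       (\<lambda>\<omega>. \<integral>s. (H \<omega> * indicator {a<..b} s) * cnj (H' \<omega> * indicator {a'<..b'} s) \<partial>lborel)"
      unfolding interval_overlap .
    have **: "(\<integral>s. (H \<omega> * indicator {a<..b} s) * cnj (evalue (e' # L') s \<omega>) \<partial>lborel) =
       (\<integral>s. (H \<omega> * indicator {a<..b} s) * cnj (H' \<omega> * indicator {a'<..b'} s) \<partial>lborel) +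
       (\<integral>s. (H \<omega> * indicator {a<..b} s) * cnj (evalue L' s \<omega>) \<partial>lborel)" for \<omega>
    proof (subst Bochner_Integration.integral_add[symmetric])
      show "integrable lborel (\<lambda>s. (H \<omega> * indicator {a<..b} s) * cnj (H' \<omega> * indicator {a'<..b'} s))"
        using integrable_evalue_mult[of "[(a, b, H)]" \<omega> "[(a', b', H')]"] by simp
      show "integrable lborel (\<lambda>s. (H \<omega> * indicator {a<..b} s) * cnj (evalue L' s \<omega>))"
        using integrable_evalue_mult[of "[(a, b, H)]" \<omega> L'] by simp
    qed (simp add: e' distrib_left)
    have "elementary 0 T L'" using Cons.prems by (simp add: e')
    from P_add[OF * Cons.IH[OF this]] show ?case
      unfolding ** by (simp add: e' distrib_left)
  qed (simp add: P_def)
  have "P (\<lambda>\<omega>. eint L \<omega> * cnj (eint L' \<omega>)) (\<lambda>\<omega>. \<integral>s. evalue L s \<omega> * cnj (evalue L' s \<omega>) \<partial>lborel)"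
    using assms(1)
  proof (induction L)
    case (Cons e L)
    obtain a b H where e: "e = (a, b, H)" by (cases e)
    have el: "elementary 0 T [(a, b, H)]" "elementary 0 T L" using Cons.prems by (simp_all add: e)
    have **: "(\<integral>s. evalue (e # L) s \<omega> * cnj (evalue L' s \<omega>) \<partial>lborel) =
       (\<integral>s. (H \<omega> * indicator {a<..b} s) * cnj (evalue L' s \<omega>) \<partial>lborel) +
       (\<integral>s. evalue L s \<omega> * cnj (evalue L' s \<omega>) \<partial>lborel)" for \<omega>
    proof (subst Bochner_Integration.integral_add[symmetric])
      show "integrable lborel (\<lambda>s. (H \<omega> * indicator {a<..b} s) * cnj (evalue L' s \<omega>))"
        using integrable_evalue_mult[of "[(a, b, H)]" \<omega> L'] by simp
    qed (auto simp: e distrib_right intro: integrable_evalue_mult)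
    from P_add[OF 1[OF el(1) assms(2)] Cons.IH[OF el(2)]] show ?case
      unfolding ** by (simp add: e distrib_right)
  qed (simp add: P_def)
  then show ?thesis unfolding P_def .
qed

lemma ito_isometry:
  assumes L: "elementary 0 T L"
  shows "(\<integral>\<^sup>+\<omega>. ennreal ((cmod (eint L \<omega>))\<^sup>2) \<partial>M) =
    (\<integral>\<^sup>+\<omega>. \<integral>\<^sup>+s. ennreal ((cmod (evalue L s \<omega>))\<^sup>2) \<partial>lborel \<partial>M)"
proof -
  have int: "integrable lborel (\<lambda>s. (cmod (evalue L s \<omega>))\<^sup>2)" for \<omega>
    using integrable_Re[OF integrable_evalue_mult[of L \<omega> L]] by (simp add: complex_mult_cnj cmod_def)
  have eq: "(\<integral>s. evalue L s \<omega> * cnj (evalue L s \<omega>) \<partial>lborel) = complex_of_real (\<integral>s. (cmod (evalue L s \<omega>))\<^sup>2 \<partial>lborel)" for \<omega>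
    unfolding complex_norm_square[symmetric] integral_complex_of_real ..
  have eq': "eint L \<omega> * cnj (eint L \<omega>) = complex_of_real ((cmod (eint L \<omega>))\<^sup>2)" for \<omega>
    by (rule complex_norm_square[symmetric])
  note c = eint_covariance[OF L L]
  have i1: "integrable M (\<lambda>\<omega>. (cmod (eint L \<omega>))\<^sup>2)"
    using integrable_Re[OF conjunct1[OF c]] unfolding eq' by simp
  have i2: "integrable M (\<lambda>\<omega>. \<integral>s. (cmod (evalue L s \<omega>))\<^sup>2 \<partial>lborel)"
    using integrable_Re[OF conjunct1[OF conjunct2[OF c]]] unfolding eq by simp
  have i3: "(\<integral>\<omega>. (cmod (eint L \<omega>))\<^sup>2 \<partial>M) = (\<integral>\<omega>. \<integral>s. (cmod (evalue L s \<omega>))\<^sup>2 \<partial>lborel \<partial>M)"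
    using conjunct2[OF conjunct2[OF c]] unfolding eq eq' integral_complex_of_real of_real_eq_iff .
  have "(\<integral>\<^sup>+\<omega>. ennreal ((cmod (eint L \<omega>))\<^sup>2) \<partial>M) = ennreal (\<integral>\<omega>. (cmod (eint L \<omega>))\<^sup>2 \<partial>M)"
    by (rule nn_integral_eq_integral[OF i1]) simp
  also have "\<dots> = (\<integral>\<^sup>+\<omega>. ennreal (\<integral>s. (cmod (evalue L s \<omega>))\<^sup>2 \<partial>lborel) \<partial>M)"
    unfolding i3 by (rule nn_integral_eq_integral[OF i2, symmetric]) simp
  also have "\<dots> = (\<integral>\<^sup>+\<omega>. \<integral>\<^sup>+s. ennreal ((cmod (evalue L s \<omega>))\<^sup>2) \<partial>lborel \<partial>M)"
    by (intro nn_integral_cong nn_integral_eq_integral[OF int, symmetric]) simp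
  finally show ?thesis .
qed

end

section \<open>Increments of the Ito integral\<close>

lemma tendsto_0_ennreal_mult:
  fixes f :: "nat \<Rightarrow> ennreal"
  assumes "f \<longlonglongrightarrow> 0" "c < \<top>" shows "(\<lambda>m. c * f m) \<longlonglongrightarrow> 0"
  using ennreal_tendsto_cmult[OF assms(2,1)] by simp

context complex_noise
begin

text \<open>An elementary integrand is cut at time \<open>T\<close>. In the later part the intervals that end before \<open>T\<close> become
  empty intervals at \<open>T\<close>, where their coefficients are adapted as well.\<close>

definition ebefore :: "real \<Rightarrow> (real \<times> real \<times> ('a \<Rightarrow> complex)) list \<Rightarrow> (real \<times> real \<times> ('a \<Rightarrow> complex)) list" where
  "ebefore T L = map (\<lambda>(a, b, H). (a, min b T, H)) (filter (\<lambda>(a, b, H). a \<le> T) L)"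

definition eafter :: "real \<Rightarrow> (real \<times> real \<times> ('a \<Rightarrow> complex)) list \<Rightarrow> (real \<times> real \<times> ('a \<Rightarrow> complex)) list" where
  "eafter T L = map (\<lambda>(a, b, H). (max a T, max b T, H)) L"

lemma ebefore_simps [simp]:
  "ebefore T [] = []"
  "ebefore T ((a, b, H) # L) = (if a \<le> T then (a, min b T, H) # ebefore T L else ebefore T L)"
  by (simp_all add: ebefore_def)

lemma eafter_simps [simp]:
  "eafter T [] = []" "eafter T ((a, b, H) # L) = (max a T, max b T, H) # eafter T L"
  by (simp_all add: eafter_def)

lemma elementary_ebefore: "elementary 0 T' L \<Longrightarrow> elementary 0 T (ebefore T L)"
  unfolding elementary_def ebefore_def by fastforce

lemma elementary_eafter: "elementary 0 T' L \<Longrightarrow> 0 \<le> T \<Longrightarrow> T \<le> T' \<Longrightarrow> elementary T T' (eafter T L)"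
proof (induction L)
  case (Cons e L)
  obtain a b H where e: "e = (a, b, H)" by (cases e)
  have "0 \<le> a" "a \<le> b" "b \<le> T'" "bounded_at a H" "elementary T T' (eafter T L)" using Cons by (auto simp: e)
  moreover have "bounded_at (max a T) H"
    by (rule bounded_at_mono[of a]) (use calculation in auto)
  ultimately show ?case using Cons.prems by (simp add: e)
qed simp

lemma eint_split: "elementary 0 T' L \<Longrightarrow> eint L \<omega> = eint (ebefore T L) \<omega> + eint (eafter T L) \<omega>"
proof (induction L)
  case (Cons e L)
  obtain a b H where e: "e = (a, b, H)" by (cases e)
  have "a \<le> b" "elementary 0 T' L" using Cons.prems by (auto simp: e)
  then show ?case using Cons.IH
    by (cases "a \<le> T"; cases "b \<le> T") (simp_all add: e min_def max_def algebra_simps)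
qed simp

lemma evalue_before: "elementary 0 T' L \<Longrightarrow> evalue (ebefore T L) s \<omega> = indicator {..T} s * evalue L s \<omega>"
proof (induction L)
  case (Cons e L)
  obtain a b H where e: "e = (a, b, H)" by (cases e)
  have "a \<le> b" "elementary 0 T' L" using Cons.prems by (auto simp: e)
  then show ?case using Cons.IH
    by (auto simp: e min_def indicator_def distrib_left)
qed simp

lemma evalue_after: "elementary 0 T' L \<Longrightarrow> evalue (eafter T L) s \<omega> = indicator {T<..} s * evalue L s \<omega>"
proof (induction L)
  case (Cons e L)
  obtain a b H where e: "e = (a, b, H)" by (cases e)
  have "a \<le> b" "elementary 0 T' L" using Cons.prems by (auto simp: e)
  then show ?case using Cons.IH
    by (auto simp: e max_def indicator_def distrib_left)
qed simp

lemma evalue_outside: "elementary T T' L \<Longrightarrow> s \<notin> {T<..T'} \<Longrightarrow> evalue L s \<omega> = 0"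
  by (induction L) (auto simp: indicator_def)

lemma simple_process_elementary:
  assumes "simple_process M F T n t H"
  shows "\<exists>L. elementary 0 T L \<and> (\<forall>\<omega>. eint L \<omega> = simple_integral n t H W \<omega>) \<and>
    (\<forall>s \<omega>. evalue L s \<omega> = simple_value n t H s \<omega>)"
proof -
  have t: "t 0 = 0" "t n = T" "\<And>k. k < n \<Longrightarrow> t k \<le> t (Suc k)"
    "\<And>k. k < n \<Longrightarrow> bounded_at (t k) (H k)"
    using assms unfolding simple_process_def bounded_at_def by auto
  have mono: "t i \<le> t j" if "i \<le> j" "j \<le> n" for i j
    using that
  proof (induction j)
    case (Suc j)
    then show ?case using t(3)[of j] by (cases "i = Suc j") (auto simp: le_Suc_eq)
  qed simp
  define L where "L = map (\<lambda>k. (t k, t (Suc k), H k)) [0..<n]"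
  have "elementary 0 T L"
    unfolding elementary_def L_def using t(1,2,4) mono[of 0] mono[of _ n] t(3) by auto
  moreover have "eint L \<omega> = simple_integral n t H W \<omega>" for \<omega>
    unfolding eint_def L_def simple_integral_def
    by (simp add: o_def sum_list_distinct_conv_sum_set atLeast0LessThan)
  moreover have "evalue L s \<omega> = simple_value n t H s \<omega>" for s \<omega>
    unfolding evalue_def L_def simple_value_def
    by (simp add: o_def sum_list_distinct_conv_sum_set atLeast0LessThan)
  ultimately show ?thesis by blast
qed

lemma has_ito_integral_elementary:
  assumes "has_ito_integral M F W T X I"
  shows "I \<in> borel_measurable M" "\<exists>L. (\<forall>m. elementary 0 T (L m)) \<and>
        (\<lambda>m. \<integral>\<^sup>+\<omega>. (\<integral>\<^sup>+s\<in>{0..T}. ennreal ((cmod (evalue (L m) s \<omega> - X s \<omega>))\<^sup>2) \<partial>lborel) \<partial>M) \<longlonglongrightarrow> 0 \<and>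
        (\<lambda>m. \<integral>\<^sup>+\<omega>. ennreal ((cmod (eint (L m) \<omega> - I \<omega>))\<^sup>2) \<partial>M) \<longlonglongrightarrow> 0"
proof -
  show "I \<in> borel_measurable M" using assms unfolding has_ito_integral_def by simp
  obtain n t H where *: "\<And>m. simple_process M F T (n m) (t m) (H m)"
     "(\<lambda>m. \<integral>\<^sup>+\<omega>. (\<integral>\<^sup>+s\<in>{0..T}. ennreal ((cmod (simple_value (n m) (t m) (H m) s \<omega> - X s \<omega>))\<^sup>2) \<partial>lborel) \<partial>M) \<longlonglongrightarrow> 0"
     "(\<lambda>m. \<integral>\<^sup>+\<omega>. ennreal ((cmod (simple_integral (n m) (t m) (H m) W \<omega> - I \<omega>))\<^sup>2) \<partial>M) \<longlonglongrightarrow> 0"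
    using assms unfolding has_ito_integral_def by blast
  from simple_process_elementary[OF *(1)] obtain L where
    L: "\<And>m. elementary 0 T (L m)" "\<And>m \<omega>. eint (L m) \<omega> = simple_integral (n m) (t m) (H m) W \<omega>"
      "\<And>m s \<omega>. evalue (L m) s \<omega> = simple_value (n m) (t m) (H m) s \<omega>" by metis
  show "\<exists>L. (\<forall>m. elementary 0 T (L m)) \<and>
        (\<lambda>m. \<integral>\<^sup>+\<omega>. (\<integral>\<^sup>+s\<in>{0..T}. ennreal ((cmod (evalue (L m) s \<omega> - X s \<omega>))\<^sup>2) \<partial>lborel) \<partial>M) \<longlonglongrightarrow> 0 \<and>
        (\<lambda>m. \<integral>\<^sup>+\<omega>. ennreal ((cmod (eint (L m) \<omega> - I \<omega>))\<^sup>2) \<partial>M) \<longlonglongrightarrow> 0"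
    by (rule exI[of _ L]) (use L *(2,3) in simp)
qed

lemma evalue_measurable [measurable]:
  assumes "elementary 0 T L"
  shows "(\<lambda>(\<omega>, s). evalue L s \<omega>) \<in> borel_measurable (M \<Otimes>\<^sub>M lborel)"
  using assms
proof (induction L)
  case (Cons e L)
  obtain a b H where e: "e = (a, b, H)" by (cases e)
  have 1: "(\<lambda>x. evalue L (snd x) (fst x)) \<in> borel_measurable (M \<Otimes>\<^sub>M lborel)"
    using Cons by (simp add: e case_prod_unfold)
  have [measurable]: "H \<in> borel_measurable M"
    using Cons.prems by (auto simp: e bounded_at_def intro: F_meas_M)
  have "(\<lambda>x. H (fst x) * indicator {a<..b} (snd x)) \<in> borel_measurable (M \<Otimes>\<^sub>M lborel)"
    by measurable
  with 1 show ?case by (simp add: e case_prod_unfold)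
qed simp

lemma eint_measurable [measurable]:
  assumes "elementary 0 T L" shows "eint L \<in> borel_measurable M"
  using assms
proof (induction L)
  case (Cons e L)
  obtain a b H where e: "e = (a, b, H)" by (cases e)
  have "0 \<le> a" "a \<le> b" "H \<in> borel_measurable (F a)" using Cons.prems by (auto simp: e bounded_at_def)
  then have "0 \<le> b" by simp
  have [measurable]: "H \<in> borel_measurable M" by (rule F_meas_M) fact+
  have [measurable]: "W a \<in> borel_measurable M" by (rule F_meas_M[OF _ W_adapted]) fact+
  have [measurable]: "W b \<in> borel_measurable M" by (rule F_meas_M[OF _ W_adapted]) fact+
  have [measurable]: "eint L \<in> borel_measurable M" using Cons by (simp add: e)
  have "(\<lambda>\<omega>. H \<omega> * (W b \<omega> - W a \<omega>) + eint L \<omega>) \<in> borel_measurable M" by measurable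
  then show ?case by (simp add: e)
next
  case Nil
  have "eint [] = (\<lambda>_. 0)" by (simp add: fun_eq_iff)
  then show ?case by simp
qed

text \<open>The squared norm in \<open>L\<^sup>2\<close> of time and chance, with the time restricted to \<open>S\<close>.\<close>

definition energy :: "real set \<Rightarrow> (real \<Rightarrow> 'a \<Rightarrow> complex) \<Rightarrow> ennreal" where
  "energy S Y = (\<integral>\<^sup>+\<omega>. (\<integral>\<^sup>+s\<in>S. ennreal ((cmod (Y s \<omega>))\<^sup>2) \<partial>lborel) \<partial>M)"

lemma energy_add:
  assumes [measurable]: "(\<lambda>(\<omega>, s). Y s \<omega>) \<in> borel_measurable (M \<Otimes>\<^sub>M lborel)"
    "(\<lambda>(\<omega>, s). Z s \<omega>) \<in> borel_measurable (M \<Otimes>\<^sub>M lborel)" "S \<in> sets borel"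
  shows "energy S (\<lambda>s \<omega>. Y s \<omega> + Z s \<omega>) \<le> 2 * energy S Y + 2 * energy S Z"
proof -
  have [measurable]: "(\<lambda>x. Y (snd x) (fst x)) \<in> borel_measurable (M \<Otimes>\<^sub>M lborel)"
    "(\<lambda>x. Z (snd x) (fst x)) \<in> borel_measurable (M \<Otimes>\<^sub>M lborel)"
    using assms by (simp_all add: case_prod_unfold)
  have 1: "(\<lambda>\<omega>. \<integral>\<^sup>+s\<in>S. ennreal ((cmod (Y s \<omega>))\<^sup>2) \<partial>lborel) \<in> borel_measurable M"
    "(\<lambda>\<omega>. \<integral>\<^sup>+s\<in>S. ennreal ((cmod (Z s \<omega>))\<^sup>2) \<partial>lborel) \<in> borel_measurable M"
    by measurable
  have 2: "(\<lambda>s. Y s \<omega>) \<in> borel_measurable lborel" "(\<lambda>s. Z s \<omega>) \<in> borel_measurable lborel" if "\<omega> \<in> space M" for \<omega>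
    using measurable_Pair2[OF assms(1) that] measurable_Pair2[OF assms(2) that] by simp_all
  have "energy S (\<lambda>s \<omega>. Y s \<omega> + Z s \<omega>) \<le>
     (\<integral>\<^sup>+\<omega>. (\<integral>\<^sup>+s\<in>S. (2 * ennreal ((cmod (Y s \<omega>))\<^sup>2) + 2 * ennreal ((cmod (Z s \<omega>))\<^sup>2)) \<partial>lborel) \<partial>M)"
    unfolding energy_def by (intro nn_integral_mono mult_right_mono ennreal_norm_sum_squared_le) auto
  also have "\<dots> = (\<integral>\<^sup>+\<omega>. 2 * (\<integral>\<^sup>+s\<in>S. ennreal ((cmod (Y s \<omega>))\<^sup>2) \<partial>lborel) +
      2 * (\<integral>\<^sup>+s\<in>S. ennreal ((cmod (Z s \<omega>))\<^sup>2) \<partial>lborel) \<partial>M)"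
  proof (intro nn_integral_cong)
    fix \<omega> assume \<omega>: "\<omega> \<in> space M"
    note [measurable] = 2[OF \<omega>]
    show "(\<integral>\<^sup>+s\<in>S. (2 * ennreal ((cmod (Y s \<omega>))\<^sup>2) + 2 * ennreal ((cmod (Z s \<omega>))\<^sup>2)) \<partial>lborel) =
       2 * (\<integral>\<^sup>+s\<in>S. ennreal ((cmod (Y s \<omega>))\<^sup>2) \<partial>lborel) + 2 * (\<integral>\<^sup>+s\<in>S. ennreal ((cmod (Z s \<omega>))\<^sup>2) \<partial>lborel)"
      by (simp add: distrib_right nn_integral_add nn_integral_cmult mult.assoc)
  qed
  also have "\<dots> = 2 * energy S Y + 2 * energy S Z"
    unfolding energy_def using 1 by (simp add: nn_integral_add nn_integral_cmult)
  finally show ?thesis .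
qed

lemma energy_evalue:
  assumes "elementary T T' L" "0 \<le> T" "{T<..T'} \<subseteq> S"
  shows "(\<integral>\<^sup>+\<omega>. ennreal ((cmod (eint L \<omega>))\<^sup>2) \<partial>M) = energy S (evalue L)"
proof -
  have "elementary 0 T' L" using assms by (auto intro: elementary_mono)
  from ito_isometry[OF this] show ?thesis
    unfolding energy_def
  proof (rule trans, intro nn_integral_cong)
    fix \<omega> s
    show "ennreal ((cmod (evalue L s \<omega>))\<^sup>2) = ennreal ((cmod (evalue L s \<omega>))\<^sup>2) * indicator S s"
    proof (cases "s \<in> S")
      case False
      then have "s \<notin> {T<..T'}" using assms(3) by blast
      then show ?thesis using evalue_outside[OF assms(1)] False by simp
    qed simp
  qed
qed

lemma energy_mono:
  assumes "\<And>s \<omega>. \<omega> \<in> space M \<Longrightarrow> s \<in> S \<Longrightarrow> s \<in> S' \<and> cmod (Y s \<omega>) \<le> cmod (Z s \<omega>)"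
  shows "energy S Y \<le> energy S' Z"
  unfolding energy_def
proof (intro nn_integral_mono)
  fix \<omega> s assume "\<omega> \<in> space M"
  then show "ennreal ((cmod (Y s \<omega>))\<^sup>2) * indicator S s \<le> ennreal ((cmod (Z s \<omega>))\<^sup>2) * indicator S' s"
    using assms[of \<omega> s] by (auto simp: indicator_def intro!: ennreal_leI power_mono)
qed

lemma nn_integral_square_add:
  assumes [measurable]: "f \<in> borel_measurable M" "g \<in> borel_measurable M"
  shows "(\<integral>\<^sup>+\<omega>. ennreal ((cmod (f \<omega> + g \<omega>))\<^sup>2) \<partial>M) \<le>
     2 * (\<integral>\<^sup>+\<omega>. ennreal ((cmod (f \<omega>))\<^sup>2) \<partial>M) + 2 * (\<integral>\<^sup>+\<omega>. ennreal ((cmod (g \<omega>))\<^sup>2) \<partial>M)"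
proof -
  have "(\<integral>\<^sup>+\<omega>. ennreal ((cmod (f \<omega> + g \<omega>))\<^sup>2) \<partial>M) \<le>
      (\<integral>\<^sup>+\<omega>. 2 * ennreal ((cmod (f \<omega>))\<^sup>2) + 2 * ennreal ((cmod (g \<omega>))\<^sup>2) \<partial>M)"
    by (intro nn_integral_mono ennreal_norm_sum_squared_le)
  then show ?thesis by (simp add: nn_integral_add nn_integral_cmult)
qed

text \<open>The approximations on \<open>{0..T'}\<close>, cut at \<open>T\<close>, serve on \<open>{T<..T'}\<close>. Their earlier parts and the
  approximations on \<open>{0..T}\<close> approach the same integrand, so by the isometry the difference of their
  integrals vanishes in the limit.\<close>

lemma ito_increment_elementary:
  assumes T: "0 \<le> T" "T \<le> T'"
    and X [measurable]: "(\<lambda>(\<omega>, s). X s \<omega>) \<in> borel_measurable (M \<Otimes>\<^sub>M lborel)"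
    and I: "has_ito_integral M F W T X I" and I': "has_ito_integral M F W T' X I'"
  shows "\<exists>L. (\<forall>m. elementary T T' (L m)) \<and>
      (\<lambda>m. energy {T<..T'} (\<lambda>s \<omega>. evalue (L m) s \<omega> - X s \<omega>)) \<longlonglongrightarrow> 0 \<and>
      (\<lambda>m. \<integral>\<^sup>+\<omega>. ennreal ((cmod (eint (L m) \<omega> - (I' \<omega> - I \<omega>)))\<^sup>2) \<partial>M) \<longlonglongrightarrow> 0"
proof -
  obtain S where S: "\<And>m. elementary 0 T (S m)"
    "(\<lambda>m. energy {0..T} (\<lambda>s \<omega>. evalue (S m) s \<omega> - X s \<omega>)) \<longlonglongrightarrow> 0"
    "(\<lambda>m. \<integral>\<^sup>+\<omega>. ennreal ((cmod (eint (S m) \<omega> - I \<omega>))\<^sup>2) \<partial>M) \<longlonglongrightarrow> 0"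
    using has_ito_integral_elementary(2)[OF I] unfolding energy_def by blast
  obtain S' where S': "\<And>m. elementary 0 T' (S' m)"
    "(\<lambda>m. energy {0..T'} (\<lambda>s \<omega>. evalue (S' m) s \<omega> - X s \<omega>)) \<longlonglongrightarrow> 0"
    "(\<lambda>m. \<integral>\<^sup>+\<omega>. ennreal ((cmod (eint (S' m) \<omega> - I' \<omega>))\<^sup>2) \<partial>M) \<longlonglongrightarrow> 0"
    using has_ito_integral_elementary(2)[OF I'] unfolding energy_def by blast
  have [measurable]: "I \<in> borel_measurable M" "I' \<in> borel_measurable M"
    using has_ito_integral_elementary(1) I I' by auto
  note [measurable] = eint_measurable[OF S(1)] eint_measurable[OF S'(1)]
  have X': "(\<lambda>x. X (snd x) (fst x)) \<in> borel_measurable (M \<Otimes>\<^sub>M lborel)"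
    using X by (simp add: case_prod_unfold)
  have diff: "(\<lambda>(\<omega>, s). evalue L s \<omega> - X s \<omega>) \<in> borel_measurable (M \<Otimes>\<^sub>M lborel)"
     "(\<lambda>(\<omega>, s). X s \<omega> - evalue L s \<omega>) \<in> borel_measurable (M \<Otimes>\<^sub>M lborel)"
    if "elementary 0 R L" for R L
    using evalue_measurable[OF that] X' by (auto simp: case_prod_unfold intro!: borel_measurable_diff)
  define L where "L m = eafter T (S' m)" for m
  have L: "elementary T T' (L m)" for m unfolding L_def by (rule elementary_eafter[OF S'(1) T])
  have "energy {T<..T'} (\<lambda>s \<omega>. evalue (L m) s \<omega> - X s \<omega>) \<le> energy {0..T'} (\<lambda>s \<omega>. evalue (S' m) s \<omega> - X s \<omega>)" for m
    unfolding L_def evalue_after[OF S'(1)] using T by (intro energy_mono) auto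
  then have lim1: "(\<lambda>m. energy {T<..T'} (\<lambda>s \<omega>. evalue (L m) s \<omega> - X s \<omega>)) \<longlonglongrightarrow> 0"
    by (intro tendsto_sandwich[OF _ _ tendsto_const S'(2)] always_eventually) auto
  define E where "E m = ebefore T (S' m) @ eneg (S m)" for m
  have E: "elementary 0 T (E m)" for m
    unfolding E_def using elementary_ebefore[OF S'(1)] eneg(1)[OF S(1)] by simp
  have "(\<integral>\<^sup>+\<omega>. ennreal ((cmod (eint (E m) \<omega>))\<^sup>2) \<partial>M) \<le>
      2 * energy {0..T'} (\<lambda>s \<omega>. evalue (S' m) s \<omega> - X s \<omega>) + 2 * energy {0..T} (\<lambda>s \<omega>. evalue (S m) s \<omega> - X s \<omega>)" for m
  proof -
    have "(\<integral>\<^sup>+\<omega>. ennreal ((cmod (eint (E m) \<omega>))\<^sup>2) \<partial>M) = energy {0..T} (evalue (E m))"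
      by (rule energy_evalue[OF E]) auto
    also have "\<dots> \<le> energy {0..T} (\<lambda>s \<omega>. (evalue (S' m) s \<omega> - X s \<omega>) + (X s \<omega> - evalue (S m) s \<omega>))"
      by (intro energy_mono) (simp add: E_def eneg evalue_before[OF S'(1)])
    also have "\<dots> \<le> 2 * energy {0..T} (\<lambda>s \<omega>. evalue (S' m) s \<omega> - X s \<omega>) + 2 * energy {0..T} (\<lambda>s \<omega>. X s \<omega> - evalue (S m) s \<omega>)"
      by (intro energy_add diff(1)[OF S'(1)] diff(2)[OF S(1)]) auto
    also have "energy {0..T} (\<lambda>s \<omega>. X s \<omega> - evalue (S m) s \<omega>) = energy {0..T} (\<lambda>s \<omega>. evalue (S m) s \<omega> - X s \<omega>)"
      unfolding energy_def by (simp add: norm_minus_commute)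
    also have "energy {0..T} (\<lambda>s \<omega>. evalue (S' m) s \<omega> - X s \<omega>) \<le> energy {0..T'} (\<lambda>s \<omega>. evalue (S' m) s \<omega> - X s \<omega>)"
      using T by (intro energy_mono) auto
    finally show ?thesis by (simp add: add_right_mono mult_left_mono)
  qed
  moreover have "(\<lambda>m. 2 * energy {0..T'} (\<lambda>s \<omega>. evalue (S' m) s \<omega> - X s \<omega>) + 2 * energy {0..T} (\<lambda>s \<omega>. evalue (S m) s \<omega> - X s \<omega>)) \<longlonglongrightarrow> 0 + 0"
    by (intro tendsto_add tendsto_0_ennreal_mult S S') auto
  ultimately have limE: "(\<lambda>m. \<integral>\<^sup>+\<omega>. ennreal ((cmod (eint (E m) \<omega>))\<^sup>2) \<partial>M) \<longlonglongrightarrow> 0"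
    by (intro tendsto_sandwich[OF _ _ tendsto_const, of _ "\<lambda>m. \<integral>\<^sup>+\<omega>. ennreal ((cmod (eint (E m) \<omega>))\<^sup>2) \<partial>M" sequentially]
          always_eventually) auto
  note [measurable] = eint_measurable[OF E]
  let ?n = "\<lambda>f. \<integral>\<^sup>+\<omega>. ennreal ((cmod (f \<omega>))\<^sup>2) \<partial>M"
  have "?n (\<lambda>\<omega>. eint (L m) \<omega> - (I' \<omega> - I \<omega>)) \<le>
      2 * (2 * ?n (\<lambda>\<omega>. eint (S' m) \<omega> - I' \<omega>) + 2 * ?n (\<lambda>\<omega>. eint (S m) \<omega> - I \<omega>)) + 2 * ?n (eint (E m))" for m
  proof -
    have "?n (\<lambda>\<omega>. eint (L m) \<omega> - (I' \<omega> - I \<omega>)) =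
       ?n (\<lambda>\<omega>. ((eint (S' m) \<omega> - I' \<omega>) + - (eint (S m) \<omega> - I \<omega>)) + - eint (E m) \<omega>)"
      unfolding L_def E_def eint_simps(3) eneg(2) eint_split[OF S'(1), of _ _ T]
      by (intro nn_integral_cong) (simp add: algebra_simps)
    also have "\<dots> \<le> 2 * ?n (\<lambda>\<omega>. (eint (S' m) \<omega> - I' \<omega>) + - (eint (S m) \<omega> - I \<omega>)) + 2 * ?n (\<lambda>\<omega>. - eint (E m) \<omega>)"
      by (rule nn_integral_square_add) measurable
    also have "\<dots> \<le> 2 * (2 * ?n (\<lambda>\<omega>. eint (S' m) \<omega> - I' \<omega>) + 2 * ?n (\<lambda>\<omega>. - (eint (S m) \<omega> - I \<omega>))) + 2 * ?n (\<lambda>\<omega>. - eint (E m) \<omega>)"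
      by (intro add_right_mono mult_left_mono nn_integral_square_add; (measurable | simp))
    finally show ?thesis unfolding norm_minus_cancel .
  qed
  moreover have "(\<lambda>m. 2 * (2 * ?n (\<lambda>\<omega>. eint (S' m) \<omega> - I' \<omega>) + 2 * ?n (\<lambda>\<omega>. eint (S m) \<omega> - I \<omega>)) + 2 * ?n (eint (E m))) \<longlonglongrightarrow> 0 + 0"
  proof (intro tendsto_add tendsto_0_ennreal_mult)
    have "(\<lambda>m. 2 * ?n (\<lambda>\<omega>. eint (S' m) \<omega> - I' \<omega>) + 2 * ?n (\<lambda>\<omega>. eint (S m) \<omega> - I \<omega>)) \<longlonglongrightarrow> 0 + 0"
      by (intro tendsto_add tendsto_0_ennreal_mult S S') auto
    then show "(\<lambda>m. 2 * ?n (\<lambda>\<omega>. eint (S' m) \<omega> - I' \<omega>) + 2 * ?n (\<lambda>\<omega>. eint (S m) \<omega> - I \<omega>)) \<longlonglongrightarrow> 0" by simp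
  qed (use limE in auto)
  ultimately have "(\<lambda>m. ?n (\<lambda>\<omega>. eint (L m) \<omega> - (I' \<omega> - I \<omega>))) \<longlonglongrightarrow> 0"
    by (intro tendsto_sandwich[OF _ _ tendsto_const, of _ "\<lambda>m. ?n (\<lambda>\<omega>. eint (L m) \<omega> - (I' \<omega> - I \<omega>))" sequentially]
          always_eventually) auto
  with L lim1 show ?thesis by blast
qed

text \<open>The isometry, applied to the difference of an approximating elementary integrand and the integrand
  that is frozen at \<open>Y\<close> on \<open>{T<..T'}\<close>. The constant 4 stems from splitting squares of sums twice.\<close>

lemma ito_increment_error:
  assumes T: "0 \<le> T" "T \<le> T'"
    and X: "(\<lambda>(\<omega>, s). X s \<omega>) \<in> borel_measurable (M \<Otimes>\<^sub>M lborel)"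
    and I: "has_ito_integral M F W T X I" and I': "has_ito_integral M F W T' X I'"
    and Y: "bounded_at T Y"
  shows "(\<integral>\<^sup>+\<omega>. ennreal ((cmod (I' \<omega> - I \<omega> - Y \<omega> * (W T' \<omega> - W T \<omega>)))\<^sup>2) \<partial>M) \<le>
     4 * energy {T<..T'} (\<lambda>s \<omega>. X s \<omega> - Y \<omega>)"
proof -
  obtain L where L: "\<And>m. elementary T T' (L m)"
      "(\<lambda>m. energy {T<..T'} (\<lambda>s \<omega>. evalue (L m) s \<omega> - X s \<omega>)) \<longlonglongrightarrow> 0"
      "(\<lambda>m. \<integral>\<^sup>+\<omega>. ennreal ((cmod (eint (L m) \<omega> - (I' \<omega> - I \<omega>)))\<^sup>2) \<partial>M) \<longlonglongrightarrow> 0"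
    using ito_increment_elementary[OF T X I I'] by blast
  define D where "D m = (T, T', \<lambda>\<omega>. - Y \<omega>) # L m" for m
  have D: "elementary T T' (D m)" for m unfolding D_def using L(1) T Y bounded_at_uminus by simp
  have L0: "elementary 0 T' (L m)" "elementary 0 T' (D m)" for m
    using L(1)[of m] D[of m] T by (auto intro: elementary_mono)
  have [measurable]: "I \<in> borel_measurable M" "I' \<in> borel_measurable M"
    using has_ito_integral_elementary(1) I I' by auto
  note [measurable] = eint_measurable[OF L0(1)] eint_measurable[OF L0(2)]
  have [measurable]: "Y \<in> borel_measurable M" using T Y by (auto simp: bounded_at_def intro: F_meas_M)
  let ?n = "\<lambda>f. \<integral>\<^sup>+\<omega>. ennreal ((cmod (f \<omega>))\<^sup>2) \<partial>M"
  have X': "(\<lambda>x. X (snd x) (fst x)) \<in> borel_measurable (M \<Otimes>\<^sub>M lborel)"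
    using X by (simp add: case_prod_unfold)
  have bound: "?n (\<lambda>\<omega>. I' \<omega> - I \<omega> - Y \<omega> * (W T' \<omega> - W T \<omega>)) \<le>
      2 * ?n (\<lambda>\<omega>. eint (L m) \<omega> - (I' \<omega> - I \<omega>)) +
      2 * (2 * energy {T<..T'} (\<lambda>s \<omega>. evalue (L m) s \<omega> - X s \<omega>) + 2 * energy {T<..T'} (\<lambda>s \<omega>. X s \<omega> - Y \<omega>))" for m
  proof -
    have "?n (\<lambda>\<omega>. I' \<omega> - I \<omega> - Y \<omega> * (W T' \<omega> - W T \<omega>)) =
      ?n (\<lambda>\<omega>. - (eint (L m) \<omega> - (I' \<omega> - I \<omega>)) + eint (D m) \<omega>)"
      unfolding D_def by (intro nn_integral_cong) (simp add: algebra_simps)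
    also have "\<dots> \<le> 2 * ?n (\<lambda>\<omega>. - (eint (L m) \<omega> - (I' \<omega> - I \<omega>))) + 2 * ?n (eint (D m))"
      by (rule nn_integral_square_add) measurable
    also have "\<dots> \<le> 2 * ?n (\<lambda>\<omega>. - (eint (L m) \<omega> - (I' \<omega> - I \<omega>))) +
        2 * (2 * energy {T<..T'} (\<lambda>s \<omega>. evalue (L m) s \<omega> - X s \<omega>) + 2 * energy {T<..T'} (\<lambda>s \<omega>. X s \<omega> - Y \<omega>))"
    proof (intro add_left_mono mult_left_mono)
      have "?n (eint (D m)) = energy {T<..T'} (evalue (D m))"
        by (rule energy_evalue[OF D T(1)]) simp
      also have "\<dots> \<le> energy {T<..T'} (\<lambda>s \<omega>. (evalue (L m) s \<omega> - X s \<omega>) + (X s \<omega> - Y \<omega>))"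
        by (rule energy_mono) (simp add: D_def)
      also have "\<dots> \<le> 2 * energy {T<..T'} (\<lambda>s \<omega>. evalue (L m) s \<omega> - X s \<omega>) + 2 * energy {T<..T'} (\<lambda>s \<omega>. X s \<omega> - Y \<omega>)"
      proof (rule energy_add)
        show "(\<lambda>(\<omega>, s). evalue (L m) s \<omega> - X s \<omega>) \<in> borel_measurable (M \<Otimes>\<^sub>M lborel)"
          using evalue_measurable[OF L0(1)] X' by (auto simp: case_prod_unfold intro!: borel_measurable_diff)
        show "(\<lambda>(\<omega>, s). X s \<omega> - Y \<omega>) \<in> borel_measurable (M \<Otimes>\<^sub>M lborel)"
          using X' by (auto simp: case_prod_unfold intro!: borel_measurable_diff)
      qed simp
      finally show "?n (eint (D m)) \<le> 2 * energy {T<..T'} (\<lambda>s \<omega>. evalue (L m) s \<omega> - X s \<omega>) + 2 * energy {T<..T'} (\<lambda>s \<omega>. X s \<omega> - Y \<omega>)" .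
    qed simp
    finally show ?thesis unfolding norm_minus_cancel .
  qed
  let ?e = "energy {T<..T'} (\<lambda>s \<omega>. X s \<omega> - Y \<omega>)"
  have "(\<lambda>m. 2 * energy {T<..T'} (\<lambda>s \<omega>. evalue (L m) s \<omega> - X s \<omega>) + 2 * ?e) \<longlonglongrightarrow> 0 + 2 * ?e"
    by (intro tendsto_add tendsto_0_ennreal_mult L tendsto_const) auto
  then have "(\<lambda>m. 2 * (2 * energy {T<..T'} (\<lambda>s \<omega>. evalue (L m) s \<omega> - X s \<omega>) + 2 * ?e)) \<longlonglongrightarrow> 2 * (0 + 2 * ?e)"
    by (intro ennreal_tendsto_cmult) auto
  then have "(\<lambda>m. 2 * ?n (\<lambda>\<omega>. eint (L m) \<omega> - (I' \<omega> - I \<omega>)) +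
      2 * (2 * energy {T<..T'} (\<lambda>s \<omega>. evalue (L m) s \<omega> - X s \<omega>) + 2 * ?e)) \<longlonglongrightarrow> 0 + 2 * (0 + 2 * ?e)"
    by (intro tendsto_add tendsto_0_ennreal_mult L) auto
  then have "?n (\<lambda>\<omega>. I' \<omega> - I \<omega> - Y \<omega> * (W T' \<omega> - W T \<omega>)) \<le> 0 + 2 * (0 + 2 * ?e)"
    by (rule LIMSEQ_le_const) (use bound in blast)
  also have "\<dots> = 4 * ?e" by (simp add: mult.assoc[symmetric])
  finally show ?thesis .
qed

lemma eint_mean:
  assumes T: "0 \<le> T" and "elementary T T' K" and g: "bounded_at T g"
  shows "has_bochner_integral M (\<lambda>\<omega>. g \<omega> * eint K \<omega>) 0"
  using assms(2)
proof (induction K)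
  case (Cons e K)
  obtain a b H where e: "e = (a, b, H)" by (cases e)
  have ab: "0 \<le> a" "a \<le> b" "T \<le> a" "bounded_at a H" using Cons.prems T by (auto simp: e)
  have K: "bounded_at a (\<lambda>\<omega>. g \<omega> * H \<omega>)"
    by (rule bounded_at_times[OF bounded_at_mono[OF T ab(3) g] ab(4)])
  have "has_bochner_integral M (\<lambda>\<omega>. (g \<omega> * H \<omega>) * (W b \<omega> - W a \<omega>)) 0"
    by (rule W_mean[OF ab(1,2) bounded_atD[OF K] integrable_bounded_at[OF ab(1) K]])
  moreover have "has_bochner_integral M (\<lambda>\<omega>. g \<omega> * eint K \<omega>) 0" using Cons by (simp add: e)
  ultimately have "has_bochner_integral M (\<lambda>\<omega>. (g \<omega> * H \<omega>) * (W b \<omega> - W a \<omega>) + g \<omega> * eint K \<omega>) (0 + 0)"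
    by (rule has_bochner_integral_add)
  then show ?case by (simp add: e distrib_left mult.assoc)
qed (simp add: has_bochner_integral_zero)

text \<open>Elementary integrals over \<open>{T<..T'}\<close> have mean 0 against the past at time \<open>T\<close>, and convergence in mean
  square preserves this.\<close>

lemma ito_increment_mean:
  assumes T: "0 \<le> T" "T \<le> T'"
    and X: "(\<lambda>(\<omega>, s). X s \<omega>) \<in> borel_measurable (M \<Otimes>\<^sub>M lborel)"
    and I: "has_ito_integral M F W T X I" and I': "has_ito_integral M F W T' X I'"
    and g: "bounded_at T g"
  shows "has_bochner_integral M (\<lambda>\<omega>. g \<omega> * (I' \<omega> - I \<omega>)) 0"
proof -
  obtain L where L: "\<And>m. elementary T T' (L m)"
      "(\<lambda>m. \<integral>\<^sup>+\<omega>. ennreal ((cmod (eint (L m) \<omega> - (I' \<omega> - I \<omega>)))\<^sup>2) \<partial>M) \<longlonglongrightarrow> 0"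
    using ito_increment_elementary[OF T X I I'] by blast
  have L0: "elementary 0 T' (L m)" for m using L(1)[of m] T by (auto intro: elementary_mono)
  have [measurable]: "I \<in> borel_measurable M" "I' \<in> borel_measurable M"
    using has_ito_integral_elementary(1) I I' by auto
  note [measurable] = eint_measurable[OF L0]
  have [measurable]: "g \<in> borel_measurable M" using T g by (auto simp: bounded_at_def intro: F_meas_M)
  define e where "e m = (\<integral>\<^sup>+\<omega>. ennreal ((cmod (eint (L m) \<omega> - (I' \<omega> - I \<omega>)))\<^sup>2) \<partial>M)" for m
  have e: "e \<longlonglongrightarrow> 0" using L(2) unfolding e_def .
  \<comment> \<open>this turns a small mean square into a small first moment\<close>
  have bound: "cmod z \<le> \<eta> + (cmod z)\<^sup>2 / \<eta>" if "0 < \<eta>" for \<eta> :: real and z :: complex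
  proof (cases "cmod z \<le> \<eta>")
    case False
    then have "cmod z * \<eta> \<le> (cmod z)\<^sup>2" by (simp add: power2_eq_square mult_left_mono)
    then have "cmod z \<le> (cmod z)\<^sup>2 / \<eta>" using that by (simp add: pos_le_divide_eq)
    then show ?thesis using that by simp
  qed (use that in \<open>simp add: add_increasing2\<close>)
  have close: "\<exists>m. integrable M (\<lambda>\<omega>. eint (L m) \<omega> - (I' \<omega> - I \<omega>)) \<and>
      (\<integral>\<omega>. cmod (eint (L m) \<omega> - (I' \<omega> - I \<omega>)) \<partial>M) \<le> 2 * \<eta>" if \<eta>: "0 < \<eta>" for \<eta>
  proof -
    have "\<forall>\<^sub>F m in sequentially. e m < ennreal (\<eta>\<^sup>2)"
      by (rule order_tendstoD(2)[OF e]) (use \<eta> in simp)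
    then obtain m where m: "e m < ennreal (\<eta>\<^sup>2)" by (auto simp: eventually_sequentially)
    let ?Z = "\<lambda>\<omega>. eint (L m) \<omega> - (I' \<omega> - I \<omega>)"
    have "(\<integral>\<^sup>+\<omega>. ennreal (norm (?Z \<omega>)) \<partial>M) \<le> (\<integral>\<^sup>+\<omega>. ennreal \<eta> + ennreal (1 / \<eta>) * ennreal ((cmod (?Z \<omega>))\<^sup>2) \<partial>M)"
    proof (rule nn_integral_mono)
      fix \<omega>
      have "ennreal (norm (?Z \<omega>)) \<le> ennreal (\<eta> + 1 / \<eta> * (cmod (?Z \<omega>))\<^sup>2)"
        using bound[OF \<eta>, of "?Z \<omega>"] by (intro ennreal_leI) simp
      also have "\<dots> = ennreal \<eta> + ennreal (1 / \<eta>) * ennreal ((cmod (?Z \<omega>))\<^sup>2)"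
      proof -
        have "ennreal (\<eta> + 1 / \<eta> * (cmod (?Z \<omega>))\<^sup>2) = ennreal \<eta> + ennreal (1 / \<eta> * (cmod (?Z \<omega>))\<^sup>2)"
          by (rule ennreal_plus) (use \<eta> in auto)
        moreover have "ennreal (1 / \<eta> * (cmod (?Z \<omega>))\<^sup>2) = ennreal (1 / \<eta>) * ennreal ((cmod (?Z \<omega>))\<^sup>2)"
          by (rule ennreal_mult) (use \<eta> in auto)
        ultimately show ?thesis by (simp only:)
      qed
      finally show "ennreal (norm (?Z \<omega>)) \<le> ennreal \<eta> + ennreal (1 / \<eta>) * ennreal ((cmod (?Z \<omega>))\<^sup>2)" .
    qed
    also have "\<dots> = ennreal \<eta> + ennreal (1 / \<eta>) * e m"
      unfolding e_def by (simp add: nn_integral_add nn_integral_cmult emeasure_space_1)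
    also have "\<dots> \<le> ennreal \<eta> + ennreal (1 / \<eta>) * ennreal (\<eta>\<^sup>2)"
      using m by (intro add_left_mono mult_left_mono) auto
    also have "\<dots> = ennreal (2 * \<eta>)"
      using \<eta> by (simp add: ennreal_mult[symmetric] power2_eq_square flip: ennreal_plus)
    finally have *: "(\<integral>\<^sup>+\<omega>. ennreal (norm (?Z \<omega>)) \<partial>M) \<le> ennreal (2 * \<eta>)" .
    have int: "integrable M ?Z"
      by (rule integrableI_bounded) (use * in \<open>auto intro: order.strict_trans1\<close>)
    have "ennreal (\<integral>\<omega>. cmod (?Z \<omega>) \<partial>M) \<le> ennreal (2 * \<eta>)"
      using * nn_integral_eq_integral[OF integrable_norm[OF int]] by simp
    then show ?thesis using int \<eta> by (intro exI[of _ m]) (simp add: ennreal_le_iff)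
  qed
  obtain m0 where m0: "integrable M (\<lambda>\<omega>. eint (L m0) \<omega> - (I' \<omega> - I \<omega>))" using close[of 1] by auto
  note mean = eint_mean[OF T(1) _ g]
  have eint_int: "integrable M (eint (L m))" for m
  proof -
    have "bounded_at T (\<lambda>_. 1)" unfolding bounded_at_def by auto
    from eint_mean[OF T(1) L(1) this] show ?thesis by (simp add: has_bochner_integral_iff)
  qed
  have int: "integrable M (\<lambda>\<omega>. I' \<omega> - I \<omega>)"
    using Bochner_Integration.integrable_diff[OF eint_int[of m0] m0] by simp
  obtain C where C: "\<And>\<omega>. \<omega> \<in> space M \<Longrightarrow> cmod (g \<omega>) \<le> C" "0 \<le> C"
  proof -
    obtain C where "\<And>\<omega>. \<omega> \<in> space M \<Longrightarrow> cmod (g \<omega>) \<le> C" using g unfolding bounded_at_def by auto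
    then show ?thesis by (intro that[of "\<bar>C\<bar>"]) (auto intro: order_trans[OF _ abs_ge_self])
  qed
  have int_g: "integrable M (\<lambda>\<omega>. g \<omega> * (I' \<omega> - I \<omega>))"
    by (rule bounded_at_integrable_mult[OF T(1) g int])
  have small: "cmod (\<integral>\<omega>. g \<omega> * (I' \<omega> - I \<omega>) \<partial>M) \<le> C * (2 * \<eta>)" if \<eta>: "0 < \<eta>" for \<eta>
  proof -
    obtain m where m: "integrable M (\<lambda>\<omega>. eint (L m) \<omega> - (I' \<omega> - I \<omega>))"
       "(\<integral>\<omega>. cmod (eint (L m) \<omega> - (I' \<omega> - I \<omega>)) \<partial>M) \<le> 2 * \<eta>" using close[OF \<eta>] by blast
    let ?Z = "\<lambda>\<omega>. eint (L m) \<omega> - (I' \<omega> - I \<omega>)"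
    have gZ: "integrable M (\<lambda>\<omega>. g \<omega> * ?Z \<omega>)" by (rule bounded_at_integrable_mult[OF T(1) g m(1)])
    have "(\<integral>\<omega>. g \<omega> * ?Z \<omega> \<partial>M) = (\<integral>\<omega>. g \<omega> * eint (L m) \<omega> \<partial>M) - (\<integral>\<omega>. g \<omega> * (I' \<omega> - I \<omega>) \<partial>M)"
      using mean[OF L(1)] int_g by (subst Bochner_Integration.integral_diff[symmetric])
        (auto simp: has_bochner_integral_iff right_diff_distrib)
    then have "cmod (\<integral>\<omega>. g \<omega> * (I' \<omega> - I \<omega>) \<partial>M) = cmod (\<integral>\<omega>. g \<omega> * ?Z \<omega> \<partial>M)"
      using has_bochner_integral_integral_eq[OF mean[OF L(1)]] by simp
    also have "\<dots> \<le> (\<integral>\<omega>. cmod (g \<omega> * ?Z \<omega>) \<partial>M)" by (rule integral_norm_bound)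
    also have "\<dots> \<le> (\<integral>\<omega>. C * cmod (?Z \<omega>) \<partial>M)"
      using C by (intro integral_mono integrable_norm gZ integrable_mult_right m(1)) (auto simp: norm_mult mult_right_mono)
    also have "\<dots> \<le> C * (2 * \<eta>)" using m(2) C(2) by (simp add: mult_left_mono)
    finally show ?thesis .
  qed
  have "cmod (\<integral>\<omega>. g \<omega> * (I' \<omega> - I \<omega>) \<partial>M) \<le> 0"
  proof (rule field_le_epsilon)
    fix \<epsilon> :: real assume "0 < \<epsilon>"
    then have "C * (2 * (\<epsilon> / (2 * (C + 1)))) \<le> \<epsilon>"
      using C(2) by (simp add: field_simps)
    moreover have "0 < \<epsilon> / (2 * (C + 1))" using \<open>0 < \<epsilon>\<close> C(2) by simp
    ultimately show "cmod (\<integral>\<omega>. g \<omega> * (I' \<omega> - I \<omega>) \<partial>M) \<le> 0 + \<epsilon>"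
      using small[of "\<epsilon> / (2 * (C + 1))"] by linarith
  qed
  then show ?thesis using int_g by (simp add: has_bochner_integral_iff)
qed

end

section \<open>The phase over a short time\<close>

definition planar_noise :: "(real \<Rightarrow> 'a \<Rightarrow> real) \<Rightarrow> (real \<Rightarrow> 'a \<Rightarrow> real) \<Rightarrow> real \<Rightarrow> 'a \<Rightarrow> complex" where
  "planar_noise X Y t \<omega> = (complex_of_real (X t \<omega>) + \<i> * complex_of_real (Y t \<omega>)) / complex_of_real (sqrt 2)"

lemma (in brownian_noise) complex_noise_planar:
  assumes ij: "i < d" "j < d" "i \<noteq> j"
  shows "complex_noise M F (planar_noise (b i) (b j))"
proof
  fix s t :: real
  let ?W = "planar_noise (b i) (b j)"
  show "0 \<le> t \<Longrightarrow> subalgebra M (F t)" by (rule subalg)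
  show "0 \<le> s \<Longrightarrow> s \<le> t \<Longrightarrow> sets (F s) \<subseteq> sets (F t)" by (rule F_mono)
  show "?W t \<in> borel_measurable (F t)" if "0 \<le> t"
  proof -
    note [measurable] = noise_adapted[OF ij(1) that] noise_adapted[OF ij(2) that]
    show ?thesis unfolding planar_noise_def by measurable
  qed
  define D where "D i \<omega> = complex_of_real (b i t \<omega> - b i s \<omega>)" for i \<omega>
  have W: "?W t \<omega> - ?W s \<omega> = (D i \<omega> + \<i> * D j \<omega>) / complex_of_real (sqrt 2)" for \<omega>
    unfolding planar_noise_def D_def by (simp add: diff_divide_distrib[symmetric] algebra_simps)
  have s2: "complex_of_real (sqrt 2) * complex_of_real (sqrt 2) = 2"
    by (metis of_real_mult of_real_numeral real_sqrt_mult_self abs_numeral)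
  fix g :: "'a \<Rightarrow> complex" assume g: "0 \<le> s" "s \<le> t" "g \<in> borel_measurable (F s)" "integrable M g"
  show "has_bochner_integral M (\<lambda>\<omega>. g \<omega> * (?W t \<omega> - ?W s \<omega>)) 0"
  proof -
    have "has_bochner_integral M (\<lambda>\<omega>. (g \<omega> * D i \<omega> + \<i> * (g \<omega> * D j \<omega>)) / complex_of_real (sqrt 2)) ((0 + \<i> * 0) / complex_of_real (sqrt 2))"
      unfolding D_def
      by (intro has_bochner_integral_divide has_bochner_integral_add has_bochner_integral_mult_right noise_mean g ij)
    then show ?thesis unfolding W by (simp add: algebra_simps)
  qed
  have WW: "(?W t \<omega> - ?W s \<omega>) * cnj (?W t \<omega> - ?W s \<omega>) = (D i \<omega> * D i \<omega> + D j \<omega> * D j \<omega>) / 2" for \<omega>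
  proof -
    have c: "cnj (D k \<omega>) = D k \<omega>" for k unfolding D_def by simp
    show ?thesis unfolding W
      by (simp add: c s2 algebra_simps add_divide_distrib diff_divide_distrib power2_eq_square)
  qed
  show "has_bochner_integral M (\<lambda>\<omega>. g \<omega> * ((?W t \<omega> - ?W s \<omega>) * cnj (?W t \<omega> - ?W s \<omega>)))
      (complex_of_real (t - s) * (\<integral>\<omega>. g \<omega> \<partial>M))"
  proof -
    have c: "has_bochner_integral M (\<lambda>\<omega>. g \<omega> * (D k \<omega> * D k \<omega>)) (complex_of_real (t - s) * (\<integral>\<omega>. g \<omega> \<partial>M))" if "k < d" for k
      using noise_cov[OF g(1,2) that that g(3,4)] unfolding D_def by simp
    have "has_bochner_integral M (\<lambda>\<omega>. (g \<omega> * (D i \<omega> * D i \<omega>) + g \<omega> * (D j \<omega> * D j \<omega>)) / 2)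
      ((complex_of_real (t - s) * (\<integral>\<omega>. g \<omega> \<partial>M) + complex_of_real (t - s) * (\<integral>\<omega>. g \<omega> \<partial>M)) / 2)"
      by (intro has_bochner_integral_divide has_bochner_integral_add c ij)
    then show ?thesis unfolding WW by (simp add: distrib_left mult.commute)
  qed
qed

lemma norm_exp_imaginary_diff_le:
  "cmod (exp (- \<i> * complex_of_real x) - exp (- \<i> * complex_of_real y)) \<le> \<bar>x - y\<bar>"
proof -
  have "exp (- \<i> * complex_of_real x) - exp (- \<i> * complex_of_real y) =
     exp (- \<i> * complex_of_real y) * (exp (\<i> * complex_of_real (y - x)) - 1)"
    by (simp add: exp_diff exp_minus field_simps)
  then have "cmod (exp (- \<i> * complex_of_real x) - exp (- \<i> * complex_of_real y)) = 2 * \<bar>sin ((y - x) / 2)\<bar>"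
    using norm_exp_i_times[of "- y"] by (simp only: norm_mult dist_exp_i_1) simp
  also have "\<dots> \<le> 2 * \<bar>(y - x) / 2\<bar>" by (intro mult_left_mono abs_sin_x_le_abs_x) auto
  finally show ?thesis by simp
qed

text \<open>By continuity in time the process is the limit of the processes that only move at multiples of
  \<open>1 / (n + 1)\<close>, which are jointly measurable.\<close>

lemma continuous_process_measurable:
  fixes f :: "real \<Rightarrow> 'a \<Rightarrow> 'b::metric_space"
  assumes meas: "\<And>t. f t \<in> borel_measurable M"
    and cont: "\<And>\<omega>. \<omega> \<in> space M \<Longrightarrow> continuous_on UNIV (\<lambda>t. f t \<omega>)"
  shows "(\<lambda>(\<omega>, s). f s \<omega>) \<in> borel_measurable (M \<Otimes>\<^sub>M lborel)"
proof (rule borel_measurable_LIMSEQ_metric)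
  fix n :: nat
  define q where "q x = \<lfloor>real (Suc n) * snd x\<rfloor>" for x :: "'a \<times> real"
  have q: "q \<in> measurable (M \<Otimes>\<^sub>M lborel) (count_space UNIV)"
    unfolding q_def by (intro measurable_compose[OF _ measurable_real_floor]) measurable
  show "(\<lambda>x. f (of_int (q x) / real (Suc n)) (fst x)) \<in> borel_measurable (M \<Otimes>\<^sub>M lborel)"
    by (rule measurable_compose_countable[OF _ q]) (intro measurable_compose[OF measurable_fst meas])
next
  fix x :: "'a \<times> real" assume "x \<in> space (M \<Otimes>\<^sub>M lborel)"
  then have \<omega>: "fst x \<in> space M" by (simp add: space_pair_measure mem_Times_iff)
  have "(\<lambda>n. of_int \<lfloor>real (Suc n) * snd x\<rfloor> / real (Suc n)) \<longlonglongrightarrow> snd x"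
  proof (rule tendsto_sandwich)
    have "(\<lambda>n. snd x - 1 / real (Suc n)) \<longlonglongrightarrow> snd x - 0"
      by (intro tendsto_diff tendsto_const LIMSEQ_Suc[OF lim_1_over_n])
    then show "(\<lambda>n. snd x - 1 / real (Suc n)) \<longlonglongrightarrow> snd x" by simp
    show "\<forall>\<^sub>F n in sequentially. snd x - 1 / real (Suc n) \<le> of_int \<lfloor>real (Suc n) * snd x\<rfloor> / real (Suc n)"
    proof (intro always_eventually allI)
      fix n
      have "real (Suc n) * snd x - 1 \<le> of_int \<lfloor>real (Suc n) * snd x\<rfloor>" by linarith
      then have "(real (Suc n) * snd x - 1) / real (Suc n) \<le> of_int \<lfloor>real (Suc n) * snd x\<rfloor> / real (Suc n)"
        by (intro divide_right_mono) auto
      then show "snd x - 1 / real (Suc n) \<le> of_int \<lfloor>real (Suc n) * snd x\<rfloor> / real (Suc n)"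
        by (simp add: diff_divide_distrib)
    qed
    show "\<forall>\<^sub>F n in sequentially. of_int \<lfloor>real (Suc n) * snd x\<rfloor> / real (Suc n) \<le> snd x"
      by (intro always_eventually allI) (simp add: pos_divide_le_eq mult.commute[of "snd x"] del: of_nat_Suc)
  qed simp
  then show "(\<lambda>n. f (of_int \<lfloor>real (Suc n) * snd x\<rfloor> / real (Suc n)) (fst x)) \<longlonglongrightarrow> (case x of (\<omega>, s) \<Rightarrow> f s \<omega>)"
    using continuous_on_tendsto_compose[OF cont[OF \<omega>], of _ "snd x" sequentially]
    by (simp add: case_prod_unfold)
qed

lemma has_ito_integral_cong_AE:
  assumes "AE \<omega> in M. \<forall>s\<in>{0..T}. X s \<omega> = Y s \<omega>" and "has_ito_integral M F W T X I"
  shows "has_ito_integral M F W T Y I"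
proof -
  have eq: "(\<integral>\<^sup>+\<omega>. (\<integral>\<^sup>+s\<in>{0..T}. ennreal ((cmod (Z s \<omega> - X s \<omega>))\<^sup>2) \<partial>lborel) \<partial>M) =
      (\<integral>\<^sup>+\<omega>. (\<integral>\<^sup>+s\<in>{0..T}. ennreal ((cmod (Z s \<omega> - Y s \<omega>))\<^sup>2) \<partial>lborel) \<partial>M)" for Z
    by (rule nn_integral_cong_AE) (use assms(1) in \<open>eventually_elim; intro nn_integral_cong; auto simp: indicator_def\<close>)
  show ?thesis using assms(2) unfolding has_ito_integral_def eq .
qed

locale driving_noise = brownian_noise M F b 3 for M :: "'a measure" and F b
begin

abbreviation noiseW :: "real \<Rightarrow> 'a \<Rightarrow> complex" where
  "noiseW \<equiv> planar_noise (b 1) (b 2)"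

sublocale complex_noise M F noiseW
  by (rule complex_noise_planar) auto

definition is_phase :: "real \<Rightarrow> (real \<Rightarrow> 'a \<Rightarrow> real) \<Rightarrow> bool" where
  "is_phase l \<theta> \<longleftrightarrow> (\<forall>t\<ge>0. \<theta> t \<in> borel_measurable (F t)) \<and>
     (AE \<omega> in M. continuous_on {0..} (\<lambda>t. \<theta> t \<omega>)) \<and>
     (\<forall>t\<ge>0. \<exists>I. has_ito_integral M F noiseW t (\<lambda>s \<omega>. exp (- \<i> * complex_of_real (\<theta> s \<omega>))) I \<and>
           (AE \<omega> in M. \<theta> t \<omega> = l * t + b 0 t \<omega> + Re (I \<omega>)))"

definition rbounded :: "real \<Rightarrow> ('a \<Rightarrow> real) \<Rightarrow> bool" where
  "rbounded t g \<longleftrightarrow> g \<in> borel_measurable (F t) \<and> (\<exists>C. \<forall>\<omega>\<in>space M. \<bar>g \<omega>\<bar> \<le> C)"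

lemma rbounded_of_real: "rbounded t g \<Longrightarrow> bounded_at t (\<lambda>\<omega>. complex_of_real (g \<omega>))"
  unfolding rbounded_def bounded_at_def by auto

lemma ennreal_square_sum3_le:
  "ennreal ((x + y + z)\<^sup>2) \<le> 3 * ennreal (x\<^sup>2) + 3 * ennreal (y\<^sup>2) + 3 * ennreal (z\<^sup>2)" for x y z :: real
proof -
  have "(x + y + z)\<^sup>2 \<le> 3 * x\<^sup>2 + 3 * y\<^sup>2 + 3 * z\<^sup>2"
    using sum_squares_bound[of x y] sum_squares_bound[of x z] sum_squares_bound[of y z]
    by (simp add: power2_eq_square algebra_simps)
  then have "ennreal ((x + y + z)\<^sup>2) \<le> ennreal (3 * x\<^sup>2 + 3 * y\<^sup>2 + 3 * z\<^sup>2)" by (rule ennreal_leI)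
  then show ?thesis by (simp add: ennreal_mult)
qed

lemma noise_square_integral:
  assumes "i < 3" "0 \<le> s" "s \<le> t"
  shows "has_bochner_integral M (\<lambda>\<omega>. (b i t \<omega> - b i s \<omega>)\<^sup>2) (t - s)"
proof -
  have "has_bochner_integral M (\<lambda>\<omega>. 1 * complex_of_real ((b i t \<omega> - b i s \<omega>) * (b i t \<omega> - b i s \<omega>)))
      (if i = i then complex_of_real (t - s) * (\<integral>\<omega>. 1 \<partial>M) else 0)"
    by (rule noise_cov) (use assms in simp_all)
  then have "has_bochner_integral M (\<lambda>\<omega>. complex_of_real ((b i t \<omega> - b i s \<omega>)\<^sup>2)) (complex_of_real (t - s))"
    by (simp add: power2_eq_square prob_space)
  then have "has_bochner_integral M (\<lambda>\<omega>. Re (complex_of_real ((b i t \<omega> - b i s \<omega>)\<^sup>2))) (Re (complex_of_real (t - s)))"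
    by (rule has_bochner_integral_bounded_linear[OF bounded_linear_Re])
  then show ?thesis by simp
qed

lemma noise_M: "i < 3 \<Longrightarrow> 0 \<le> t \<Longrightarrow> b i t \<in> borel_measurable M"
  by (rule F_meas_M[OF _ noise_adapted])

text \<open>\<open>R\<close> is the error that is made when the angle of the noise is frozen at time \<open>t\<close> during a step of
  length \<open>h\<close>.\<close>

definition phase_remainder ::
  "real \<Rightarrow> (real \<Rightarrow> 'a \<Rightarrow> real) \<Rightarrow> real \<Rightarrow> real \<Rightarrow> real \<Rightarrow> ('a \<Rightarrow> real) \<Rightarrow> bool" where
  "phase_remainder l \<theta> C t h R \<longleftrightarrow>
     (AE \<omega> in M. \<theta> (t + h) \<omega> - \<theta> t \<omega> = l * h + (b 0 (t + h) \<omega> - b 0 t \<omega>) +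
        (cos (\<theta> t \<omega>) * (b 1 (t + h) \<omega> - b 1 t \<omega>) + sin (\<theta> t \<omega>) * (b 2 (t + h) \<omega> - b 2 t \<omega>)) / sqrt 2 + R \<omega>) \<and>
     integrable M R \<and> integrable M (\<lambda>\<omega>. (R \<omega>)\<^sup>2) \<and> (\<integral>\<omega>. (R \<omega>)\<^sup>2 \<partial>M) \<le> C * h\<^sup>2 \<and>
     (\<forall>g. rbounded t g \<longrightarrow> has_bochner_integral M (\<lambda>\<omega>. g \<omega> * R \<omega>) 0)"

text \<open>The mean square of the error is of second order in the length of the step, because the angle itself
  moves by the square root of the elapsed time; the error has mean 0 given the past, because it is
  an increment of an Ito integral.\<close>

lemma phase_increment:
  assumes ph: "is_phase l \<theta>"
  shows "\<exists>C\<ge>0. \<forall>t h. 0 \<le> t \<and> 0 \<le> h \<and> h \<le> 1 \<longrightarrow> (\<exists>R. phase_remainder l \<theta> C t h R)"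
proof -
  have ad: "\<theta> t \<in> borel_measurable (F t)" if "0 \<le> t" for t using ph that unfolding is_phase_def by auto
  obtain N where N: "N \<in> null_sets M" "\<And>\<omega>. \<omega> \<in> space M - N \<Longrightarrow> continuous_on {0..} (\<lambda>t. \<theta> t \<omega>)"
  proof -
    have "AE \<omega> in M. continuous_on {0..} (\<lambda>t. \<theta> t \<omega>)" using ph unfolding is_phase_def by auto
    then obtain N where "{\<omega> \<in> space M. \<not> continuous_on {0..} (\<lambda>t. \<theta> t \<omega>)} \<subseteq> N" "N \<in> null_sets M"
      by (auto elim: AE_E3 simp: eventually_ae_filter)
    then show ?thesis by (intro that[of N]) auto
  qed
  \<comment> \<open>a version with all paths continuous on the whole line; it is still adapted, since null sets are known at all times\<close>
  define \<psi> where "\<psi> t \<omega> = (if \<omega> \<in> N then 0 else \<theta> (max 0 t) \<omega>)" for t \<omega>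
  have \<psi>_F: "\<psi> t \<in> borel_measurable (F (max 0 t))" for t
  proof -
    have "N \<in> sets (F (max 0 t))" by (rule null_F) (use N in auto)
    moreover have "{\<omega> \<in> space (F (max 0 t)). \<omega> \<in> N} = N \<inter> space (F (max 0 t))" by auto
    ultimately show ?thesis unfolding \<psi>_def using ad[of "max 0 t"]
      by (intro measurable_If_set) auto
  qed
  have \<psi>_M: "\<psi> t \<in> borel_measurable M" for t by (rule F_meas_M[OF _ \<psi>_F]) simp
  have \<psi>_cont: "continuous_on UNIV (\<lambda>t. \<psi> t \<omega>)" if "\<omega> \<in> space M" for \<omega>
  proof (cases "\<omega> \<in> N")
    case False
    have "continuous_on UNIV (\<lambda>t. \<theta> (max 0 t) \<omega>)"
      by (rule continuous_on_compose2[OF N(2)[of \<omega>]]) (use that False in \<open>auto intro!: continuous_intros\<close>)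
    then show ?thesis using False by (simp add: \<psi>_def)
  qed (simp add: \<psi>_def)
  have AE_eq: "AE \<omega> in M. \<forall>t\<ge>0. \<psi> t \<omega> = \<theta> t \<omega>"
    by (rule AE_I'[OF N(1)]) (auto simp: \<psi>_def)
  define X where "X t \<omega> = exp (- \<i> * complex_of_real (\<psi> t \<omega>))" for t \<omega>
  have X_meas: "(\<lambda>(\<omega>, s). X s \<omega>) \<in> borel_measurable (M \<Otimes>\<^sub>M lborel)"
  proof (rule continuous_process_measurable)
    show "X t \<in> borel_measurable M" for t
      unfolding X_def using \<psi>_M[of t] by measurable
    show "continuous_on UNIV (\<lambda>t. X t \<omega>)" if "\<omega> \<in> space M" for \<omega>
      unfolding X_def by (intro continuous_intros \<psi>_cont that)
  qed
  have X1: "cmod (X t \<omega>) = 1" for t \<omega> unfolding X_def using norm_exp_i_times[of "- \<psi> t \<omega>"] by simp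
  have X_bd: "bounded_at t (X t)" if "0 \<le> t" for t
  proof -
    have "\<psi> t \<in> borel_measurable (F t)" using \<psi>_F[of t] that by (simp add: max_def)
    then have "X t \<in> borel_measurable (F t)" unfolding X_def by measurable
    then show ?thesis unfolding bounded_at_def using X1 by (auto intro!: exI[of _ 1])
  qed
  have "\<exists>I. has_ito_integral M F noiseW t X I \<and> (AE \<omega> in M. \<psi> t \<omega> = l * t + b 0 t \<omega> + Re (I \<omega>))" if t: "0 \<le> t" for t
  proof -
    obtain I where I: "has_ito_integral M F noiseW t (\<lambda>s \<omega>. exp (- \<i> * complex_of_real (\<theta> s \<omega>))) I"
      "AE \<omega> in M. \<theta> t \<omega> = l * t + b 0 t \<omega> + Re (I \<omega>)" using ph t unfolding is_phase_def by blast
    have "has_ito_integral M F noiseW t X I"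
      by (rule has_ito_integral_cong_AE[OF _ I(1)]) (use AE_eq in \<open>eventually_elim; simp add: X_def\<close>)
    moreover have "AE \<omega> in M. \<psi> t \<omega> = l * t + b 0 t \<omega> + Re (I \<omega>)"
      using I(2) AE_eq by eventually_elim (use t in simp)
    ultimately show ?thesis by blast
  qed
  then obtain I where I: "\<And>t. 0 \<le> t \<Longrightarrow> has_ito_integral M F noiseW t X (I t)"
    "\<And>t. 0 \<le> t \<Longrightarrow> AE \<omega> in M. \<psi> t \<omega> = l * t + b 0 t \<omega> + Re (I t \<omega>)" by metis
  have I_M: "I t \<in> borel_measurable M" if "0 \<le> t" for t
    using has_ito_integral_elementary(1)[OF I(1)[OF that]] .
  have I2: "(\<integral>\<^sup>+\<omega>. ennreal ((cmod (I s \<omega> - I t \<omega>))\<^sup>2) \<partial>M) \<le> ennreal (4 * (s - t))" if "0 \<le> t" "t \<le> s" for s t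
  proof -
    have "bounded_at t (\<lambda>_. 0)" unfolding bounded_at_def by auto
    from ito_increment_error[OF that X_meas I(1)[OF that(1)] I(1)[OF order_trans[OF that]] this]
    have "(\<integral>\<^sup>+\<omega>. ennreal ((cmod (I s \<omega> - I t \<omega>))\<^sup>2) \<partial>M) \<le> 4 * energy {t<..s} X" by simp
    also have "energy {t<..s} X = ennreal (s - t)"
      unfolding energy_def X1 using that by (simp add: emeasure_space_1)
    also have "4 * ennreal (s - t) = ennreal (4 * (s - t))"
      using that ennreal_mult[of 4 "s - t"] by simp
    finally show ?thesis .
  qed
  define C where "C = 3 * l\<^sup>2 + 15"
  have C0: "0 \<le> C" unfolding C_def by simp
  have \<psi>2: "(\<integral>\<^sup>+\<omega>. ennreal ((\<psi> s \<omega> - \<psi> t \<omega>)\<^sup>2) \<partial>M) \<le> ennreal (C * (s - t))"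
    if t: "0 \<le> t" "t \<le> s" and st: "s - t \<le> 1" for s t
  proof -
    have s: "0 \<le> s" using t by simp
    note [measurable] = I_M[OF t(1)] I_M[OF s] noise_M[of 0, OF _ t(1)] noise_M[of 0, OF _ s]
    have "(\<integral>\<^sup>+\<omega>. ennreal ((\<psi> s \<omega> - \<psi> t \<omega>)\<^sup>2) \<partial>M) \<le>
       (\<integral>\<^sup>+\<omega>. 3 * ennreal ((l * (s - t))\<^sup>2) + 3 * ennreal ((b 0 s \<omega> - b 0 t \<omega>)\<^sup>2) + 3 * ennreal ((cmod (I s \<omega> - I t \<omega>))\<^sup>2) \<partial>M)"
    proof (rule nn_integral_mono_AE)
      show "AE \<omega> in M. ennreal ((\<psi> s \<omega> - \<psi> t \<omega>)\<^sup>2) \<le>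
         3 * ennreal ((l * (s - t))\<^sup>2) + 3 * ennreal ((b 0 s \<omega> - b 0 t \<omega>)\<^sup>2) + 3 * ennreal ((cmod (I s \<omega> - I t \<omega>))\<^sup>2)"
        using I(2)[OF t(1)] I(2)[OF s]
      proof eventually_elim
        case (elim \<omega>)
        have "\<psi> s \<omega> - \<psi> t \<omega> = l * (s - t) + (b 0 s \<omega> - b 0 t \<omega>) + Re (I s \<omega> - I t \<omega>)"
          unfolding elim by (simp add: algebra_simps)
        then have "ennreal ((\<psi> s \<omega> - \<psi> t \<omega>)\<^sup>2) \<le>
          3 * ennreal ((l * (s - t))\<^sup>2) + 3 * ennreal ((b 0 s \<omega> - b 0 t \<omega>)\<^sup>2) + 3 * ennreal ((Re (I s \<omega> - I t \<omega>))\<^sup>2)"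
          by (simp only: ennreal_square_sum3_le)
        also have "ennreal ((Re (I s \<omega> - I t \<omega>))\<^sup>2) \<le> ennreal ((cmod (I s \<omega> - I t \<omega>))\<^sup>2)"
          using abs_Re_le_cmod[of "I s \<omega> - I t \<omega>"] by (intro ennreal_leI) (metis abs_le_square_iff abs_norm_cancel)
        finally show ?case by (simp add: add_left_mono mult_left_mono)
      qed
    qed
    also have "\<dots> = 3 * ennreal ((l * (s - t))\<^sup>2) + 3 * (\<integral>\<^sup>+\<omega>. ennreal ((b 0 s \<omega> - b 0 t \<omega>)\<^sup>2) \<partial>M) +
        3 * (\<integral>\<^sup>+\<omega>. ennreal ((cmod (I s \<omega> - I t \<omega>))\<^sup>2) \<partial>M)"
      by (simp add: nn_integral_add nn_integral_cmult emeasure_space_1)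
    also have "(\<integral>\<^sup>+\<omega>. ennreal ((b 0 s \<omega> - b 0 t \<omega>)\<^sup>2) \<partial>M) = ennreal (s - t)"
      using noise_square_integral[of 0, OF _ t] by (subst nn_integral_eq_integral) (auto simp: has_bochner_integral_iff)
    also have "3 * ennreal ((l * (s - t))\<^sup>2) + 3 * ennreal (s - t) + 3 * (\<integral>\<^sup>+\<omega>. ennreal ((cmod (I s \<omega> - I t \<omega>))\<^sup>2) \<partial>M) \<le>
        3 * ennreal ((l * (s - t))\<^sup>2) + 3 * ennreal (s - t) + 3 * ennreal (4 * (s - t))"
      using t by (intro add_left_mono mult_left_mono I2) auto
    also have "\<dots> = ennreal (3 * (l * (s - t))\<^sup>2 + 3 * (s - t) + 3 * (4 * (s - t)))"
    proof -
      have *: "3 * ennreal x = ennreal (3 * x)" if "0 \<le> x" for x using ennreal_mult[of 3 x] that by simp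
      have "0 \<le> s - t" using t by simp
      then show ?thesis
        unfolding *[OF zero_le_power2] *[OF \<open>0 \<le> s - t\<close>] *[OF mult_nonneg_nonneg[OF zero_le_numeral \<open>0 \<le> s - t\<close>]]
        by (simp only: ennreal_plus mult_nonneg_nonneg add_nonneg_nonneg zero_le_power2 zero_le_numeral)
    qed
    also have "\<dots> \<le> ennreal (C * (s - t))"
    proof (rule ennreal_leI)
      have "(s - t)\<^sup>2 \<le> (s - t)" using st t mult_left_mono[of "s - t" 1 "s - t"] by (simp add: power2_eq_square)
      then have "l\<^sup>2 * (s - t)\<^sup>2 \<le> l\<^sup>2 * (s - t)" by (intro mult_left_mono) auto
      then show "3 * (l * (s - t))\<^sup>2 + 3 * (s - t) + 3 * (4 * (s - t)) \<le> C * (s - t)"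
        unfolding C_def power_mult_distrib by (simp add: algebra_simps)
    qed
    finally show ?thesis .
  qed
  have en: "energy {t<..t + h} (\<lambda>s \<omega>. X s \<omega> - X t \<omega>) \<le> ennreal (C * h\<^sup>2)" if t: "0 \<le> t" and h: "0 \<le> h" "h \<le> 1" for t h
  proof -
    interpret P: pair_sigma_finite M lborel ..
    have X': "(\<lambda>x. X (snd x) (fst x)) \<in> borel_measurable (M \<Otimes>\<^sub>M lborel)"
      using X_meas by (simp add: case_prod_unfold)
    have Xt: "(\<lambda>x. X t (fst x)) \<in> borel_measurable (M \<Otimes>\<^sub>M lborel)"
      by (rule measurable_compose[OF measurable_fst]) (rule F_meas_M[OF t bounded_atD[OF X_bd[OF t]]])
    have "energy {t<..t + h} (\<lambda>s \<omega>. X s \<omega> - X t \<omega>) =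
       (\<integral>\<^sup>+s. (\<integral>\<^sup>+\<omega>. ennreal ((cmod (X s \<omega> - X t \<omega>))\<^sup>2) * indicator {t<..t + h} s \<partial>M) \<partial>lborel)"
      unfolding energy_def
    proof (rule P.Fubini'[symmetric])
      show "(\<lambda>(\<omega>, s). ennreal ((cmod (X s \<omega> - X t \<omega>))\<^sup>2) * indicator {t<..t + h} s) \<in> borel_measurable (M \<Otimes>\<^sub>M lborel)"
        unfolding case_prod_unfold using X' Xt by measurable
    qed
    also have "\<dots> \<le> (\<integral>\<^sup>+s. ennreal (C * h) * indicator {t<..t + h} s \<partial>lborel)"
    proof (rule nn_integral_mono)
      fix s
      show "(\<integral>\<^sup>+\<omega>. ennreal ((cmod (X s \<omega> - X t \<omega>))\<^sup>2) * indicator {t<..t + h} s \<partial>M) \<le> ennreal (C * h) * indicator {t<..t + h} s"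
      proof (cases "s \<in> {t<..t + h}")
        case True
        have "(\<integral>\<^sup>+\<omega>. ennreal ((cmod (X s \<omega> - X t \<omega>))\<^sup>2) \<partial>M) \<le> (\<integral>\<^sup>+\<omega>. ennreal ((\<psi> s \<omega> - \<psi> t \<omega>)\<^sup>2) \<partial>M)"
        proof (intro nn_integral_mono ennreal_leI)
          fix \<omega>
          show "(cmod (X s \<omega> - X t \<omega>))\<^sup>2 \<le> (\<psi> s \<omega> - \<psi> t \<omega>)\<^sup>2"
            unfolding X_def using norm_exp_imaginary_diff_le[of "\<psi> s \<omega>" "\<psi> t \<omega>"]
            by (metis abs_le_square_iff abs_norm_cancel)
        qed
        also have "\<dots> \<le> ennreal (C * (s - t))" using True t h by (intro \<psi>2) auto
        also have "\<dots> \<le> ennreal (C * h)" using True C0 by (intro ennreal_leI mult_left_mono) auto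
        finally show ?thesis using True by simp
      qed simp
    qed
    also have "\<dots> = ennreal (C * h) * ennreal h" using h by (simp add: nn_integral_cmult_indicator)
    also have "\<dots> = ennreal (C * h\<^sup>2)" using C0 h by (simp add: ennreal_mult[symmetric] power2_eq_square mult.assoc)
    finally show ?thesis .
  qed
  show ?thesis unfolding phase_remainder_def
  proof (intro exI[of _ "4 * C"] conjI allI impI)
    show "0 \<le> 4 * C" using C0 by simp
    fix t h :: real assume th: "0 \<le> t \<and> 0 \<le> h \<and> h \<le> 1"
    then have t: "0 \<le> t" and h: "0 \<le> h" "h \<le> 1" and t': "t \<le> t + h" and t'0: "0 \<le> t + h" by auto
    define Z where "Z \<omega> = I (t + h) \<omega> - I t \<omega> - X t \<omega> * (noiseW (t + h) \<omega> - noiseW t \<omega>)" for \<omega>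
    define R where "R \<omega> = Re (Z \<omega>)" for \<omega>
    have [measurable]: "Z \<in> borel_measurable M"
      unfolding Z_def
      by (intro borel_measurable_diff borel_measurable_times I_M t t'0 F_meas_M[OF t bounded_atD[OF X_bd[OF t]]]
           F_meas_M[OF t'0 W_adapted] F_meas_M[OF t W_adapted])
    have [measurable]: "R \<in> borel_measurable M" unfolding R_def by measurable
    have Z2: "(\<integral>\<^sup>+\<omega>. ennreal ((cmod (Z \<omega>))\<^sup>2) \<partial>M) \<le> ennreal (4 * C * h\<^sup>2)"
    proof -
      have "(\<integral>\<^sup>+\<omega>. ennreal ((cmod (Z \<omega>))\<^sup>2) \<partial>M) \<le> 4 * energy {t<..t + h} (\<lambda>s \<omega>. X s \<omega> - X t \<omega>)"
        unfolding Z_def by (rule ito_increment_error[OF t t' X_meas I(1)[OF t] I(1)[OF t'0] X_bd[OF t]])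
      also have "\<dots> \<le> 4 * ennreal (C * h\<^sup>2)" by (intro mult_left_mono en t h) simp
      also have "\<dots> = ennreal (4 * C * h\<^sup>2)" using C0 by (simp add: ennreal_mult mult.assoc)
      finally show ?thesis .
    qed
    have R2: "(\<integral>\<^sup>+\<omega>. ennreal ((R \<omega>)\<^sup>2) \<partial>M) \<le> ennreal (4 * C * h\<^sup>2)"
    proof (rule order_trans[OF nn_integral_mono Z2])
      fix \<omega> show "ennreal ((R \<omega>)\<^sup>2) \<le> ennreal ((cmod (Z \<omega>))\<^sup>2)"
        unfolding R_def using abs_Re_le_cmod[of "Z \<omega>"] by (intro ennreal_leI) (metis abs_le_square_iff abs_norm_cancel)
    qed
    have iR2: "integrable M (\<lambda>\<omega>. (R \<omega>)\<^sup>2)"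
      by (rule integrableI_bounded) (use R2 in \<open>auto intro: order.strict_trans1\<close>)
    moreover have iR: "integrable M R"
      by (rule square_integrable_imp_integrable[OF _ iR2]) simp
    moreover have "(\<integral>\<omega>. (R \<omega>)\<^sup>2 \<partial>M) \<le> 4 * C * h\<^sup>2"
      using R2 nn_integral_eq_integral[OF iR2] C0 by (simp add: ennreal_le_iff)
    moreover have "has_bochner_integral M (\<lambda>\<omega>. g \<omega> * R \<omega>) 0" if g: "rbounded t g" for g
    proof -
      let ?g = "\<lambda>\<omega>. complex_of_real (g \<omega>)"
      have gX: "bounded_at t (\<lambda>\<omega>. ?g \<omega> * X t \<omega>)"
        by (intro bounded_at_times rbounded_of_real g X_bd t)
      have "has_bochner_integral M (\<lambda>\<omega>. ?g \<omega> * (I (t + h) \<omega> - I t \<omega>)) 0"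
        by (rule ito_increment_mean[OF t t' X_meas I(1)[OF t] I(1)[OF t'0] rbounded_of_real[OF g]])
      moreover have "has_bochner_integral M (\<lambda>\<omega>. (?g \<omega> * X t \<omega>) * (noiseW (t + h) \<omega> - noiseW t \<omega>)) 0"
        by (rule W_mean[OF t t' bounded_atD[OF gX] integrable_bounded_at[OF t gX]])
      ultimately have "has_bochner_integral M (\<lambda>\<omega>. ?g \<omega> * (I (t + h) \<omega> - I t \<omega>) - (?g \<omega> * X t \<omega>) * (noiseW (t + h) \<omega> - noiseW t \<omega>)) (0 - 0)"
        by (rule has_bochner_integral_diff)
      then have "has_bochner_integral M (\<lambda>\<omega>. Re (?g \<omega> * (I (t + h) \<omega> - I t \<omega>) - (?g \<omega> * X t \<omega>) * (noiseW (t + h) \<omega> - noiseW t \<omega>))) (Re (0 - 0))"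
        by (rule has_bochner_integral_bounded_linear[OF bounded_linear_Re])
      moreover have "Re (?g \<omega> * (I (t + h) \<omega> - I t \<omega>) - (?g \<omega> * X t \<omega>) * (noiseW (t + h) \<omega> - noiseW t \<omega>)) = g \<omega> * R \<omega>" for \<omega>
      proof -
        have "?g \<omega> * (I (t + h) \<omega> - I t \<omega>) - (?g \<omega> * X t \<omega>) * (noiseW (t + h) \<omega> - noiseW t \<omega>) = ?g \<omega> * Z \<omega>"
          unfolding Z_def by (simp add: algebra_simps)
        then show ?thesis by (simp add: R_def)
      qed
      ultimately show ?thesis by simp
    qed
    moreover have "AE \<omega> in M. \<theta> (t + h) \<omega> - \<theta> t \<omega> = l * h + (b 0 (t + h) \<omega> - b 0 t \<omega>) +
        (cos (\<theta> t \<omega>) * (b 1 (t + h) \<omega> - b 1 t \<omega>) + sin (\<theta> t \<omega>) * (b 2 (t + h) \<omega> - b 2 t \<omega>)) / sqrt 2 + R \<omega>"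
      using AE_eq I(2)[OF t] I(2)[OF t'0]
    proof eventually_elim
      case (elim \<omega>)
      have "\<theta> (t + h) \<omega> - \<theta> t \<omega> = l * h + (b 0 (t + h) \<omega> - b 0 t \<omega>) + Re (I (t + h) \<omega> - I t \<omega>)"
        using elim t t'0 by (simp add: algebra_simps)
      also have "Re (I (t + h) \<omega> - I t \<omega>) = Re (X t \<omega> * (noiseW (t + h) \<omega> - noiseW t \<omega>)) + R \<omega>"
        unfolding R_def Z_def by simp
      also have "Re (X t \<omega> * (noiseW (t + h) \<omega> - noiseW t \<omega>)) =
        (cos (\<theta> t \<omega>) * (b 1 (t + h) \<omega> - b 1 t \<omega>) + sin (\<theta> t \<omega>) * (b 2 (t + h) \<omega> - b 2 t \<omega>)) / sqrt 2"
      proof -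
        have "X t \<omega> = cis (- \<theta> t \<omega>)" unfolding X_def cis_conv_exp using elim(1) t by simp
        moreover have "noiseW (t + h) \<omega> - noiseW t \<omega> =
           Complex ((b 1 (t + h) \<omega> - b 1 t \<omega>) / sqrt 2) ((b 2 (t + h) \<omega> - b 2 t \<omega>) / sqrt 2)"
          unfolding planar_noise_def by (simp add: complex_eq_iff Re_divide_of_real Im_divide_of_real diff_divide_distrib)
        ultimately show ?thesis by (simp add: add_divide_distrib)
      qed
      finally show ?case by simp
    qed
    ultimately show "\<exists>R. (AE \<omega> in M. \<theta> (t + h) \<omega> - \<theta> t \<omega> = l * h + (b 0 (t + h) \<omega> - b 0 t \<omega>) +
        (cos (\<theta> t \<omega>) * (b 1 (t + h) \<omega> - b 1 t \<omega>) + sin (\<theta> t \<omega>) * (b 2 (t + h) \<omega> - b 2 t \<omega>)) / sqrt 2 + R \<omega>) \<and>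
     integrable M R \<and> integrable M (\<lambda>\<omega>. (R \<omega>)\<^sup>2) \<and> (\<integral>\<omega>. (R \<omega>)\<^sup>2 \<partial>M) \<le> 4 * C * h\<^sup>2 \<and>
     (\<forall>g. rbounded t g \<longrightarrow> has_bochner_integral M (\<lambda>\<omega>. g \<omega> * R \<omega>) 0)" by blast
  qed
qed

end

section \<open>Second order expansion of test functions\<close>

text \<open>The bound on the third derivative controls the remainder of a second order expansion by the cube of
  the displacement, uniformly in the base point.\<close>

definition bounded_C3 :: "(real \<Rightarrow> real) \<Rightarrow> (real \<Rightarrow> real) \<Rightarrow> (real \<Rightarrow> real) \<Rightarrow> (real \<Rightarrow> real) \<Rightarrow> bool" where
  "bounded_C3 f f1 f2 f3 \<longleftrightarrow>
     (\<forall>x. (f has_real_derivative f1 x) (at x)) \<and> (\<forall>x. (f1 has_real_derivative f2 x) (at x)) \<and>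
     (\<forall>x. (f2 has_real_derivative f3 x) (at x)) \<and>
     (\<exists>C. \<forall>x. \<bar>f x\<bar> \<le> C \<and> \<bar>f1 x\<bar> \<le> C \<and> \<bar>f2 x\<bar> \<le> C \<and> \<bar>f3 x\<bar> \<le> C)"

lemma taylor3_bound:
  fixes g :: "real \<Rightarrow> real"
  assumes "\<And>t. (g has_real_derivative g1 t) (at t)" "\<And>t. (g1 has_real_derivative g2 t) (at t)"
    "\<And>t. (g2 has_real_derivative g3 t) (at t)" and b: "\<And>t. \<bar>g3 t\<bar> \<le> K"
  shows "\<bar>g 1 - g 0 - g1 0 - g2 0 / 2\<bar> \<le> K / 6"
proof -
  define D where "D m = (if m = 0 then g else if m = 1 then g1 else if m = 2 then g2 else g3)" for m :: nat
  have "\<exists>t>0. t < 1 \<and> g 1 = (\<Sum>m<3. D m 0 / fact m * 1 ^ m) + D 3 t / fact 3 * 1 ^ 3"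
  proof (rule Maclaurin)
    show "\<forall>m t. m < 3 \<and> 0 \<le> t \<and> t \<le> 1 \<longrightarrow> DERIV (D m) t :> D (Suc m) t"
    proof (intro allI impI)
      fix m :: nat and t :: real assume "m < 3 \<and> 0 \<le> t \<and> t \<le> 1"
      then have "m = 0 \<or> m = 1 \<or> m = 2" by auto
      then show "DERIV (D m) t :> D (Suc m) t" using assms by (auto simp: D_def)
    qed
  qed (auto simp: D_def)
  then obtain t where "g 1 = (\<Sum>m<3. D m 0 / fact m * 1 ^ m) + D 3 t / fact 3 * 1 ^ 3" by blast
  then have "g 1 - g 0 - g1 0 - g2 0 / 2 = g3 t / 6"
    by (simp add: D_def numeral_eq_Suc)
  then show ?thesis using b[of t] by (simp only: abs_divide)
qed

lemma taylor2_bound: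
  fixes g :: "real \<Rightarrow> real"
  assumes "\<And>t. (g has_real_derivative g1 t) (at t)" "\<And>t. (g1 has_real_derivative g2 t) (at t)"
    and b: "\<And>t. \<bar>g2 t\<bar> \<le> K"
  shows "\<bar>g 1 - g 0 - g1 0\<bar> \<le> K / 2"
proof -
  define D where "D m = (if m = 0 then g else if m = 1 then g1 else g2)" for m :: nat
  have "\<exists>t>0. t < 1 \<and> g 1 = (\<Sum>m<2. D m 0 / fact m * 1 ^ m) + D 2 t / fact 2 * 1 ^ 2"
  proof (rule Maclaurin)
    show "\<forall>m t. m < 2 \<and> 0 \<le> t \<and> t \<le> 1 \<longrightarrow> DERIV (D m) t :> D (Suc m) t"
    proof (intro allI impI)
      fix m :: nat and t :: real assume "m < 2 \<and> 0 \<le> t \<and> t \<le> 1"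
      then have "m = 0 \<or> m = 1" by auto
      then show "DERIV (D m) t :> D (Suc m) t" using assms by (auto simp: D_def)
    qed
  qed (auto simp: D_def)
  then obtain t where "g 1 = (\<Sum>m<2. D m 0 / fact m * 1 ^ m) + D 2 t / fact 2 * 1 ^ 2" by blast
  then have "g 1 - g 0 - g1 0 = g2 t / 2"
    by (simp add: D_def numeral_eq_Suc)
  then show ?thesis using b[of t] by (simp only: abs_divide)
qed

lemma product_line_derivative:
  assumes "\<And>x. (p has_real_derivative p1 x) (at x)" "\<And>x. (q has_real_derivative q1 x) (at x)"
  shows "((\<lambda>t. p (x + t * a) * q (y + t * b)) has_real_derivative
     (p1 (x + t * a) * q (y + t * b) * a + p (x + t * a) * q1 (y + t * b) * b)) (at t)"
proof -
  have 1: "((\<lambda>t. p (x + t * a)) has_real_derivative p1 (x + t * a) * a) (at t)"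
    by (rule DERIV_chain2[OF assms(1)]) (auto intro!: derivative_eq_intros)
  have 2: "((\<lambda>t. q (y + t * b)) has_real_derivative q1 (y + t * b) * b) (at t)"
    by (rule DERIV_chain2[OF assms(2)]) (auto intro!: derivative_eq_intros)
  show ?thesis using DERIV_mult[OF 1 2] by (simp add: algebra_simps)
qed

lemma product_lipschitz:
  fixes p q :: "real \<Rightarrow> real"
  assumes d: "\<And>x. (p has_real_derivative p1 x) (at x)" "\<And>x. (q has_real_derivative q1 x) (at x)"
    and b: "\<And>x. \<bar>p x\<bar> \<le> C" "\<And>x. \<bar>p1 x\<bar> \<le> C" "\<And>x. \<bar>q x\<bar> \<le> C" "\<And>x. \<bar>q1 x\<bar> \<le> C"
  shows "\<bar>p (x + a) * q (y + b) - p x * q y\<bar> \<le> C\<^sup>2 * (\<bar>a\<bar> + \<bar>b\<bar>)"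
proof -
  have C: "0 \<le> C" using b(1)[of 0] by linarith
  have lip: "\<bar>f (x + a) - f x\<bar> \<le> C * \<bar>a\<bar>"
    if "\<And>x. (f has_real_derivative f1 x) (at x)" "\<And>x. \<bar>f1 x\<bar> \<le> C" for f f1 :: "real \<Rightarrow> real" and x a
    using field_differentiable_bound[of UNIV f f1 C x "x + a"] that by (auto simp: has_field_derivative_at_within)
  have "p (x + a) * q (y + b) - p x * q y = (p (x + a) - p x) * q (y + b) + p x * (q (y + b) - q y)"
    by (simp add: algebra_simps)
  also have "\<bar>\<dots>\<bar> \<le> \<bar>p (x + a) - p x\<bar> * \<bar>q (y + b)\<bar> + \<bar>p x\<bar> * \<bar>q (y + b) - q y\<bar>"
    by (metis abs_mult abs_triangle_ineq)
  also have "\<dots> \<le> (C * \<bar>a\<bar>) * C + C * (C * \<bar>b\<bar>)"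
    by (intro add_mono mult_mono lip[OF d(1) b(2)] lip[OF d(2) b(4)] b) (auto simp: C)
  finally show ?thesis by (simp add: power2_eq_square algebra_simps)
qed

text \<open>A displacement is split into a main part \<open>Z\<close> and a small part \<open>r\<close> that only enters to first order,
  so that the mean square of \<open>r\<close> controls its share of the remainder.\<close>

lemma product_expansion:
  assumes f: "bounded_C3 f f1 f2 f3" and k: "bounded_C3 k k1 k2 k3"
  shows "\<exists>C\<ge>0. \<forall>x y Z Z' r r'.
    \<bar>f (x + Z + r) * k (y + Z' + r') - f x * k y - f1 x * k y * (Z + r) - f x * k1 y * (Z' + r')
      - (f2 x * k y * Z\<^sup>2 + 2 * f1 x * k1 y * Z * Z' + f x * k2 y * Z'\<^sup>2) / 2\<bar>
    \<le> C * ((\<bar>Z\<bar> + \<bar>Z'\<bar>) ^ 3 + (\<bar>Z\<bar> + \<bar>Z'\<bar>) * (\<bar>r\<bar> + \<bar>r'\<bar>) + (\<bar>r\<bar> + \<bar>r'\<bar>)\<^sup>2)"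
proof -
  have f': "\<And>x. (f has_real_derivative f1 x) (at x)" "\<And>x. (f1 has_real_derivative f2 x) (at x)"
     "\<And>x. (f2 has_real_derivative f3 x) (at x)" using f unfolding bounded_C3_def by auto
  have k': "\<And>x. (k has_real_derivative k1 x) (at x)" "\<And>x. (k1 has_real_derivative k2 x) (at x)"
     "\<And>x. (k2 has_real_derivative k3 x) (at x)" using k unfolding bounded_C3_def by auto
  obtain Cf Ck where C': "\<And>x. \<bar>f x\<bar> \<le> Cf \<and> \<bar>f1 x\<bar> \<le> Cf \<and> \<bar>f2 x\<bar> \<le> Cf \<and> \<bar>f3 x\<bar> \<le> Cf"
     "\<And>x. \<bar>k x\<bar> \<le> Ck \<and> \<bar>k1 x\<bar> \<le> Ck \<and> \<bar>k2 x\<bar> \<le> Ck \<and> \<bar>k3 x\<bar> \<le> Ck"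
    using f k unfolding bounded_C3_def by metis
  define C where "C = max Cf Ck"
  have fb: "\<bar>f x\<bar> \<le> C" "\<bar>f1 x\<bar> \<le> C" "\<bar>f2 x\<bar> \<le> C" "\<bar>f3 x\<bar> \<le> C" for x
    using C'(1)[of x] unfolding C_def by auto
  have kb: "\<bar>k x\<bar> \<le> C" "\<bar>k1 x\<bar> \<le> C" "\<bar>k2 x\<bar> \<le> C" "\<bar>k3 x\<bar> \<le> C" for x
    using C'(2)[of x] unfolding C_def by auto
  have C: "0 \<le> C" using fb(1)[of 0] by linarith
  have pb: "\<bar>p * q\<bar> \<le> C\<^sup>2" if "\<bar>p\<bar> \<le> C" "\<bar>q\<bar> \<le> C" for p q
    unfolding abs_mult power2_eq_square using that C by (intro mult_mono) auto
  have cube: "c * A ^ 3 + c * (3 * A\<^sup>2 * B) + c * (3 * A * B\<^sup>2) + c * B ^ 3 = c * (A + B) ^ 3"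
    and square: "c * A\<^sup>2 + c * (2 * A * B) + c * B\<^sup>2 = c * (A + B)\<^sup>2" for c A B :: real
    by (simp_all add: power3_eq_cube power2_eq_square algebra_simps)
  have T3: "\<bar>f (x + a) * k (y + b) - f x * k y - (f1 x * k y * a + f x * k1 y * b)
      - (f2 x * k y * a\<^sup>2 + 2 * f1 x * k1 y * a * b + f x * k2 y * b\<^sup>2) / 2\<bar> \<le> C\<^sup>2 * (\<bar>a\<bar> + \<bar>b\<bar>) ^ 3 / 6" for x y a b
  proof -
    define u where "u p q t = p (x + t * a) * q (y + t * b)" for p q :: "real \<Rightarrow> real" and t
    have du: "(u p q has_real_derivative u p1 q t * a + u p q1 t * b) (at t)"
      if "\<And>x. (p has_real_derivative p1 x) (at x)" "\<And>x. (q has_real_derivative q1 x) (at x)" for p q p1 q1 t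
      using product_line_derivative[OF that, of x a y b t] unfolding u_def .
    have "\<bar>u f k 1 - u f k 0 - (u f1 k 0 * a + u f k1 0 * b)
        - (u f2 k 0 * a\<^sup>2 + 2 * u f1 k1 0 * a * b + u f k2 0 * b\<^sup>2) / 2\<bar> \<le> (C\<^sup>2 * (\<bar>a\<bar> + \<bar>b\<bar>) ^ 3) / 6"
    proof (rule taylor3_bound)
      fix t
      show "(u f k has_real_derivative u f1 k t * a + u f k1 t * b) (at t)" by (rule du f' k')+
      show "((\<lambda>t. u f1 k t * a + u f k1 t * b) has_real_derivative
          u f2 k t * a\<^sup>2 + 2 * u f1 k1 t * a * b + u f k2 t * b\<^sup>2) (at t)"
        by (rule derivative_eq_intros du f' k' refl)+ (simp add: algebra_simps power2_eq_square)
      show "((\<lambda>t. u f2 k t * a\<^sup>2 + 2 * u f1 k1 t * a * b + u f k2 t * b\<^sup>2) has_real_derivative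
          u f3 k t * a ^ 3 + 3 * u f2 k1 t * a\<^sup>2 * b + 3 * u f1 k2 t * a * b\<^sup>2 + u f k3 t * b ^ 3) (at t)"
        by (rule derivative_eq_intros du f' k' refl)+ (simp add: algebra_simps power2_eq_square power3_eq_cube)
      have "\<bar>u f3 k t * a ^ 3 + 3 * u f2 k1 t * a\<^sup>2 * b + 3 * u f1 k2 t * a * b\<^sup>2 + u f k3 t * b ^ 3\<bar> \<le>
         \<bar>u f3 k t * a ^ 3\<bar> + \<bar>3 * u f2 k1 t * a\<^sup>2 * b\<bar> + \<bar>3 * u f1 k2 t * a * b\<^sup>2\<bar> + \<bar>u f k3 t * b ^ 3\<bar>" by linarith
      also have "\<dots> = \<bar>u f3 k t\<bar> * \<bar>a\<bar> ^ 3 + \<bar>u f2 k1 t\<bar> * (3 * \<bar>a\<bar>\<^sup>2 * \<bar>b\<bar>) + \<bar>u f1 k2 t\<bar> * (3 * \<bar>a\<bar> * \<bar>b\<bar>\<^sup>2) + \<bar>u f k3 t\<bar> * \<bar>b\<bar> ^ 3"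
        by (simp add: abs_mult power_abs mult_ac)
      also have "\<dots> \<le> C\<^sup>2 * \<bar>a\<bar> ^ 3 + C\<^sup>2 * (3 * \<bar>a\<bar>\<^sup>2 * \<bar>b\<bar>) + C\<^sup>2 * (3 * \<bar>a\<bar> * \<bar>b\<bar>\<^sup>2) + C\<^sup>2 * \<bar>b\<bar> ^ 3"
        unfolding u_def by (intro add_mono mult_right_mono pb fb kb) auto
      also have "\<dots> = C\<^sup>2 * (\<bar>a\<bar> + \<bar>b\<bar>) ^ 3" by (rule cube)
      finally show "\<bar>u f3 k t * a ^ 3 + 3 * u f2 k1 t * a\<^sup>2 * b + 3 * u f1 k2 t * a * b\<^sup>2 + u f k3 t * b ^ 3\<bar> \<le> C\<^sup>2 * (\<bar>a\<bar> + \<bar>b\<bar>) ^ 3" .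
    qed
    then show ?thesis by (simp add: u_def mult.assoc)
  qed
  have T2: "\<bar>f (x + a) * k (y + b) - f x * k y - (f1 x * k y * a + f x * k1 y * b)\<bar> \<le> C\<^sup>2 * (\<bar>a\<bar> + \<bar>b\<bar>)\<^sup>2 / 2" for x y a b
  proof -
    define u where "u p q t = p (x + t * a) * q (y + t * b)" for p q :: "real \<Rightarrow> real" and t
    have du: "(u p q has_real_derivative u p1 q t * a + u p q1 t * b) (at t)"
      if "\<And>x. (p has_real_derivative p1 x) (at x)" "\<And>x. (q has_real_derivative q1 x) (at x)" for p q p1 q1 t
      using product_line_derivative[OF that, of x a y b t] unfolding u_def .
    have "\<bar>u f k 1 - u f k 0 - (u f1 k 0 * a + u f k1 0 * b)\<bar> \<le> (C\<^sup>2 * (\<bar>a\<bar> + \<bar>b\<bar>)\<^sup>2) / 2"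
    proof (rule taylor2_bound)
      fix t
      show "(u f k has_real_derivative u f1 k t * a + u f k1 t * b) (at t)" by (rule du f' k')+
      show "((\<lambda>t. u f1 k t * a + u f k1 t * b) has_real_derivative
          u f2 k t * a\<^sup>2 + 2 * u f1 k1 t * a * b + u f k2 t * b\<^sup>2) (at t)"
        by (rule derivative_eq_intros du f' k' refl)+ (simp add: algebra_simps power2_eq_square)
      have "\<bar>u f2 k t * a\<^sup>2 + 2 * u f1 k1 t * a * b + u f k2 t * b\<^sup>2\<bar> \<le>
         \<bar>u f2 k t * a\<^sup>2\<bar> + \<bar>2 * u f1 k1 t * a * b\<bar> + \<bar>u f k2 t * b\<^sup>2\<bar>" by linarith
      also have "\<dots> = \<bar>u f2 k t\<bar> * \<bar>a\<bar>\<^sup>2 + \<bar>u f1 k1 t\<bar> * (2 * \<bar>a\<bar> * \<bar>b\<bar>) + \<bar>u f k2 t\<bar> * \<bar>b\<bar>\<^sup>2"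
        by (simp add: abs_mult mult_ac)
      also have "\<dots> \<le> C\<^sup>2 * \<bar>a\<bar>\<^sup>2 + C\<^sup>2 * (2 * \<bar>a\<bar> * \<bar>b\<bar>) + C\<^sup>2 * \<bar>b\<bar>\<^sup>2"
        unfolding u_def by (intro add_mono mult_right_mono pb fb kb) auto
      also have "\<dots> = C\<^sup>2 * (\<bar>a\<bar> + \<bar>b\<bar>)\<^sup>2" by (rule square)
      finally show "\<bar>u f2 k t * a\<^sup>2 + 2 * u f1 k1 t * a * b + u f k2 t * b\<^sup>2\<bar> \<le> C\<^sup>2 * (\<bar>a\<bar> + \<bar>b\<bar>)\<^sup>2" .
    qed
    then show ?thesis by (simp add: u_def)
  qed
  have T1: "\<bar>f1 (x + a) * k (y + b) - f1 x * k y\<bar> \<le> C\<^sup>2 * (\<bar>a\<bar> + \<bar>b\<bar>)"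
    "\<bar>f (x + a) * k1 (y + b) - f x * k1 y\<bar> \<le> C\<^sup>2 * (\<bar>a\<bar> + \<bar>b\<bar>)" for x y a b
    by (rule product_lipschitz; fact f' k' fb kb)+
  show ?thesis
  proof (intro exI[of _ "C\<^sup>2"] conjI allI)
    fix x y Z Z' r r' :: real
    let ?z = "\<bar>Z\<bar> + \<bar>Z'\<bar>" and ?r = "\<bar>r\<bar> + \<bar>r'\<bar>"
    let ?E3 = "f (x + Z) * k (y + Z') - f x * k y - (f1 x * k y * Z + f x * k1 y * Z')
      - (f2 x * k y * Z\<^sup>2 + 2 * f1 x * k1 y * Z * Z' + f x * k2 y * Z'\<^sup>2) / 2"
    let ?E2 = "f (x + Z + r) * k (y + Z' + r') - f (x + Z) * k (y + Z')
       - (f1 (x + Z) * k (y + Z') * r + f (x + Z) * k1 (y + Z') * r')"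
    let ?E1 = "(f1 (x + Z) * k (y + Z') - f1 x * k y) * r" and ?E1' = "(f (x + Z) * k1 (y + Z') - f x * k1 y) * r'"
    have sum4: "\<bar>e\<bar> \<le> c3 + c2 + c1 + c1'"
      if "e = e3 + e2 + e1 + e1'" "\<bar>e3\<bar> \<le> c3" "\<bar>e2\<bar> \<le> c2" "\<bar>e1\<bar> \<le> c1" "\<bar>e1'\<bar> \<le> c1'"
      for e e3 e2 e1 e1' c3 c2 c1 c1' :: real using that by linarith
    have "\<bar>f (x + Z + r) * k (y + Z' + r') - f x * k y - f1 x * k y * (Z + r) - f x * k1 y * (Z' + r')
      - (f2 x * k y * Z\<^sup>2 + 2 * f1 x * k1 y * Z * Z' + f x * k2 y * Z'\<^sup>2) / 2\<bar> \<le>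
      C\<^sup>2 * ?z ^ 3 / 6 + C\<^sup>2 * ?r\<^sup>2 / 2 + (C\<^sup>2 * ?z) * \<bar>r\<bar> + (C\<^sup>2 * ?z) * \<bar>r'\<bar>"
    proof (rule sum4)
      show "f (x + Z + r) * k (y + Z' + r') - f x * k y - f1 x * k y * (Z + r) - f x * k1 y * (Z' + r')
        - (f2 x * k y * Z\<^sup>2 + 2 * f1 x * k1 y * Z * Z' + f x * k2 y * Z'\<^sup>2) / 2 = ?E3 + ?E2 + ?E1 + ?E1'"
        by (simp add: algebra_simps)
      show "\<bar>?E3\<bar> \<le> C\<^sup>2 * ?z ^ 3 / 6" by (rule T3)
      show "\<bar>?E2\<bar> \<le> C\<^sup>2 * ?r\<^sup>2 / 2" by (rule T2)
      show "\<bar>?E1\<bar> \<le> (C\<^sup>2 * ?z) * \<bar>r\<bar>" unfolding abs_mult by (rule mult_right_mono[OF T1(1)]) simp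
      show "\<bar>?E1'\<bar> \<le> (C\<^sup>2 * ?z) * \<bar>r'\<bar>" unfolding abs_mult by (rule mult_right_mono[OF T1(2)]) simp
    qed
    also have "\<dots> \<le> C\<^sup>2 * (?z ^ 3 + ?z * ?r + ?r\<^sup>2)"
    proof -
      define A where "A = ?z"
      define R where "R = ?r"
      have "0 \<le> A" "0 \<le> R" unfolding A_def R_def by auto
      then have "0 \<le> C\<^sup>2 * A ^ 3" "0 \<le> C\<^sup>2 * R\<^sup>2" by auto
      moreover have "(C\<^sup>2 * A) * \<bar>r\<bar> + (C\<^sup>2 * A) * \<bar>r'\<bar> = C\<^sup>2 * (A * R)" unfolding R_def by (simp add: algebra_simps)
      ultimately have "C\<^sup>2 * A ^ 3 / 6 + C\<^sup>2 * R\<^sup>2 / 2 + (C\<^sup>2 * A) * \<bar>r\<bar> + (C\<^sup>2 * A) * \<bar>r'\<bar> \<le> C\<^sup>2 * (A ^ 3 + A * R + R\<^sup>2)"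
        unfolding distrib_left[of "C\<^sup>2"] by linarith
      then show ?thesis unfolding A_def R_def .
    qed
    finally show "\<bar>f (x + Z + r) * k (y + Z' + r') - f x * k y - f1 x * k y * (Z + r) - f x * k1 y * (Z' + r')
      - (f2 x * k y * Z\<^sup>2 + 2 * f1 x * k1 y * Z * Z' + f x * k2 y * Z'\<^sup>2) / 2\<bar>
      \<le> C\<^sup>2 * (?z ^ 3 + ?z * ?r + ?r\<^sup>2)" .
  qed simp
qed

text \<open>Odd powers are split into even ones, whose moments are known, by the arithmetic-geometric inequality
  with weight \<open>s\<close>. Each term is of order \<open>s\<^sup>3 = h * sqrt h\<close> in the mean when \<open>S\<close> is of the size of a Brownian increment
  over time \<open>h = s\<^sup>2\<close> and \<open>T\<close> is of order \<open>h\<close>.\<close>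

lemma remainder_bound:
  fixes s S T \<kappa> :: real
  assumes s: "0 < s" "s \<le> 1" and nn: "0 \<le> S" "0 \<le> T" "0 \<le> \<kappa>"
    and z: "0 \<le> z" "z \<le> 3 * S" and r: "0 \<le> r" "r \<le> \<kappa> * s\<^sup>2 + T"
  shows "z ^ 3 + z * r + r\<^sup>2 \<le>
     (2 * \<kappa> + 2 * \<kappa>\<^sup>2) * s ^ 3 + (15 + 2 * \<kappa>) * (s * S\<^sup>2) + 14 * (S ^ 4 / s) + 4 * (T\<^sup>2 / s)"
proof -
  have am: "2 * (a * b) \<le> s * a\<^sup>2 + b\<^sup>2 / s" for a b
  proof -
    have "0 \<le> (s * a - b)\<^sup>2 / s" using s by simp
    also have "\<dots> = s * a\<^sup>2 + b\<^sup>2 / s - 2 * (a * b)"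
      using s by (simp add: power2_eq_square field_simps)
    finally show ?thesis by simp
  qed
  have S3: "2 * S ^ 3 \<le> s * S\<^sup>2 + S ^ 4 / s"
    using am[of S "S\<^sup>2"] by (simp add: power2_eq_square power3_eq_cube numeral_eq_Suc mult.assoc)
  have ST: "2 * (S * T) \<le> s * S\<^sup>2 + T\<^sup>2 / s" by (rule am)
  have Sh: "2 * (S * s\<^sup>2) \<le> s * S\<^sup>2 + s ^ 3"
    using am[of S "s\<^sup>2"] s by (simp add: power2_eq_square power3_eq_cube mult.assoc)
  have T2: "T\<^sup>2 \<le> T\<^sup>2 / s"
    using s by (simp add: pos_le_divide_eq mult_left_le)
  have h2: "(s\<^sup>2)\<^sup>2 \<le> s ^ 3"
    using s mult_left_mono[of s 1 "s ^ 3"] by (simp add: power2_eq_square power3_eq_cube mult.assoc)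
  have 1: "z ^ 3 \<le> 27 * S ^ 3" using power_mono[OF z(2,1), of 3] by (simp add: power_mult_distrib)
  have 2: "z * r \<le> (3 * S) * (\<kappa> * s\<^sup>2 + T)" by (intro mult_mono z r) (use nn in auto)
  have "r\<^sup>2 \<le> (\<kappa> * s\<^sup>2 + T)\<^sup>2" by (rule power_mono[OF r(2,1)])
  also have "\<dots> \<le> 2 * (\<kappa>\<^sup>2 * (s\<^sup>2)\<^sup>2) + 2 * T\<^sup>2"
    using sum_squares_bound[of "\<kappa> * s\<^sup>2" T] by (simp add: power2_sum power_mult_distrib)
  also have "\<dots> \<le> 2 * (\<kappa>\<^sup>2 * s ^ 3) + 2 * (T\<^sup>2 / s)"
    by (intro add_mono mult_left_mono h2 T2) auto
  finally have 3: "r\<^sup>2 \<le> 2 * (\<kappa>\<^sup>2 * s ^ 3) + 2 * (T\<^sup>2 / s)" .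
  have 4: "\<kappa> * (2 * (S * s\<^sup>2)) \<le> \<kappa> * (s * S\<^sup>2 + s ^ 3)" by (rule mult_left_mono[OF Sh nn(3)])
  have lin: "(27 / 2) * a + (3 / 2) * b + (3 / 2) * c + d + e \<le> (27 / 2) * a' + (3 / 2) * b' + (3 / 2) * c' + d + e"
    if "a \<le> a'" "b \<le> b'" "c \<le> c'" for a b c d e a' b' c' :: real using that by linarith
  have nn': "0 \<le> \<kappa> * (s * S\<^sup>2)" "0 \<le> \<kappa> * s ^ 3" "0 \<le> S ^ 4 / s" "0 \<le> T\<^sup>2 / s" using s nn by auto
  have "z ^ 3 + z * r + r\<^sup>2 \<le> 27 * S ^ 3 + (3 * S) * (\<kappa> * s\<^sup>2 + T) + (2 * (\<kappa>\<^sup>2 * s ^ 3) + 2 * (T\<^sup>2 / s))"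
    using 1 2 3 by linarith
  also have "\<dots> = (27 / 2) * (2 * S ^ 3) + (3 / 2) * (\<kappa> * (2 * (S * s\<^sup>2))) + (3 / 2) * (2 * (S * T)) + 2 * (\<kappa>\<^sup>2 * s ^ 3) + 2 * (T\<^sup>2 / s)"
    by (simp add: algebra_simps)
  also have "\<dots> \<le> (27 / 2) * (s * S\<^sup>2 + S ^ 4 / s) + (3 / 2) * (\<kappa> * (s * S\<^sup>2 + s ^ 3)) + (3 / 2) * (s * S\<^sup>2 + T\<^sup>2 / s) + 2 * (\<kappa>\<^sup>2 * s ^ 3) + 2 * (T\<^sup>2 / s)"
    by (rule lin[OF S3 4 ST])
  also have "\<dots> \<le> (2 * \<kappa> + 2 * \<kappa>\<^sup>2) * s ^ 3 + (15 + 2 * \<kappa>) * (s * S\<^sup>2) + 14 * (S ^ 4 / s) + 4 * (T\<^sup>2 / s)"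
    using nn' by (simp add: algebra_simps)
  finally show ?thesis .
qed

lemma sum3_square_le: "(x + y + z)\<^sup>2 \<le> 3 * (x\<^sup>2 + y\<^sup>2 + z\<^sup>2)" for x y z :: real
  using sum_squares_bound[of x y] sum_squares_bound[of x z] sum_squares_bound[of y z]
  by (simp add: power2_eq_square algebra_simps)

lemma sum3_fourth_le: "(x + y + z) ^ 4 \<le> 27 * (x ^ 4 + y ^ 4 + z ^ 4)" for x y z :: real
proof -
  have "(x + y + z) ^ 4 = ((x + y + z)\<^sup>2)\<^sup>2" by (simp flip: power_mult)
  also have "\<dots> \<le> (3 * (x\<^sup>2 + y\<^sup>2 + z\<^sup>2))\<^sup>2" by (intro power_mono sum3_square_le) simp
  also have "\<dots> = 9 * (x\<^sup>2 + y\<^sup>2 + z\<^sup>2)\<^sup>2" unfolding power_mult_distrib by simp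
  also have "\<dots> \<le> 9 * (3 * ((x\<^sup>2)\<^sup>2 + (y\<^sup>2)\<^sup>2 + (z\<^sup>2)\<^sup>2))" by (intro mult_left_mono sum3_square_le) simp
  also have "\<dots> = 27 * (x ^ 4 + y ^ 4 + z ^ 4)" by (simp flip: power_mult)
  finally show ?thesis .
qed

section \<open>Mixed moments of the noise and the past\<close>

context driving_noise
begin

lemma rbounded_integrable:
  assumes "0 \<le> t" "rbounded t g" shows "integrable M g"
proof -
  have "integrable M (\<lambda>\<omega>. Re (complex_of_real (g \<omega>)))"
    by (rule integrable_Re[OF integrable_bounded_at[OF assms(1) rbounded_of_real[OF assms(2)]]])
  then show ?thesis by simp
qed

lemma rbounded_mult: 
  assumes "rbounded t g" "rbounded t h" shows "rbounded t (\<lambda>\<omega>. g \<omega> * h \<omega>)"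
proof -
  obtain C C' where C: "\<And>\<omega>. \<omega> \<in> space M \<Longrightarrow> \<bar>g \<omega>\<bar> \<le> C" "\<And>\<omega>. \<omega> \<in> space M \<Longrightarrow> \<bar>h \<omega>\<bar> \<le> C'"
    using assms unfolding rbounded_def by auto
  have "\<bar>g \<omega> * h \<omega>\<bar> \<le> \<bar>C\<bar> * \<bar>C'\<bar>" if "\<omega> \<in> space M" for \<omega>
    unfolding abs_mult using C[OF that] by (intro mult_mono) auto
  then show ?thesis using assms unfolding rbounded_def by (auto intro!: borel_measurable_times)
qed

lemma rbounded_const: "rbounded t (\<lambda>_. c)"
  unfolding rbounded_def by auto

lemma rbounded_cmult: "rbounded t g \<Longrightarrow> rbounded t (\<lambda>\<omega>. c * g \<omega>)"
  by (rule rbounded_mult[OF rbounded_const])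

lemma rbounded_add:
  assumes "rbounded t g" "rbounded t h" shows "rbounded t (\<lambda>\<omega>. g \<omega> + h \<omega>)"
proof -
  obtain C C' where C: "\<And>\<omega>. \<omega> \<in> space M \<Longrightarrow> \<bar>g \<omega>\<bar> \<le> C" "\<And>\<omega>. \<omega> \<in> space M \<Longrightarrow> \<bar>h \<omega>\<bar> \<le> C'"
    using assms unfolding rbounded_def by auto
  have "\<bar>g \<omega> + h \<omega>\<bar> \<le> C + C'" if "\<omega> \<in> space M" for \<omega>
    using C[OF that] by linarith
  then show ?thesis using assms unfolding rbounded_def by (auto intro!: borel_measurable_add)
qed

lemma noise_mean_real:
  assumes "0 \<le> s" "s \<le> t" "i < 3" "rbounded s g"
  shows "has_bochner_integral M (\<lambda>\<omega>. g \<omega> * (b i t \<omega> - b i s \<omega>)) 0"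
proof -
  have "has_bochner_integral M (\<lambda>\<omega>. complex_of_real (g \<omega>) * complex_of_real (b i t \<omega> - b i s \<omega>)) 0"
    using bounded_atD[OF rbounded_of_real[OF assms(4)]] integrable_bounded_at[OF assms(1) rbounded_of_real[OF assms(4)]]
    by (intro noise_mean assms)
  then have "has_bochner_integral M (\<lambda>\<omega>. Re (complex_of_real (g \<omega>) * complex_of_real (b i t \<omega> - b i s \<omega>))) (Re 0)"
    by (rule has_bochner_integral_bounded_linear[OF bounded_linear_Re])
  then show ?thesis by simp
qed

lemma noise_cov_real:
  assumes "0 \<le> s" "s \<le> t" "i < 3" "j < 3" "rbounded s g"
  shows "has_bochner_integral M (\<lambda>\<omega>. g \<omega> * ((b i t \<omega> - b i s \<omega>) * (b j t \<omega> - b j s \<omega>)))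
    (if i = j then (t - s) * (\<integral>\<omega>. g \<omega> \<partial>M) else 0)"
proof -
  have "has_bochner_integral M (\<lambda>\<omega>. complex_of_real (g \<omega>) * complex_of_real ((b i t \<omega> - b i s \<omega>) * (b j t \<omega> - b j s \<omega>)))
      (if i = j then complex_of_real (t - s) * (\<integral>\<omega>. complex_of_real (g \<omega>) \<partial>M) else 0)"
    using bounded_atD[OF rbounded_of_real[OF assms(5)]] integrable_bounded_at[OF assms(1) rbounded_of_real[OF assms(5)]]
    by (intro noise_cov assms)
  then have "has_bochner_integral M (\<lambda>\<omega>. Re (complex_of_real (g \<omega>) * complex_of_real ((b i t \<omega> - b i s \<omega>) * (b j t \<omega> - b j s \<omega>))))
      (Re (if i = j then complex_of_real (t - s) * (\<integral>\<omega>. complex_of_real (g \<omega>) \<partial>M) else 0))"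
    by (rule has_bochner_integral_bounded_linear[OF bounded_linear_Re])
  then show ?thesis by (cases "i = j") simp_all
qed

text \<open>A stochastic integral whose integrand is frozen at time \<open>s\<close>.\<close>

definition lin_noise :: "(nat \<Rightarrow> 'a \<Rightarrow> real) \<Rightarrow> real \<Rightarrow> real \<Rightarrow> 'a \<Rightarrow> real" where
  "lin_noise p s t \<omega> = (\<Sum>i<3. p i \<omega> * (b i t \<omega> - b i s \<omega>))"

lemma lin_noise_mean:
  assumes "0 \<le> s" "s \<le> t" "\<And>i. i < 3 \<Longrightarrow> rbounded s (p i)" "rbounded s g"
  shows "has_bochner_integral M (\<lambda>\<omega>. g \<omega> * lin_noise p s t \<omega>) 0"
proof -
  have "has_bochner_integral M (\<lambda>\<omega>. \<Sum>i<3. (g \<omega> * p i \<omega>) * (b i t \<omega> - b i s \<omega>)) (\<Sum>i<(3::nat). 0)"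
    by (intro has_bochner_integral_sum noise_mean_real rbounded_mult assms) auto
  then show ?thesis by (simp add: lin_noise_def sum_distrib_left mult.assoc)
qed

lemma lin_noise_cov:
  assumes "0 \<le> s" "s \<le> t" "\<And>i. i < 3 \<Longrightarrow> rbounded s (p i)" "\<And>i. i < 3 \<Longrightarrow> rbounded s (q i)" "rbounded s g"
  shows "has_bochner_integral M (\<lambda>\<omega>. g \<omega> * (lin_noise p s t \<omega> * lin_noise q s t \<omega>))
    ((t - s) * (\<integral>\<omega>. g \<omega> * (\<Sum>i<3. p i \<omega> * q i \<omega>) \<partial>M))"
proof -
  have rb: "rbounded s (\<lambda>\<omega>. g \<omega> * (p i \<omega> * q j \<omega>))" if "i < 3" "j < 3" for i j
    by (intro rbounded_mult assms that)
  have "has_bochner_integral M (\<lambda>\<omega>. \<Sum>i<3. \<Sum>j<3. (g \<omega> * (p i \<omega> * q j \<omega>)) * ((b i t \<omega> - b i s \<omega>) * (b j t \<omega> - b j s \<omega>)))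
      (\<Sum>i<(3::nat). \<Sum>j<3. if i = j then (t - s) * (\<integral>\<omega>. g \<omega> * (p i \<omega> * q j \<omega>) \<partial>M) else 0)"
    by (intro has_bochner_integral_sum noise_cov_real rb assms) auto
  moreover have "(\<Sum>i<(3::nat). \<Sum>j<3. if i = j then (t - s) * (\<integral>\<omega>. g \<omega> * (p i \<omega> * q j \<omega>) \<partial>M) else 0) =
      (t - s) * (\<integral>\<omega>. g \<omega> * (\<Sum>i<3. p i \<omega> * q i \<omega>) \<partial>M)"
  proof -
    have "(\<integral>\<omega>. g \<omega> * (\<Sum>i<3. p i \<omega> * q i \<omega>) \<partial>M) = (\<integral>\<omega>. (\<Sum>i<3. g \<omega> * (p i \<omega> * q i \<omega>)) \<partial>M)"
      by (simp add: sum_distrib_left)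
    also have "\<dots> = (\<Sum>i<3. (\<integral>\<omega>. g \<omega> * (p i \<omega> * q i \<omega>) \<partial>M))"
      by (rule Bochner_Integration.integral_sum) (auto intro: rbounded_integrable[OF assms(1) rb])
    finally show ?thesis by (simp add: sum_distrib_left)
  qed
  moreover have "(\<Sum>i<3. \<Sum>j<3. (g \<omega> * (p i \<omega> * q j \<omega>)) * ((b i t \<omega> - b i s \<omega>) * (b j t \<omega> - b j s \<omega>))) =
      g \<omega> * (lin_noise p s t \<omega> * lin_noise q s t \<omega>)" for \<omega>
    unfolding lin_noise_def sum_product by (simp add: sum_distrib_left mult_ac)
  ultimately show ?thesis by simp
qed

end

section \<open>The generator of the mean and the difference of two phases\<close>

lemma bounded_C3_measurable:
  assumes "bounded_C3 f f1 f2 f3"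
  shows "f \<in> borel_measurable borel" "f1 \<in> borel_measurable borel" "f2 \<in> borel_measurable borel"
proof -
  have *: "g \<in> borel_measurable borel" if "\<And>x. (g has_real_derivative g' x) (at x)" for g g'
  proof (rule borel_measurable_continuous_onI)
    show "continuous_on UNIV g"
      unfolding continuous_on_eq_continuous_at[OF open_UNIV] using that by (blast intro: DERIV_isCont)
  qed
  show "f \<in> borel_measurable borel" by (rule *[of f f1]) (use assms in \<open>simp add: bounded_C3_def\<close>)
  show "f1 \<in> borel_measurable borel" by (rule *[of f1 f2]) (use assms in \<open>simp add: bounded_C3_def\<close>)
  show "f2 \<in> borel_measurable borel" by (rule *[of f2 f3]) (use assms in \<open>simp add: bounded_C3_def\<close>)
qed

lemma bounded_C3_bound:
  assumes "bounded_C3 f f1 f2 f3"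
  obtains C where "\<And>x. \<bar>f x\<bar> \<le> C" "\<And>x. \<bar>f1 x\<bar> \<le> C" "\<And>x. \<bar>f2 x\<bar> \<le> C"
  using assms unfolding bounded_C3_def by blast

lemma (in driving_noise) rbounded_comp:
  assumes "\<phi> \<in> borel_measurable borel" "\<And>x. \<bar>\<phi> x\<bar> \<le> C" "X \<in> borel_measurable (F t)"
  shows "rbounded t (\<lambda>\<omega>. \<phi> (X \<omega>))"
  unfolding rbounded_def using assms by (auto intro: measurable_compose)

locale phase_pair = driving_noise M F b for M :: "'a measure" and F b +
  fixes l0 l1 :: real and \<theta>0 \<theta>1 :: "real \<Rightarrow> 'a \<Rightarrow> real"
  assumes phase0: "is_phase l0 \<theta>0" and phase1: "is_phase l1 \<theta>1"
begin

text \<open>The mean and the difference of the phases, seen from frames that move with speeds \<open>\<rho>\<close> and \<open>\<sigma>\<close>.\<close>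

definition mid :: "real \<Rightarrow> real \<Rightarrow> 'a \<Rightarrow> real" where
  "mid \<rho> t \<omega> = (\<theta>0 t \<omega> + \<theta>1 t \<omega>) / 2 - \<rho> * t"

definition gap :: "real \<Rightarrow> real \<Rightarrow> 'a \<Rightarrow> real" where
  "gap \<sigma> t \<omega> = \<theta>1 t \<omega> - \<theta>0 t \<omega> - \<sigma> * t"

lemma phase_F: "0 \<le> t \<Longrightarrow> \<theta>0 t \<in> borel_measurable (F t)" "0 \<le> t \<Longrightarrow> \<theta>1 t \<in> borel_measurable (F t)"
  using phase0 phase1 unfolding is_phase_def by auto

lemma mid_gap_F:
  assumes "0 \<le> t" shows "mid \<rho> t \<in> borel_measurable (F t)" "gap \<sigma> t \<in> borel_measurable (F t)"
  unfolding mid_def gap_def using phase_F[OF assms] by measurable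

text \<open>The noises of the mean and of the difference of the two phases are uncorrelated, so the generator
  has no mixed derivative.\<close>

definition generator ::
  "real \<Rightarrow> real \<Rightarrow> (real \<Rightarrow> real) \<Rightarrow> (real \<Rightarrow> real) \<Rightarrow> (real \<Rightarrow> real) \<Rightarrow>
    (real \<Rightarrow> real) \<Rightarrow> (real \<Rightarrow> real) \<Rightarrow> (real \<Rightarrow> real) \<Rightarrow> real \<Rightarrow> 'a \<Rightarrow> real" where
  "generator \<rho> \<sigma> f f1 f2 k k1 k2 t \<omega> =
     ((l0 + l1) / 2 - \<rho>) * (f1 (mid \<rho> t \<omega>) * k (gap \<sigma> t \<omega>)) + (l1 - l0 - \<sigma>) * (f (mid \<rho> t \<omega>) * k1 (gap \<sigma> t \<omega>)) +
     ((1 + (1 + cos (gap 0 t \<omega>)) / 4) * (f2 (mid \<rho> t \<omega>) * k (gap \<sigma> t \<omega>)) +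
      (1 - cos (gap 0 t \<omega>)) * (f (mid \<rho> t \<omega>) * k2 (gap \<sigma> t \<omega>))) / 2"

text \<open>This is Ito's formula in the mean over one short step. In the second order expansion of the product
  the terms that are linear in the noise have mean 0, and the quadratic ones give the generator. The
  error collects third powers of Brownian increments, of order \<open>h * sqrt h\<close>, and products of a
  Brownian increment, of order \<open>sqrt h\<close>, with a drift or an error of freezing, of order \<open>h\<close>.\<close>

lemma one_step:
  assumes f: "bounded_C3 f f1 f2 f3" and k: "bounded_C3 k k1 k2 k3"
  shows "\<exists>C\<ge>0. \<forall>t h. 0 \<le> t \<and> 0 < h \<and> h \<le> 1 \<longrightarrow>
    \<bar>(\<integral>\<omega>. f (mid \<rho> (t + h) \<omega>) * k (gap \<sigma> (t + h) \<omega>) \<partial>M) - (\<integral>\<omega>. f (mid \<rho> t \<omega>) * k (gap \<sigma> t \<omega>) \<partial>M)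
      - h * (\<integral>\<omega>. generator \<rho> \<sigma> f f1 f2 k k1 k2 t \<omega> \<partial>M)\<bar> \<le> C * (h * sqrt h)"
proof -
  define r where "r = (l0 + l1) / 2 - \<rho>"
  define r' where "r' = l1 - l0 - \<sigma>"
  define \<kappa> where "\<kappa> = \<bar>r\<bar> + \<bar>r'\<bar>"
  obtain Cf Ck where Cf: "\<And>x. \<bar>f x\<bar> \<le> Cf" "\<And>x. \<bar>f1 x\<bar> \<le> Cf" "\<And>x. \<bar>f2 x\<bar> \<le> Cf"
    and Ck: "\<And>x. \<bar>k x\<bar> \<le> Ck" "\<And>x. \<bar>k1 x\<bar> \<le> Ck" "\<And>x. \<bar>k2 x\<bar> \<le> Ck"
    using bounded_C3_bound[OF f] bounded_C3_bound[OF k] by metis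
  obtain C0 where C0: "0 \<le> C0" "\<And>t h. 0 \<le> t \<and> 0 \<le> h \<and> h \<le> 1 \<Longrightarrow> \<exists>R. phase_remainder l0 \<theta>0 C0 t h R"
    using phase_increment[OF phase0] by blast
  obtain C1 where C1: "0 \<le> C1" "\<And>t h. 0 \<le> t \<and> 0 \<le> h \<and> h \<le> 1 \<Longrightarrow> \<exists>R. phase_remainder l1 \<theta>1 C1 t h R"
    using phase_increment[OF phase1] by blast
  obtain E where E: "0 \<le> E" "\<And>x y Z Z' r r'.
    \<bar>f (x + Z + r) * k (y + Z' + r') - f x * k y - f1 x * k y * (Z + r) - f x * k1 y * (Z' + r')
      - (f2 x * k y * Z\<^sup>2 + 2 * f1 x * k1 y * Z * Z' + f x * k2 y * Z'\<^sup>2) / 2\<bar>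
    \<le> E * ((\<bar>Z\<bar> + \<bar>Z'\<bar>) ^ 3 + (\<bar>Z\<bar> + \<bar>Z'\<bar>) * (\<bar>r\<bar> + \<bar>r'\<bar>) + (\<bar>r\<bar> + \<bar>r'\<bar>)\<^sup>2)"
    using product_expansion[OF f k] by blast
  define C where "C = E * ((2 * \<kappa> + 2 * \<kappa>\<^sup>2) + (15 + 2 * \<kappa>) * 9 + 14 * 243 + 4 * (8 * (C0 + C1)))"
  show ?thesis
  proof (intro exI[of _ C] conjI allI impI)
    show "0 \<le> C" unfolding C_def \<kappa>_def using E(1) C0(1) C1(1) by (intro mult_nonneg_nonneg add_nonneg_nonneg) auto
    fix t h :: real assume th: "0 \<le> t \<and> 0 < h \<and> h \<le> 1"
    then have t: "0 \<le> t" and h: "0 < h" "h \<le> 1" and tt: "t \<le> t + h" and t'0: "0 \<le> t + h" by auto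
    define s where "s = sqrt h"
    have s: "0 < s" "s \<le> 1" "s\<^sup>2 = h" "s ^ 3 = h * sqrt h" unfolding s_def using h by (auto simp: power3_eq_cube)
    obtain R0 where R0: "AE \<omega> in M. \<theta>0 (t + h) \<omega> - \<theta>0 t \<omega> = l0 * h + (b 0 (t + h) \<omega> - b 0 t \<omega>) +
        (cos (\<theta>0 t \<omega>) * (b 1 (t + h) \<omega> - b 1 t \<omega>) + sin (\<theta>0 t \<omega>) * (b 2 (t + h) \<omega> - b 2 t \<omega>)) / sqrt 2 + R0 \<omega>"
      "integrable M R0" "integrable M (\<lambda>\<omega>. (R0 \<omega>)\<^sup>2)" "(\<integral>\<omega>. (R0 \<omega>)\<^sup>2 \<partial>M) \<le> C0 * h\<^sup>2"
      "\<And>g. rbounded t g \<Longrightarrow> has_bochner_integral M (\<lambda>\<omega>. g \<omega> * R0 \<omega>) 0"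
      using C0(2)[of t h] th unfolding phase_remainder_def by auto
    obtain R1 where R1: "AE \<omega> in M. \<theta>1 (t + h) \<omega> - \<theta>1 t \<omega> = l1 * h + (b 0 (t + h) \<omega> - b 0 t \<omega>) +
        (cos (\<theta>1 t \<omega>) * (b 1 (t + h) \<omega> - b 1 t \<omega>) + sin (\<theta>1 t \<omega>) * (b 2 (t + h) \<omega> - b 2 t \<omega>)) / sqrt 2 + R1 \<omega>"
      "integrable M R1" "integrable M (\<lambda>\<omega>. (R1 \<omega>)\<^sup>2)" "(\<integral>\<omega>. (R1 \<omega>)\<^sup>2 \<partial>M) \<le> C1 * h\<^sup>2"
      "\<And>g. rbounded t g \<Longrightarrow> has_bochner_integral M (\<lambda>\<omega>. g \<omega> * R1 \<omega>) 0"
      using C1(2)[of t h] th unfolding phase_remainder_def by auto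
    define x where "x = mid \<rho> t"
    define y where "y = gap \<sigma> t"
    define c where "c \<omega> = cos (gap 0 t \<omega>)" for \<omega>
    \<comment> \<open>the coefficients of the noise in the mean and in the difference, and the remaining displacements\<close>
    define p where "p i \<omega> = (if i = 0 then 1 else if i = 1 then (cos (\<theta>0 t \<omega>) + cos (\<theta>1 t \<omega>)) / (2 * sqrt 2)
       else (sin (\<theta>0 t \<omega>) + sin (\<theta>1 t \<omega>)) / (2 * sqrt 2))" for i :: nat and \<omega>
    define q where "q i \<omega> = (if i = 0 then 0 else if i = 1 then (cos (\<theta>1 t \<omega>) - cos (\<theta>0 t \<omega>)) / sqrt 2
       else (sin (\<theta>1 t \<omega>) - sin (\<theta>0 t \<omega>)) / sqrt 2)" for i :: nat and \<omega>
    define Z where "Z = lin_noise p t (t + h)"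
    define Z' where "Z' = lin_noise q t (t + h)"
    define e where "e \<omega> = r * h + (R0 \<omega> + R1 \<omega>) / 2" for \<omega>
    define e' where "e' \<omega> = r' * h + (R1 \<omega> - R0 \<omega>)" for \<omega>
    have sum3: "(\<Sum>i<(3::nat). v i) = v 0 + v 1 + v 2" for v :: "nat \<Rightarrow> real"
      by (simp add: numeral_eq_Suc)
    have [measurable]: "\<theta>0 t \<in> borel_measurable (F t)" "\<theta>1 t \<in> borel_measurable (F t)" using phase_F[OF t] by auto
    have trig: "rbounded t (\<lambda>\<omega>. cos (\<theta> t \<omega>))" "rbounded t (\<lambda>\<omega>. sin (\<theta> t \<omega>))"
      if "\<theta> t \<in> borel_measurable (F t)" for \<theta>
      unfolding rbounded_def using that by (auto intro!: exI[of _ 1])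
    have pb: "rbounded t (p i)" for i
    proof -
      have "rbounded t (\<lambda>\<omega>. (1 / (2 * sqrt 2)) * (cos (\<theta>0 t \<omega>) + cos (\<theta>1 t \<omega>)))"
        "rbounded t (\<lambda>\<omega>. (1 / (2 * sqrt 2)) * (sin (\<theta>0 t \<omega>) + sin (\<theta>1 t \<omega>)))"
        by (intro rbounded_cmult rbounded_add trig phase_F t)+
      then show ?thesis using rbounded_const[of t 1] unfolding p_def by (cases "i = 0"; cases "i = 1") simp_all
    qed
    have qb: "rbounded t (q i)" for i
    proof -
      have "rbounded t (\<lambda>\<omega>. (1 / sqrt 2) * (cos (\<theta>1 t \<omega>) + (- 1) * cos (\<theta>0 t \<omega>)))"
        "rbounded t (\<lambda>\<omega>. (1 / sqrt 2) * (sin (\<theta>1 t \<omega>) + (- 1) * sin (\<theta>0 t \<omega>)))"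
        by (intro rbounded_cmult rbounded_add trig phase_F t)+
      then show ?thesis using rbounded_const[of t 0] unfolding q_def by (cases "i = 0"; cases "i = 1") simp_all
    qed
    have cos_gap: "c \<omega> = cos (\<theta>0 t \<omega>) * cos (\<theta>1 t \<omega>) + sin (\<theta>0 t \<omega>) * sin (\<theta>1 t \<omega>)" for \<omega>
      unfolding c_def gap_def by (simp add: cos_diff algebra_simps)
    have cs: "cos a * cos a = 1 - sin a * sin a" for a :: real
      using sin_cos_squared_add3[of a] by linarith
    have pp: "(\<Sum>i<3. p i \<omega> * p i \<omega>) = 1 + (1 + c \<omega>) / 4" for \<omega>
      unfolding sum3 p_def cos_gap by (simp add: field_simps cs)
    have pq: "(\<Sum>i<3. p i \<omega> * q i \<omega>) = 0" for \<omega>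
      unfolding sum3 p_def q_def by (simp add: field_simps cs)
    have qq: "(\<Sum>i<3. q i \<omega> * q i \<omega>) = 1 - c \<omega>" for \<omega>
      unfolding sum3 q_def cos_gap by (simp add: field_simps cs)
    have step: "AE \<omega> in M. mid \<rho> (t + h) \<omega> = x \<omega> + Z \<omega> + e \<omega> \<and> gap \<sigma> (t + h) \<omega> = y \<omega> + Z' \<omega> + e' \<omega>"
      using R0(1) R1(1)
    proof eventually_elim
      case (elim \<omega>)
      have a: "\<theta>0 (t + h) \<omega> = \<theta>0 t \<omega> + (l0 * h + (b 0 (t + h) \<omega> - b 0 t \<omega>) +
        (cos (\<theta>0 t \<omega>) * (b 1 (t + h) \<omega> - b 1 t \<omega>) + sin (\<theta>0 t \<omega>) * (b 2 (t + h) \<omega> - b 2 t \<omega>)) / sqrt 2 + R0 \<omega>)"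
        "\<theta>1 (t + h) \<omega> = \<theta>1 t \<omega> + (l1 * h + (b 0 (t + h) \<omega> - b 0 t \<omega>) +
        (cos (\<theta>1 t \<omega>) * (b 1 (t + h) \<omega> - b 1 t \<omega>) + sin (\<theta>1 t \<omega>) * (b 2 (t + h) \<omega> - b 2 t \<omega>)) / sqrt 2 + R1 \<omega>)"
        using elim by linarith+
      show ?case
        unfolding mid_def gap_def x_def y_def Z_def Z'_def lin_noise_def sum3 p_def q_def e_def e'_def a r_def r'_def
        by (simp add: field_simps)
    qed
    have gm: "rbounded t (\<lambda>\<omega>. f (x \<omega>))" "rbounded t (\<lambda>\<omega>. f1 (x \<omega>))" "rbounded t (\<lambda>\<omega>. f2 (x \<omega>))"
       "rbounded t (\<lambda>\<omega>. k (y \<omega>))" "rbounded t (\<lambda>\<omega>. k1 (y \<omega>))" "rbounded t (\<lambda>\<omega>. k2 (y \<omega>))"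
      unfolding x_def y_def
      by (rule rbounded_comp[OF _ _ mid_gap_F(1)[OF t]] rbounded_comp[OF _ _ mid_gap_F(2)[OF t]];
          fact bounded_C3_measurable[OF f] bounded_C3_measurable[OF k] Cf Ck)+
    have cb: "rbounded t c" unfolding c_def using mid_gap_F(2)[OF t] by (intro trig)
    define D where "D \<omega> = f (x \<omega> + Z \<omega> + e \<omega>) * k (y \<omega> + Z' \<omega> + e' \<omega>) - f (x \<omega>) * k (y \<omega>)
      - f1 (x \<omega>) * k (y \<omega>) * (Z \<omega> + e \<omega>) - f (x \<omega>) * k1 (y \<omega>) * (Z' \<omega> + e' \<omega>)
      - (f2 (x \<omega>) * k (y \<omega>) * (Z \<omega>)\<^sup>2 + 2 * f1 (x \<omega>) * k1 (y \<omega>) * Z \<omega> * Z' \<omega> + f (x \<omega>) * k2 (y \<omega>) * (Z' \<omega>)\<^sup>2) / 2" for \<omega>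
    have split: "f1 (x \<omega>) * k (y \<omega>) * (Z \<omega> + e \<omega>) = (f1 (x \<omega>) * k (y \<omega>)) * Z \<omega> +
        (r * h) * (f1 (x \<omega>) * k (y \<omega>)) + ((f1 (x \<omega>) * k (y \<omega>)) * R0 \<omega> + (f1 (x \<omega>) * k (y \<omega>)) * R1 \<omega>) / 2"
      "f (x \<omega>) * k1 (y \<omega>) * (Z' \<omega> + e' \<omega>) = (f (x \<omega>) * k1 (y \<omega>)) * Z' \<omega> +
        (r' * h) * (f (x \<omega>) * k1 (y \<omega>)) + ((f (x \<omega>) * k1 (y \<omega>)) * R1 \<omega> - (f (x \<omega>) * k1 (y \<omega>)) * R0 \<omega>)" for \<omega>
      unfolding e_def e'_def by (simp_all add: field_simps)
    have g10: "rbounded t (\<lambda>\<omega>. f1 (x \<omega>) * k (y \<omega>))" and g01: "rbounded t (\<lambda>\<omega>. f (x \<omega>) * k1 (y \<omega>))"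
      and g20: "rbounded t (\<lambda>\<omega>. f2 (x \<omega>) * k (y \<omega>))" and g02: "rbounded t (\<lambda>\<omega>. f (x \<omega>) * k2 (y \<omega>))"
      and g11: "rbounded t (\<lambda>\<omega>. f1 (x \<omega>) * k1 (y \<omega>))" and g00: "rbounded t (\<lambda>\<omega>. f (x \<omega>) * k (y \<omega>))"
      by (intro rbounded_mult gm)+
    note int = rbounded_integrable[OF t]
    have hb: "has_bochner_integral M g (\<integral>\<omega>. g \<omega> \<partial>M)" if "rbounded t g" for g
      using int[OF that] by (simp add: has_bochner_integral_iff)
    have I10: "has_bochner_integral M (\<lambda>\<omega>. f1 (x \<omega>) * k (y \<omega>) * (Z \<omega> + e \<omega>))
        (0 + (r * h) * (\<integral>\<omega>. f1 (x \<omega>) * k (y \<omega>) \<partial>M) + (0 + 0) / 2)"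
      unfolding split unfolding Z_def
      by (intro has_bochner_integral_add has_bochner_integral_divide has_bochner_integral_mult_right hb
            lin_noise_mean t tt pb R0(5) R1(5) g10)
    have I01: "has_bochner_integral M (\<lambda>\<omega>. f (x \<omega>) * k1 (y \<omega>) * (Z' \<omega> + e' \<omega>))
        (0 + (r' * h) * (\<integral>\<omega>. f (x \<omega>) * k1 (y \<omega>) \<partial>M) + (0 - 0))"
      unfolding split unfolding Z'_def
      by (intro has_bochner_integral_add has_bochner_integral_diff has_bochner_integral_mult_right hb
            lin_noise_mean t tt qb R0(5) R1(5) g01)
    have I2: "has_bochner_integral M (\<lambda>\<omega>. (f2 (x \<omega>) * k (y \<omega>)) * (Z \<omega> * Z \<omega>))
        (h * (\<integral>\<omega>. f2 (x \<omega>) * k (y \<omega>) * (1 + (1 + c \<omega>) / 4) \<partial>M))"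
      "has_bochner_integral M (\<lambda>\<omega>. (f1 (x \<omega>) * k1 (y \<omega>)) * (Z \<omega> * Z' \<omega>)) 0"
      "has_bochner_integral M (\<lambda>\<omega>. (f (x \<omega>) * k2 (y \<omega>)) * (Z' \<omega> * Z' \<omega>))
        (h * (\<integral>\<omega>. f (x \<omega>) * k2 (y \<omega>) * (1 - c \<omega>) \<partial>M))"
      unfolding Z_def Z'_def
      using lin_noise_cov[of t "t + h" p p, OF t tt pb pb g20] lin_noise_cov[of t "t + h" p q, OF t tt pb qb g11]
        lin_noise_cov[of t "t + h" q q, OF t tt qb qb g02] unfolding pp pq qq by simp_all
    have u1: "integrable M (\<lambda>\<omega>. f (mid \<rho> (t + h) \<omega>) * k (gap \<sigma> (t + h) \<omega>))"
    proof (rule rbounded_integrable[OF t'0], rule rbounded_mult)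
      show "rbounded (t + h) (\<lambda>\<omega>. f (mid \<rho> (t + h) \<omega>))"
        by (rule rbounded_comp[OF bounded_C3_measurable(1)[OF f] Cf(1) mid_gap_F(1)[OF t'0]])
      show "rbounded (t + h) (\<lambda>\<omega>. k (gap \<sigma> (t + h) \<omega>))"
        by (rule rbounded_comp[OF bounded_C3_measurable(1)[OF k] Ck(1) mid_gap_F(2)[OF t'0]])
    qed
    define D' where "D' \<omega> = f (mid \<rho> (t + h) \<omega>) * k (gap \<sigma> (t + h) \<omega>) - f (x \<omega>) * k (y \<omega>)
      - f1 (x \<omega>) * k (y \<omega>) * (Z \<omega> + e \<omega>) - f (x \<omega>) * k1 (y \<omega>) * (Z' \<omega> + e' \<omega>)
      - ((f2 (x \<omega>) * k (y \<omega>)) * (Z \<omega> * Z \<omega>) + 2 * ((f1 (x \<omega>) * k1 (y \<omega>)) * (Z \<omega> * Z' \<omega>)) + (f (x \<omega>) * k2 (y \<omega>)) * (Z' \<omega> * Z' \<omega>)) / 2" for \<omega>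
    have DD: "AE \<omega> in M. D' \<omega> = D \<omega>"
      using step by eventually_elim (simp add: D_def D'_def power2_eq_square mult_ac)
    define G where "G = (\<integral>\<omega>. generator \<rho> \<sigma> f f1 f2 k k1 k2 t \<omega> \<partial>M)"
    have G: "G = r * (\<integral>\<omega>. f1 (x \<omega>) * k (y \<omega>) \<partial>M) + r' * (\<integral>\<omega>. f (x \<omega>) * k1 (y \<omega>) \<partial>M) +
       ((\<integral>\<omega>. f2 (x \<omega>) * k (y \<omega>) * (1 + (1 + c \<omega>) / 4) \<partial>M) + (\<integral>\<omega>. f (x \<omega>) * k2 (y \<omega>) * (1 - c \<omega>) \<partial>M)) / 2"
    proof -
      have cV: "rbounded t (\<lambda>\<omega>. 1 + (1 + c \<omega>) / 4)" "rbounded t (\<lambda>\<omega>. 1 - c \<omega>)"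
      proof -
        have "rbounded t (\<lambda>\<omega>. 5 / 4 + (1 / 4) * c \<omega>)" "rbounded t (\<lambda>\<omega>. 1 + (- 1) * c \<omega>)"
          by (intro rbounded_add rbounded_const rbounded_cmult cb)+
        then show "rbounded t (\<lambda>\<omega>. 1 + (1 + c \<omega>) / 4)" "rbounded t (\<lambda>\<omega>. 1 - c \<omega>)"
          by (simp_all add: add_divide_distrib)
      qed
      have "has_bochner_integral M (\<lambda>\<omega>. r * (f1 (x \<omega>) * k (y \<omega>)) + r' * (f (x \<omega>) * k1 (y \<omega>)) +
         (f2 (x \<omega>) * k (y \<omega>) * (1 + (1 + c \<omega>) / 4) + f (x \<omega>) * k2 (y \<omega>) * (1 - c \<omega>)) / 2)
         (r * (\<integral>\<omega>. f1 (x \<omega>) * k (y \<omega>) \<partial>M) + r' * (\<integral>\<omega>. f (x \<omega>) * k1 (y \<omega>) \<partial>M) +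
       ((\<integral>\<omega>. f2 (x \<omega>) * k (y \<omega>) * (1 + (1 + c \<omega>) / 4) \<partial>M) + (\<integral>\<omega>. f (x \<omega>) * k2 (y \<omega>) * (1 - c \<omega>) \<partial>M)) / 2)"
        by (intro has_bochner_integral_add has_bochner_integral_divide has_bochner_integral_mult_right hb
            rbounded_mult[OF g20 cV(1)] rbounded_mult[OF g02 cV(2)] g10 g01)
      moreover have "r * (f1 (x \<omega>) * k (y \<omega>)) + r' * (f (x \<omega>) * k1 (y \<omega>)) +
         (f2 (x \<omega>) * k (y \<omega>) * (1 + (1 + c \<omega>) / 4) + f (x \<omega>) * k2 (y \<omega>) * (1 - c \<omega>)) / 2 = generator \<rho> \<sigma> f f1 f2 k k1 k2 t \<omega>" for \<omega>
        unfolding generator_def x_def y_def c_def r_def r'_def by (simp only: mult.commute)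
      ultimately show ?thesis unfolding G_def by (simp only: has_bochner_integral_iff)
    qed
    have ID': "has_bochner_integral M D' ((\<integral>\<omega>. f (mid \<rho> (t + h) \<omega>) * k (gap \<sigma> (t + h) \<omega>) \<partial>M) - (\<integral>\<omega>. f (mid \<rho> t \<omega>) * k (gap \<sigma> t \<omega>) \<partial>M) - h * G)"
    proof -
      have "has_bochner_integral M D' ((\<integral>\<omega>. f (mid \<rho> (t + h) \<omega>) * k (gap \<sigma> (t + h) \<omega>) \<partial>M) - (\<integral>\<omega>. f (x \<omega>) * k (y \<omega>) \<partial>M)
         - (0 + (r * h) * (\<integral>\<omega>. f1 (x \<omega>) * k (y \<omega>) \<partial>M) + (0 + 0) / 2) - (0 + (r' * h) * (\<integral>\<omega>. f (x \<omega>) * k1 (y \<omega>) \<partial>M) + (0 - 0))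
         - (h * (\<integral>\<omega>. f2 (x \<omega>) * k (y \<omega>) * (1 + (1 + c \<omega>) / 4) \<partial>M) + 2 * 0 + h * (\<integral>\<omega>. f (x \<omega>) * k2 (y \<omega>) * (1 - c \<omega>) \<partial>M)) / 2)"
        unfolding D'_def
        by (intro has_bochner_integral_diff has_bochner_integral_add has_bochner_integral_divide has_bochner_integral_mult_right
             I10 I01 I2 hb[OF g00]) (use u1 in \<open>simp add: has_bochner_integral_iff\<close>)
      then show ?thesis unfolding G x_def y_def by (simp add: algebra_simps add_divide_distrib)
    qed
    define S where "S \<omega> = \<bar>b 0 (t + h) \<omega> - b 0 t \<omega>\<bar> + \<bar>b 1 (t + h) \<omega> - b 1 t \<omega>\<bar> + \<bar>b 2 (t + h) \<omega> - b 2 t \<omega>\<bar>" for \<omega>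
    define T where "T \<omega> = 2 * (\<bar>R0 \<omega>\<bar> + \<bar>R1 \<omega>\<bar>)" for \<omega>
    define N2 where "N2 \<omega> = (\<Sum>i<3. (b i (t + h) \<omega> - b i t \<omega>)\<^sup>2)" for \<omega>
    define N4 where "N4 \<omega> = (\<Sum>i<3. (b i (t + h) \<omega> - b i t \<omega>) ^ 4)" for \<omega>
    define B where "B \<omega> = E * ((2 * \<kappa> + 2 * \<kappa>\<^sup>2) * s ^ 3 + (15 + 2 * \<kappa>) * (s * (3 * N2 \<omega>)) + 14 * ((27 * N4 \<omega>) / s)
        + 4 * ((8 * ((R0 \<omega>)\<^sup>2 + (R1 \<omega>)\<^sup>2)) / s))" for \<omega>
    have \<kappa>: "0 \<le> \<kappa>" unfolding \<kappa>_def by simp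
    have bound: "\<bar>D \<omega>\<bar> \<le> B \<omega>" for \<omega>
    proof -
      let ?z = "\<bar>Z \<omega>\<bar> + \<bar>Z' \<omega>\<bar>" and ?r = "\<bar>e \<omega>\<bar> + \<bar>e' \<omega>\<bar>"
      have lin: "\<bar>lin_noise v t (t + h) \<omega>\<bar> \<le> K * S \<omega>" if v: "\<And>i. \<bar>v i \<omega>\<bar> \<le> K" for v K
      proof -
        have "\<bar>lin_noise v t (t + h) \<omega>\<bar> \<le> (\<Sum>i<3. \<bar>v i \<omega> * (b i (t + h) \<omega> - b i t \<omega>)\<bar>)"
          unfolding lin_noise_def by (rule sum_abs)
        also have "\<dots> \<le> (\<Sum>i<3. K * \<bar>b i (t + h) \<omega> - b i t \<omega>\<bar>)"
          unfolding abs_mult by (intro sum_mono mult_right_mono v) auto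
        also have "\<dots> = K * S \<omega>" unfolding S_def sum3 by (simp add: distrib_left)
        finally show ?thesis .
      qed
      have s21: "1 \<le> sqrt (2::real)" by simp
      have pv: "\<bar>p i \<omega>\<bar> \<le> 1" for i
      proof -
        have *: "\<bar>u / (2 * sqrt 2)\<bar> \<le> 1" if "\<bar>u\<bar> \<le> 2" for u
        proof -
          have "\<bar>u\<bar> \<le> 2 * sqrt 2" using that s21 by linarith
          then show ?thesis by simp
        qed
        have "\<bar>cos (\<theta>0 t \<omega>) + cos (\<theta>1 t \<omega>)\<bar> \<le> 2" "\<bar>sin (\<theta>0 t \<omega>) + sin (\<theta>1 t \<omega>)\<bar> \<le> 2"
          using abs_cos_le_one[of "\<theta>0 t \<omega>"] abs_cos_le_one[of "\<theta>1 t \<omega>"] abs_sin_le_one[of "\<theta>0 t \<omega>"] abs_sin_le_one[of "\<theta>1 t \<omega>"]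
          by linarith+
        then show ?thesis unfolding p_def using * by auto
      qed
      have qv: "\<bar>q i \<omega>\<bar> \<le> 2" for i
      proof -
        have *: "\<bar>u / sqrt 2\<bar> \<le> 2" if "\<bar>u\<bar> \<le> 2" for u
        proof -
          have "\<bar>u\<bar> \<le> 2 * sqrt 2" using that s21 by linarith
          then show ?thesis by (simp add: pos_divide_le_eq)
        qed
        have "\<bar>cos (\<theta>1 t \<omega>) - cos (\<theta>0 t \<omega>)\<bar> \<le> 2" "\<bar>sin (\<theta>1 t \<omega>) - sin (\<theta>0 t \<omega>)\<bar> \<le> 2"
          using abs_cos_le_one[of "\<theta>0 t \<omega>"] abs_cos_le_one[of "\<theta>1 t \<omega>"] abs_sin_le_one[of "\<theta>0 t \<omega>"] abs_sin_le_one[of "\<theta>1 t \<omega>"]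
          by linarith+
        then show ?thesis unfolding q_def using * by auto
      qed
      have z: "?z \<le> 3 * S \<omega>"
        using lin[of p 1, OF pv] lin[of q 2, OF qv] unfolding Z_def Z'_def by linarith
      have r: "?r \<le> \<kappa> * s\<^sup>2 + T \<omega>"
      proof -
        have "\<bar>r * h\<bar> = \<bar>r\<bar> * h" "\<bar>r' * h\<bar> = \<bar>r'\<bar> * h" using h by (simp_all add: abs_mult)
        moreover have "\<kappa> * h = \<bar>r\<bar> * h + \<bar>r'\<bar> * h" unfolding \<kappa>_def by (simp add: distrib_right)
        moreover have "\<bar>e \<omega>\<bar> \<le> \<bar>r * h\<bar> + (\<bar>R0 \<omega>\<bar> + \<bar>R1 \<omega>\<bar>) / 2"
        proof -
          have *: "a \<le> u + w / 2" if "a \<le> u + v / 2" "v \<le> w" for a u v w :: real using that by simp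
          show ?thesis unfolding e_def
            by (rule *[OF _ abs_triangle_ineq]) (use abs_triangle_ineq[of "r * h" "(R0 \<omega> + R1 \<omega>) / 2"] in simp)
        qed
        moreover have "\<bar>e' \<omega>\<bar> \<le> \<bar>r' * h\<bar> + (\<bar>R0 \<omega>\<bar> + \<bar>R1 \<omega>\<bar>)"
        proof -
          have *: "a \<le> u + w" if "a \<le> u + v" "v \<le> w" for a u v w :: real using that by simp
          show ?thesis unfolding e'_def
            by (rule *[OF abs_triangle_ineq]) (use abs_triangle_ineq4[of "R1 \<omega>" "R0 \<omega>"] in simp)
        qed
        moreover have "0 \<le> \<bar>R0 \<omega>\<bar> + \<bar>R1 \<omega>\<bar>" by simp
        moreover have "a + a' \<le> c * h + 2 * w"
          if "u = v * h" "u' = v' * h" "c * h = v * h + v' * h" "a \<le> u + w / 2" "a' \<le> u' + w" "0 \<le> w"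
          for a a' c w u u' v v' :: real using that by simp
        ultimately show ?thesis unfolding s(3) T_def by blast
      qed
      have nn: "0 \<le> S \<omega>" "0 \<le> T \<omega>" unfolding S_def T_def by auto
      have S2: "(S \<omega>)\<^sup>2 \<le> 3 * N2 \<omega>"
        unfolding S_def N2_def sum3 by (rule order_trans[OF sum3_square_le]) simp
      have S4: "(S \<omega>) ^ 4 \<le> 27 * N4 \<omega>"
        unfolding S_def N4_def sum3 by (rule order_trans[OF sum3_fourth_le]) (simp add: power_even_abs)
      have T2: "(T \<omega>)\<^sup>2 \<le> 8 * ((R0 \<omega>)\<^sup>2 + (R1 \<omega>)\<^sup>2)"
        unfolding T_def using sum_squares_bound[of "\<bar>R0 \<omega>\<bar>" "\<bar>R1 \<omega>\<bar>"] by (simp add: power_mult_distrib power2_sum)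
      have "\<bar>D \<omega>\<bar> \<le> E * (?z ^ 3 + ?z * ?r + ?r\<^sup>2)" unfolding D_def by (rule E(2))
      also have "\<dots> \<le> E * ((2 * \<kappa> + 2 * \<kappa>\<^sup>2) * s ^ 3 + (15 + 2 * \<kappa>) * (s * (S \<omega>)\<^sup>2) + 14 * ((S \<omega>) ^ 4 / s) + 4 * ((T \<omega>)\<^sup>2 / s))"
        by (intro mult_left_mono E(1) remainder_bound s nn \<kappa> z r) auto
      also have "\<dots> \<le> B \<omega>"
        unfolding B_def using s \<kappa>
        by (intro mult_left_mono E(1) add_mono order_refl divide_right_mono S2 S4 T2) auto
      finally show ?thesis .
    qed
    have IN2: "has_bochner_integral M N2 (3 * h)"
    proof -
      have "has_bochner_integral M (\<lambda>\<omega>. \<Sum>i<3. (b i (t + h) \<omega> - b i t \<omega>)\<^sup>2) (\<Sum>i<(3::nat). t + h - t)"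
        by (intro has_bochner_integral_sum noise_square_integral t tt) auto
      then show ?thesis unfolding N2_def[abs_def] by simp
    qed
    have IN4: "has_bochner_integral M N4 (9 * h\<^sup>2)"
    proof -
      have "has_bochner_integral M (\<lambda>\<omega>. \<Sum>i<3. (b i (t + h) \<omega> - b i t \<omega>) ^ 4) (\<Sum>i<(3::nat). 3 * (t + h - t)\<^sup>2)"
        by (intro has_bochner_integral_sum noise_fourth t tt) auto
      then show ?thesis unfolding N4_def[abs_def] by simp
    qed
    have IB: "has_bochner_integral M B (E * ((2 * \<kappa> + 2 * \<kappa>\<^sup>2) * s ^ 3 + (15 + 2 * \<kappa>) * (s * (3 * (3 * h))) + 14 * ((27 * (9 * h\<^sup>2)) / s)
        + 4 * ((8 * ((\<integral>\<omega>. (R0 \<omega>)\<^sup>2 \<partial>M) + (\<integral>\<omega>. (R1 \<omega>)\<^sup>2 \<partial>M))) / s)))"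
    proof -
      have const: "has_bochner_integral M (\<lambda>_. c) c" for c :: real
        by (simp add: has_bochner_integral_iff prob_space)
      show ?thesis unfolding B_def[abs_def]
        by (intro has_bochner_integral_add has_bochner_integral_divide has_bochner_integral_mult_right IN2 IN4 const)
           (use R0(3) R1(3) in \<open>simp_all add: has_bochner_integral_iff\<close>)
    qed
    have "\<bar>(\<integral>\<omega>. D' \<omega> \<partial>M)\<bar> \<le> (\<integral>\<omega>. \<bar>D' \<omega>\<bar> \<partial>M)" using integral_norm_bound[of M D'] by simp
    also have "\<dots> \<le> (\<integral>\<omega>. B \<omega> \<partial>M)"
    proof (rule integral_mono_AE)
      show "integrable M (\<lambda>\<omega>. \<bar>D' \<omega>\<bar>)" using ID' by (simp add: has_bochner_integral_iff)
      show "integrable M B" using IB by (simp add: has_bochner_integral_iff)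
      show "AE \<omega> in M. \<bar>D' \<omega>\<bar> \<le> B \<omega>" using DD by eventually_elim (simp add: bound)
    qed
    also have "\<dots> = E * ((2 * \<kappa> + 2 * \<kappa>\<^sup>2) * s ^ 3 + (15 + 2 * \<kappa>) * (s * (3 * (3 * h))) + 14 * ((27 * (9 * h\<^sup>2)) / s)
        + 4 * ((8 * ((\<integral>\<omega>. (R0 \<omega>)\<^sup>2 \<partial>M) + (\<integral>\<omega>. (R1 \<omega>)\<^sup>2 \<partial>M))) / s))"
      by (rule has_bochner_integral_integral_eq[OF IB])
    also have "\<dots> \<le> E * ((2 * \<kappa> + 2 * \<kappa>\<^sup>2) * s ^ 3 + (15 + 2 * \<kappa>) * (s * (3 * (3 * h))) + 14 * ((27 * (9 * h\<^sup>2)) / s)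
        + 4 * ((8 * (C0 * h\<^sup>2 + C1 * h\<^sup>2)) / s))"
      using s by (intro mult_left_mono E(1) add_mono order_refl divide_right_mono R0(4) R1(4)) auto
    also have "\<dots> = C * (h * sqrt h)"
    proof -
      have "s * (3 * (3 * s\<^sup>2)) = 9 * s ^ 3" "(27 * (9 * (s\<^sup>2)\<^sup>2)) / s = 243 * s ^ 3"
        "(8 * (C0 * (s\<^sup>2)\<^sup>2 + C1 * (s\<^sup>2)\<^sup>2)) / s = 8 * (C0 + C1) * s ^ 3"
        using s(1) by (simp_all add: power2_eq_square power3_eq_cube field_simps)
      then show ?thesis
        unfolding s(4)[symmetric] unfolding C_def s(3)[symmetric] by (simp only: distrib_right distrib_left mult.assoc)
    qed
    finally show "\<bar>(\<integral>\<omega>. f (mid \<rho> (t + h) \<omega>) * k (gap \<sigma> (t + h) \<omega>) \<partial>M) - (\<integral>\<omega>. f (mid \<rho> t \<omega>) * k (gap \<sigma> t \<omega>) \<partial>M)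
      - h * (\<integral>\<omega>. generator \<rho> \<sigma> f f1 f2 k k1 k2 t \<omega> \<partial>M)\<bar> \<le> C * (h * sqrt h)"
      unfolding G_def[symmetric] has_bochner_integral_integral_eq[OF ID'] .
  qed
qed

end

section \<open>From the generator to expectations\<close>

text \<open>After \<open>n\<close> steps of length \<open>T / n\<close>, where \<open>T = t2 - t1\<close>, the factors \<open>1 - K * T / n\<close> multiply to the exponential, while the
  accumulated errors are at most of order \<open>n * (T / n) * sqrt (T / n)\<close> and vanish as \<open>n\<close> grows.\<close>

lemma discrete_growth:
  fixes g :: "real \<Rightarrow> real"
  assumes t: "t1 \<le> t2" and K: "0 \<le> K" and C: "0 \<le> C"
    and step: "\<And>t h. t1 \<le> t \<Longrightarrow> 0 < h \<Longrightarrow> h \<le> 1 \<Longrightarrow> t + h \<le> t2 \<Longrightarrow> (1 - K * h) * g t - C * (h * sqrt h) \<le> g (t + h)"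
  shows "exp (- K * (t2 - t1)) * g t1 \<le> g t2"
proof (cases "t1 = t2")
  case False
  define T where "T = t2 - t1"
  have T: "0 < T" using False t unfolding T_def by simp
  have main: "(1 + - K * T / real n) ^ n * g t1 - C * T * sqrt (T / real n) \<le> g t2"
    if n: "0 < n" "T \<le> real n" "K * T \<le> real n" for n
  proof -
    define h where "h = T / real n"
    have h: "0 < h" "h \<le> 1" "real n * h = T" "K * h \<le> 1" unfolding h_def using n T by (auto simp: field_simps)
    have "(1 - K * h) ^ j * g t1 - real j * (C * (h * sqrt h)) \<le> g (t1 + real j * h)" if "j \<le> n" for j
      using that
    proof (induction j)
      case (Suc j)
      have le: "real (Suc j) * h \<le> T" using Suc.prems h(1,3) by (metis mult_right_mono of_nat_le_iff less_imp_le)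
      have e: "0 \<le> C * (h * sqrt h)" using C h by simp
      have IH: "(1 - K * h) ^ j * g t1 - real j * (C * (h * sqrt h)) \<le> g (t1 + real j * h)" using Suc by simp
      have "(1 - K * h) ^ Suc j * g t1 - real (Suc j) * (C * (h * sqrt h)) \<le>
         (1 - K * h) * ((1 - K * h) ^ j * g t1 - real j * (C * (h * sqrt h))) - C * (h * sqrt h)"
      proof -
        have "(1 - K * h) * (real j * (C * (h * sqrt h))) \<le> 1 * (real j * (C * (h * sqrt h)))"
          using K h e by (intro mult_right_mono) auto
        then show ?thesis by (simp add: right_diff_distrib mult.assoc distrib_right)
      qed
      also have "\<dots> \<le> (1 - K * h) * g (t1 + real j * h) - C * (h * sqrt h)"
        using IH h by (intro diff_right_mono mult_left_mono) auto
      also have "\<dots> \<le> g (t1 + real j * h + h)"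
        using h le by (intro step) (auto simp: T_def algebra_simps)
      finally show ?case by (simp add: algebra_simps)
    qed simp
    from this[of n] have "(1 - K * h) ^ n * g t1 - real n * (C * (h * sqrt h)) \<le> g t2"
      using h(3) by (simp add: T_def)
    moreover have "real n * (C * (h * sqrt h)) = C * T * sqrt h" unfolding h(3)[symmetric] by simp
    ultimately show ?thesis by (simp add: h_def)
  qed
  have lim: "(\<lambda>n. (1 + - K * T / real n) ^ n * g t1 - C * T * sqrt (T / real n)) \<longlonglongrightarrow> exp (- K * T) * g t1 - C * T * sqrt 0"
  proof (intro tendsto_diff tendsto_mult tendsto_const tendsto_real_sqrt)
    show "(\<lambda>n. (1 + - K * T / real n) ^ n) \<longlonglongrightarrow> exp (- K * T)" by (rule tendsto_exp_limit_sequentially)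
    show "(\<lambda>n. T / real n) \<longlonglongrightarrow> 0" using lim_const_over_n[of T] by simp
  qed
  have ev: "\<forall>\<^sub>F n in sequentially. (1 + - K * T / real n) ^ n * g t1 - C * T * sqrt (T / real n) \<le> g t2"
  proof -
    obtain N where N: "max T (K * T) \<le> real N" using real_arch_simple by blast
    show ?thesis
    proof (rule eventually_sequentiallyI[of "max 1 N"])
      fix n assume "max 1 N \<le> n"
      then have "0 < n" "real N \<le> real n" by auto
      then show "(1 + - K * T / real n) ^ n * g t1 - C * T * sqrt (T / real n) \<le> g t2" using N by (intro main) auto
    qed
  qed
  show ?thesis using tendsto_upperbound[OF lim ev] by (simp add: T_def)
qed simp

context phase_pair
begin

lemma rbounded_generator:
  assumes t: "0 \<le> t" and f: "bounded_C3 f f1 f2 f3" and k: "bounded_C3 k k1 k2 k3"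
  shows "rbounded t (generator \<rho> \<sigma> f f1 f2 k k1 k2 t)" "rbounded t (\<lambda>\<omega>. f (mid \<rho> t \<omega>) * k (gap \<sigma> t \<omega>))"
proof -
  obtain Cf Ck where Cf: "\<And>x. \<bar>f x\<bar> \<le> Cf" "\<And>x. \<bar>f1 x\<bar> \<le> Cf" "\<And>x. \<bar>f2 x\<bar> \<le> Cf"
    and Ck: "\<And>x. \<bar>k x\<bar> \<le> Ck" "\<And>x. \<bar>k1 x\<bar> \<le> Ck" "\<And>x. \<bar>k2 x\<bar> \<le> Ck"
    using bounded_C3_bound[OF f] bounded_C3_bound[OF k] by metis
  have gm: "rbounded t (\<lambda>\<omega>. f (mid \<rho> t \<omega>))" "rbounded t (\<lambda>\<omega>. f1 (mid \<rho> t \<omega>))" "rbounded t (\<lambda>\<omega>. f2 (mid \<rho> t \<omega>))"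
       "rbounded t (\<lambda>\<omega>. k (gap \<sigma> t \<omega>))" "rbounded t (\<lambda>\<omega>. k1 (gap \<sigma> t \<omega>))" "rbounded t (\<lambda>\<omega>. k2 (gap \<sigma> t \<omega>))"
    by (rule rbounded_comp[OF _ _ mid_gap_F(1)[OF t]] rbounded_comp[OF _ _ mid_gap_F(2)[OF t]];
          fact bounded_C3_measurable[OF f] bounded_C3_measurable[OF k] Cf Ck)+
  show "rbounded t (\<lambda>\<omega>. f (mid \<rho> t \<omega>) * k (gap \<sigma> t \<omega>))" by (intro rbounded_mult gm)
  have c: "rbounded t (\<lambda>\<omega>. cos (gap 0 t \<omega>))"
    unfolding rbounded_def using mid_gap_F(2)[OF t, of 0] by (auto intro!: exI[of _ 1])
  have "rbounded t (\<lambda>\<omega>. ((l0 + l1) / 2 - \<rho>) * (f1 (mid \<rho> t \<omega>) * k (gap \<sigma> t \<omega>)) + (l1 - l0 - \<sigma>) * (f (mid \<rho> t \<omega>) * k1 (gap \<sigma> t \<omega>)) +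
     (1 / 2) * ((5 / 4 + (1 / 4) * cos (gap 0 t \<omega>)) * (f2 (mid \<rho> t \<omega>) * k (gap \<sigma> t \<omega>)) +
      (1 + (- 1) * cos (gap 0 t \<omega>)) * (f (mid \<rho> t \<omega>) * k2 (gap \<sigma> t \<omega>))))"
    by (intro rbounded_add rbounded_cmult rbounded_mult rbounded_const gm c)
  then show "rbounded t (generator \<rho> \<sigma> f f1 f2 k k1 k2 t)"
    unfolding generator_def[abs_def] by (simp add: add_divide_distrib distrib_right left_diff_distrib)
qed

text \<open>A pointwise bound on the generator turns into an exponential bound on the expectation. A nonnegative
  test function yields a lower bound on a probability, the negative of one an upper bound.\<close>

lemma expectation_growth:
  assumes t: "0 \<le> t1" "t1 \<le> t2" and K: "0 \<le> K"
    and f: "bounded_C3 f f1 f2 f3" and k: "bounded_C3 k k1 k2 k3"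
    and gen: "\<And>t. t1 \<le> t \<Longrightarrow> t \<le> t2 \<Longrightarrow>
      AE \<omega> in M. - K * (f (mid \<rho> t \<omega>) * k (gap \<sigma> t \<omega>)) \<le> generator \<rho> \<sigma> f f1 f2 k k1 k2 t \<omega>"
  shows "exp (- K * (t2 - t1)) * (\<integral>\<omega>. f (mid \<rho> t1 \<omega>) * k (gap \<sigma> t1 \<omega>) \<partial>M) \<le> (\<integral>\<omega>. f (mid \<rho> t2 \<omega>) * k (gap \<sigma> t2 \<omega>) \<partial>M)"
proof -
  define g where "g t = (\<integral>\<omega>. f (mid \<rho> t \<omega>) * k (gap \<sigma> t \<omega>) \<partial>M)" for t
  obtain C where C: "0 \<le> C" "\<And>t h. 0 \<le> t \<and> 0 < h \<and> h \<le> 1 \<Longrightarrow>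
    \<bar>g (t + h) - g t - h * (\<integral>\<omega>. generator \<rho> \<sigma> f f1 f2 k k1 k2 t \<omega> \<partial>M)\<bar> \<le> C * (h * sqrt h)"
    using one_step[OF f k, of \<rho> \<sigma>] unfolding g_def by blast
  have "exp (- K * (t2 - t1)) * g t1 \<le> g t2"
  proof (rule discrete_growth[OF t(2) K C(1)])
    fix s h :: real assume s: "t1 \<le> s" "0 < h" "h \<le> 1" "s + h \<le> t2"
    have s0: "0 \<le> s" using s t by simp
    have "(\<integral>\<omega>. - K * (f (mid \<rho> s \<omega>) * k (gap \<sigma> s \<omega>)) \<partial>M) \<le> (\<integral>\<omega>. generator \<rho> \<sigma> f f1 f2 k k1 k2 s \<omega> \<partial>M)"
      by (rule integral_mono_AE[OF rbounded_integrable[OF s0 rbounded_cmult[OF rbounded_generator(2)[OF s0 f k]]]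
            rbounded_integrable[OF s0 rbounded_generator(1)[OF s0 f k]] gen]) (use s in auto)
    then have "- K * g s \<le> (\<integral>\<omega>. generator \<rho> \<sigma> f f1 f2 k k1 k2 s \<omega> \<partial>M)" unfolding g_def by simp
    then have "h * (- K * g s) \<le> h * (\<integral>\<omega>. generator \<rho> \<sigma> f f1 f2 k k1 k2 s \<omega> \<partial>M)" using s by (intro mult_left_mono) auto
    then show "(1 - K * h) * g s - C * (h * sqrt h) \<le> g (s + h)"
      using C(2)[of s h] s0 s by (simp add: algebra_simps)
  qed
  then show ?thesis unfolding g_def .
qed

end

section \<open>Operations on test functions\<close>

lemma DERIV_pos_power:
  fixes z :: real
  shows "((\<lambda>z. max 0 z ^ Suc (Suc n)) has_real_derivative real (Suc (Suc n)) * max 0 z ^ Suc n) (at z)"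
proof -
  consider "z > 0" | "z < 0" | "z = 0" by linarith
  then show ?thesis
  proof cases
    case 1
    have "((\<lambda>z. z ^ Suc (Suc n)) has_real_derivative real (Suc (Suc n)) * z ^ Suc n) (at z)"
      using DERIV_pow[of "Suc (Suc n)" z] by simp
    moreover have "\<forall>\<^sub>F y in nhds z. y ^ Suc (Suc n) = max 0 y ^ Suc (Suc n)"
      using eventually_nhds_in_open[of "{0<..}" z] 1 by (auto elim!: eventually_mono)
    ultimately show ?thesis using 1
      by (subst DERIV_cong_ev[OF refl _ refl, of _ "\<lambda>y. y ^ Suc (Suc n)"]) (auto elim: eventually_mono)
  next
    case 2
    have "((\<lambda>z. 0) has_real_derivative 0) (at z)" by simp
    moreover have "\<forall>\<^sub>F y in nhds z. max 0 y ^ Suc (Suc n) = (0::real)"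
      using eventually_nhds_in_open[of "{..<0}" z] 2 by (auto elim!: eventually_mono)
    ultimately show ?thesis using 2
      by (subst DERIV_cong_ev[OF refl _ refl, of _ "\<lambda>y. 0"]) auto
  next
    case 3
    have "(\<lambda>y. max 0 y ^ Suc (Suc n) / y) \<midarrow>0\<rightarrow> (0::real)"
    proof (rule Lim_null_comparison)
      show "\<forall>\<^sub>F y in at 0. norm (max 0 y ^ Suc (Suc n) / y) \<le> \<bar>y\<bar> ^ Suc n"
      proof (rule always_eventually, rule allI)
        fix y :: real
        show "norm (max 0 y ^ Suc (Suc n) / y) \<le> \<bar>y\<bar> ^ Suc n"
        proof (cases "y > 0")
          case False
          then have "max 0 y ^ Suc (Suc n) / y = 0" by simp
          then show ?thesis using zero_le_power_abs[of y "Suc n"] by (simp only: norm_zero)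
        qed simp
      qed
      have "(\<lambda>y. \<bar>y\<bar> ^ Suc n) \<midarrow>0\<rightarrow> \<bar>0::real\<bar> ^ Suc n" by (intro tendsto_intros)
      then show "(\<lambda>y. \<bar>y\<bar> ^ Suc n) \<midarrow>0\<rightarrow> (0::real)" by simp
    qed
    then show ?thesis using 3 by (simp add: has_field_derivative_iff)
  qed
qed

lemma DERIV_pos_power_comp:
  assumes "(g has_real_derivative g') (at x)"
  shows "((\<lambda>x. max 0 (g x) ^ Suc (Suc n)) has_real_derivative real (Suc (Suc n)) * max 0 (g x) ^ Suc n * g') (at x)"
  by (rule DERIV_chain2[OF DERIV_pos_power assms])

lemma bounded_C3_const: "bounded_C3 (\<lambda>_. c) (\<lambda>_. 0) (\<lambda>_. 0) (\<lambda>_. 0)"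
  unfolding bounded_C3_def by (auto intro!: exI[of _ "\<bar>c\<bar>"])

lemma bounded_C3_shift:
  assumes "bounded_C3 f f1 f2 f3"
  shows "bounded_C3 (\<lambda>x. f (x - c)) (\<lambda>x. f1 (x - c)) (\<lambda>x. f2 (x - c)) (\<lambda>x. f3 (x - c))"
proof -
  have *: "((\<lambda>x. g (x - c)) has_real_derivative g' (x - c)) (at x)"
    if "\<And>x. (g has_real_derivative g' x) (at x)" for g g' x
  proof -
    have "((\<lambda>x. x - c) has_real_derivative 1) (at x)" by (auto intro!: derivative_eq_intros)
    from DERIV_chain2[OF that this] show ?thesis by simp
  qed
  show ?thesis using assms unfolding bounded_C3_def by (auto intro!: *)
qed

section \<open>The angular bump\<close>

text \<open>The bump confines an angle to the arc of radius \<open>\<pi> / 3\<close> around \<open>0\<close> modulo \<open>2 * \<pi>\<close>. The fourth power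
  makes it three times continuously differentiable.\<close>

definition cosbump :: "real \<Rightarrow> real" where "cosbump x = max 0 (cos x - 1 / 2) ^ 4"
definition cosbump1 :: "real \<Rightarrow> real" where "cosbump1 x = - 4 * (max 0 (cos x - 1 / 2) ^ 3 * sin x)"
definition cosbump2 :: "real \<Rightarrow> real" where
  "cosbump2 x = 12 * (max 0 (cos x - 1 / 2) ^ 2 * (sin x * sin x)) - 4 * (max 0 (cos x - 1 / 2) ^ 3 * cos x)"
definition cosbump3 :: "real \<Rightarrow> real" where
  "cosbump3 x = - 24 * (max 0 (cos x - 1 / 2) * (sin x * (sin x * sin x))) +
     36 * (max 0 (cos x - 1 / 2) ^ 2 * (sin x * cos x)) + 4 * (max 0 (cos x - 1 / 2) ^ 3 * sin x)"

lemma bounded_C3_cosbump: "bounded_C3 cosbump cosbump1 cosbump2 cosbump3"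
  unfolding bounded_C3_def
proof (intro conjI allI)
  fix x :: real
  define q where "q x = max 0 (cos x - 1 / 2)" for x :: real
  have dc: "((\<lambda>x. cos x - 1 / 2) has_real_derivative - sin x) (at x)" by (auto intro!: derivative_eq_intros)
  have d2: "((\<lambda>x. q x ^ 2) has_real_derivative 2 * q x * (- sin x)) (at x)"
    using DERIV_pos_power_comp[OF dc, of 0] unfolding q_def by (simp add: numeral_eq_Suc)
  have d3: "((\<lambda>x. q x ^ 3) has_real_derivative 3 * q x ^ 2 * (- sin x)) (at x)"
    using DERIV_pos_power_comp[OF dc, of 1] unfolding q_def by (simp add: numeral_eq_Suc)
  have d4: "((\<lambda>x. q x ^ 4) has_real_derivative 4 * q x ^ 3 * (- sin x)) (at x)"
    using DERIV_pos_power_comp[OF dc, of 2] unfolding q_def by (simp add: numeral_eq_Suc)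
  show "(cosbump has_real_derivative cosbump1 x) (at x)"
    using d4 unfolding cosbump_def[abs_def] cosbump1_def q_def[symmetric] by (simp add: mult.assoc)
  show "(cosbump1 has_real_derivative cosbump2 x) (at x)"
    unfolding cosbump1_def[abs_def] cosbump2_def q_def[symmetric]
    by (rule derivative_eq_intros d3 refl)+ (simp add: algebra_simps)
  show "(cosbump2 has_real_derivative cosbump3 x) (at x)"
    unfolding cosbump2_def[abs_def] cosbump3_def q_def[symmetric]
    by (rule derivative_eq_intros d2 d3 refl)+ (simp add: algebra_simps)
next
  show "\<exists>C. \<forall>x. \<bar>cosbump x\<bar> \<le> C \<and> \<bar>cosbump1 x\<bar> \<le> C \<and> \<bar>cosbump2 x\<bar> \<le> C \<and> \<bar>cosbump3 x\<bar> \<le> C"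
  proof (intro exI[of _ 64] allI)
    fix x :: real
    have one: "\<bar>u * v\<bar> \<le> 1" if "\<bar>u\<bar> \<le> 1" "\<bar>v\<bar> \<le> 1" for u v :: real
      unfolding abs_mult using that by (intro mult_le_one) auto
    have q: "\<bar>max 0 (cos x - 1 / 2)\<bar> \<le> 1" using cos_le_one[of x] by linarith
    have qn: "\<bar>max 0 (cos x - 1 / 2) ^ n\<bar> \<le> 1" for n
      unfolding power_abs using q by (intro power_le_one) auto
    note sc = abs_sin_le_one[of x] abs_cos_le_one[of x]
    have comb: "\<bar>u0\<bar> \<le> 64 \<and> \<bar>- 4 * u1\<bar> \<le> 64 \<and> \<bar>12 * u2 - 4 * u3\<bar> \<le> 64 \<and> \<bar>- 24 * u4 + 36 * u5 + 4 * u1\<bar> \<le> 64"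
      if "\<bar>u0\<bar> \<le> 1" "\<bar>u1\<bar> \<le> 1" "\<bar>u2\<bar> \<le> 1" "\<bar>u3\<bar> \<le> 1" "\<bar>u4\<bar> \<le> 1" "\<bar>u5\<bar> \<le> 1" for u0 u1 u2 u3 u4 u5 :: real
      using that unfolding abs_le_iff by linarith
    have "\<bar>max 0 (cos x - 1 / 2) ^ 4\<bar> \<le> 1" "\<bar>max 0 (cos x - 1 / 2) ^ 3 * sin x\<bar> \<le> 1"
      "\<bar>max 0 (cos x - 1 / 2) ^ 2 * (sin x * sin x)\<bar> \<le> 1" "\<bar>max 0 (cos x - 1 / 2) ^ 3 * cos x\<bar> \<le> 1"
      "\<bar>max 0 (cos x - 1 / 2) * (sin x * (sin x * sin x))\<bar> \<le> 1" "\<bar>max 0 (cos x - 1 / 2) ^ 2 * (sin x * cos x)\<bar> \<le> 1"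
      by (intro one qn q sc)+
    then show "\<bar>cosbump x\<bar> \<le> 64 \<and> \<bar>cosbump1 x\<bar> \<le> 64 \<and> \<bar>cosbump2 x\<bar> \<le> 64 \<and> \<bar>cosbump3 x\<bar> \<le> 64"
      unfolding cosbump_def cosbump1_def cosbump2_def cosbump3_def by (rule comb)
  qed
qed

lemma cosbump_bounds: "0 \<le> cosbump x" "cosbump x \<le> 1"
proof -
  show "0 \<le> cosbump x" unfolding cosbump_def by simp
  have "max 0 (cos x - 1 / 2) \<le> 1" using cos_le_one[of x] by linarith
  then show "cosbump x \<le> 1" unfolding cosbump_def by (intro power_le_one) auto
qed

text \<open>Near the edge of the support the second derivative is positive and dominates the first one and the
  function itself, so under a bounded drift the mean of the bump decays at most at a bounded rate.\<close>

lemma cosbump_subsolution: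
  fixes a r :: real
  assumes a: "1 / 2 \<le> a" "a \<le> 3 / 4" and r: "\<bar>r\<bar> \<le> R"
  shows "- (11 + 2 * R\<^sup>2) * cosbump x \<le> r * cosbump1 x + a * cosbump2 x"
proof -
  define q where "q = max 0 (cos x - 1 / 2)"
  define S where "S = sin x"
  \<comment> \<open>half of \<open>12 * a * S\<^sup>2\<close> absorbs the drift, the other half the curvature of the cosine\<close>
  have "0 \<le> q\<^sup>2 * (12 * a * S\<^sup>2 - 4 * a * q * cos x - 4 * r * q * S + (11 + 2 * R\<^sup>2) * q\<^sup>2)"
  proof (cases "q = 0")
    case False
    then have q: "cos x = q + 1 / 2" "0 < q" unfolding q_def by (auto simp: max_def split: if_splits)
    have S2: "S\<^sup>2 = 3 / 4 - q - q\<^sup>2"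
      using sin_squared_eq[of x] unfolding S_def q(1) by (simp add: power2_eq_square algebra_simps)
    have R2: "r\<^sup>2 \<le> R\<^sup>2" using r by (metis abs_le_square_iff abs_ge_self order_trans)
    have "6 * a * S\<^sup>2 - 4 * r * q * S + 2 * R\<^sup>2 * q\<^sup>2 \<ge> 3 * S\<^sup>2 - 4 * (r * q * S) + 2 * (r\<^sup>2 * q\<^sup>2)"
    proof -
      have "3 * S\<^sup>2 \<le> 6 * a * S\<^sup>2" using a by (intro mult_right_mono) auto
      moreover have "r\<^sup>2 * q\<^sup>2 \<le> R\<^sup>2 * q\<^sup>2" using R2 by (intro mult_right_mono) auto
      ultimately show ?thesis by (simp add: mult.assoc)
    qed
    also have "3 * S\<^sup>2 - 4 * (r * q * S) + 2 * (r\<^sup>2 * q\<^sup>2) = S\<^sup>2 + 2 * (S - r * q)\<^sup>2"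
      by (simp add: power2_eq_square algebra_simps)
    finally have 1: "0 \<le> 6 * a * S\<^sup>2 - 4 * r * q * S + 2 * R\<^sup>2 * q\<^sup>2"
      by (smt (verit) zero_le_power2)
    have "6 * a * S\<^sup>2 - 4 * a * q * cos x + 11 * q\<^sup>2 = a * (9 / 2 - 8 * q - 10 * q\<^sup>2) + 11 * q\<^sup>2"
      unfolding S2 q(1) by (simp add: power2_eq_square algebra_simps)
    also have "\<dots> \<ge> a * (9 / 2 - 8 * q - 10 * q\<^sup>2) + a * (14 * q\<^sup>2)"
    proof -
      have "a * 14 \<le> 11" using a by simp
      then have "(a * 14) * q\<^sup>2 \<le> 11 * q\<^sup>2" by (rule mult_right_mono) simp
      then show ?thesis by (simp add: mult.assoc)
    qed
    finally have "a * (9 / 2 - 8 * q + 4 * q\<^sup>2) \<le> 6 * a * S\<^sup>2 - 4 * a * q * cos x + 11 * q\<^sup>2"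
      by (simp add: algebra_simps)
    moreover have "0 \<le> a * (9 / 2 - 8 * q + 4 * q\<^sup>2)"
    proof -
      have "0 \<le> (2 * q - 2)\<^sup>2 + 1 / 2" by simp
      also have "\<dots> = 9 / 2 - 8 * q + 4 * q\<^sup>2" by (simp add: power2_eq_square algebra_simps)
      finally show ?thesis using a by (intro mult_nonneg_nonneg) auto
    qed
    ultimately have 2: "0 \<le> 6 * a * S\<^sup>2 - 4 * a * q * cos x + 11 * q\<^sup>2" by linarith
    show ?thesis using 1 2 by (intro mult_nonneg_nonneg) (simp_all add: algebra_simps)
  qed simp
  also have "\<dots> = r * cosbump1 x + a * cosbump2 x + (11 + 2 * R\<^sup>2) * cosbump x"
    unfolding cosbump_def cosbump1_def cosbump2_def q_def[symmetric] S_def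
    by (simp add: power2_eq_square power3_eq_cube numeral_eq_Suc algebra_simps)
  finally show ?thesis unfolding mult_minus_left by linarith
qed

section \<open>The bump in the relative phase\<close>

text \<open>The parameter \<open>D\<close> is the square of the radius of the support.\<close>

definition bump :: "real \<Rightarrow> real \<Rightarrow> real" where "bump D z = max 0 (D - z\<^sup>2) ^ 4"
definition bump1 :: "real \<Rightarrow> real \<Rightarrow> real" where "bump1 D z = - 8 * (z * max 0 (D - z\<^sup>2) ^ 3)"
definition bump2 :: "real \<Rightarrow> real \<Rightarrow> real" where
  "bump2 D z = 48 * (z\<^sup>2 * max 0 (D - z\<^sup>2) ^ 2) - 8 * max 0 (D - z\<^sup>2) ^ 3"
definition bump3 :: "real \<Rightarrow> real \<Rightarrow> real" where
  "bump3 D z = 144 * (z * max 0 (D - z\<^sup>2) ^ 2) - 192 * (z ^ 3 * max 0 (D - z\<^sup>2))"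

lemma DERIV_bump:
  "(bump D has_real_derivative bump1 D z) (at z)" "(bump1 D has_real_derivative bump2 D z) (at z)"
  "(bump2 D has_real_derivative bump3 D z) (at z)"
proof -
  define w where "w z = max 0 (D - z\<^sup>2)" for z :: real
  have dw: "((\<lambda>z. D - z\<^sup>2) has_real_derivative - (2 * z)) (at z)" by (auto intro!: derivative_eq_intros)
  have d2: "((\<lambda>z. w z ^ 2) has_real_derivative 2 * w z * (- (2 * z))) (at z)"
    using DERIV_pos_power_comp[OF dw, of 0] unfolding w_def by (simp add: numeral_eq_Suc)
  have d3: "((\<lambda>z. w z ^ 3) has_real_derivative 3 * w z ^ 2 * (- (2 * z))) (at z)"
    using DERIV_pos_power_comp[OF dw, of 1] unfolding w_def by (simp add: numeral_eq_Suc)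
  have d4: "((\<lambda>z. w z ^ 4) has_real_derivative 4 * w z ^ 3 * (- (2 * z))) (at z)"
    using DERIV_pos_power_comp[OF dw, of 2] unfolding w_def by (simp add: numeral_eq_Suc)
  show "(bump D has_real_derivative bump1 D z) (at z)"
    using d4 unfolding bump_def[abs_def] bump1_def w_def[symmetric] by (simp add: mult_ac)
  show "(bump1 D has_real_derivative bump2 D z) (at z)"
    unfolding bump1_def[abs_def] bump2_def w_def[symmetric]
    by (rule derivative_eq_intros d3 refl)+ (simp add: algebra_simps power2_eq_square)
  show "(bump2 D has_real_derivative bump3 D z) (at z)"
    unfolding bump2_def[abs_def] bump3_def w_def[symmetric]
    by (rule derivative_eq_intros d2 d3 refl)+ (simp add: algebra_simps power2_eq_square power3_eq_cube)
qed

lemma bump_outside: "D \<le> z\<^sup>2 \<Longrightarrow> bump D z = 0 \<and> bump1 D z = 0 \<and> bump2 D z = 0 \<and> bump3 D z = 0"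
  unfolding bump_def bump1_def bump2_def bump3_def by (simp add: max_def)

lemma bounded_if_vanishing_outside:
  fixes g :: "real \<Rightarrow> real"
  assumes "continuous_on UNIV g" "\<And>z. 1 \<le> \<bar>z\<bar> \<Longrightarrow> g z = 0"
  shows "\<exists>C\<ge>0. \<forall>z. \<bar>g z\<bar> \<le> C"
proof -
  have "compact (g ` {-1..1})"
    by (intro compact_continuous_image continuous_on_subset[OF assms(1)]) auto
  then have "bounded (g ` {-1..1})" by (rule compact_imp_bounded)
  then have "\<exists>C. \<forall>y\<in>g ` {-1..1}. norm y \<le> C" by (simp only: bounded_iff)
  then obtain C where C: "\<And>y. y \<in> g ` {-1..1} \<Longrightarrow> norm y \<le> C" by blast
  have "\<bar>g z\<bar> \<le> \<bar>C\<bar>" for z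
  proof (cases "\<bar>z\<bar> \<le> 1")
    case True
    then have "z \<in> {-1..1}" by auto
    then have "norm (g z) \<le> C" by (intro C imageI)
    then show ?thesis by simp
  qed (use assms(2)[of z] in simp)
  then show ?thesis by (intro exI[of _ "\<bar>C\<bar>"]) auto
qed

lemma bounded_C3_tilted_bump:
  assumes D: "D \<le> 1"
  shows "bounded_C3 (\<lambda>z. exp (- \<theta> * z) * bump D z)
    (\<lambda>z. exp (- \<theta> * z) * (bump1 D z - \<theta> * bump D z))
    (\<lambda>z. exp (- \<theta> * z) * (bump2 D z - 2 * \<theta> * bump1 D z + \<theta>\<^sup>2 * bump D z))
    (\<lambda>z. exp (- \<theta> * z) * (bump3 D z - 3 * \<theta> * bump2 D z + 3 * \<theta>\<^sup>2 * bump1 D z - \<theta> ^ 3 * bump D z))"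
    (is "bounded_C3 ?f ?f1 ?f2 ?f3")
proof -
  have e: "((\<lambda>z. exp (- \<theta> * z)) has_real_derivative exp (- \<theta> * z) * (- \<theta>)) (at z)" for z
    by (auto intro!: derivative_eq_intros)
  have d: "(?f has_real_derivative ?f1 z) (at z)" "(?f1 has_real_derivative ?f2 z) (at z)"
    "(?f2 has_real_derivative ?f3 z) (at z)" for z
    by ((rule derivative_eq_intros e DERIV_bump refl)+, simp add: algebra_simps power2_eq_square power3_eq_cube)+
  have c3: "continuous_on UNIV ?f3"
    unfolding bump_def bump1_def bump2_def bump3_def by (intro continuous_intros)
  have c: "continuous_on UNIV g" if "\<And>z. (g has_real_derivative g' z) (at z)" for g g'
    unfolding continuous_on_eq_continuous_at[OF open_UNIV] using that by (blast intro: DERIV_isCont)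
  have z: "D \<le> z\<^sup>2" if "1 \<le> \<bar>z\<bar>" for z
    using D that power_mono[OF that, of 2] by simp
  have "\<exists>C\<ge>0. \<forall>z. \<bar>?f z\<bar> \<le> C" "\<exists>C\<ge>0. \<forall>z. \<bar>?f1 z\<bar> \<le> C" "\<exists>C\<ge>0. \<forall>z. \<bar>?f2 z\<bar> \<le> C" "\<exists>C\<ge>0. \<forall>z. \<bar>?f3 z\<bar> \<le> C"
    by (rule bounded_if_vanishing_outside, rule c, rule d, simp add: bump_outside[OF z])+
       (rule bounded_if_vanishing_outside[OF c3], simp add: bump_outside[OF z])
  then obtain C0 C1 C2 C3 where "\<And>z. \<bar>?f z\<bar> \<le> C0" "\<And>z. \<bar>?f1 z\<bar> \<le> C1" "\<And>z. \<bar>?f2 z\<bar> \<le> C2" "\<And>z. \<bar>?f3 z\<bar> \<le> C3"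
    by metis
  then have "\<bar>?f z\<bar> \<le> max (max C0 C1) (max C2 C3) \<and> \<bar>?f1 z\<bar> \<le> max (max C0 C1) (max C2 C3) \<and>
     \<bar>?f2 z\<bar> \<le> max (max C0 C1) (max C2 C3) \<and> \<bar>?f3 z\<bar> \<le> max (max C0 C1) (max C2 C3)" for z
    by (meson max.coboundedI1 max.coboundedI2)
  then show ?thesis unfolding bounded_C3_def using d by blast
qed

lemma bump_bounds: "D \<le> 1 \<Longrightarrow> 0 \<le> bump D z" "D \<le> 1 \<Longrightarrow> bump D z \<le> 1"
proof -
  show "0 \<le> bump D z" unfolding bump_def by simp
  show "bump D z \<le> 1" if "D \<le> 1"
    unfolding bump_def using that by (intro power_le_one) (auto simp: max_def intro: order_trans[OF _ that])
qed

text \<open>The rate does not depend on the noise strength \<open>s\<close>, which may vanish. This matters at the start, where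
  the relative phase is \<open>0\<close> and its noise is degenerate.\<close>

lemma bump_subsolution:
  assumes D: "0 < D" and s: "0 \<le> s" "s \<le> 1"
  shows "- (17 / D) * bump D z \<le> s * bump2 D z"
proof (cases "D \<le> z\<^sup>2")
  case False
  define w where "w = D - z\<^sup>2"
  have w: "0 < w" "max 0 (D - z\<^sup>2) = w" "z\<^sup>2 = D - w" unfolding w_def using False by auto
  have "s * (48 * D - 56 * w) + 17 / D * w\<^sup>2 \<ge> s * (48 * D - 56 * w + 17 / D * w\<^sup>2)"
  proof -
    have "s * (17 / D * w\<^sup>2) \<le> 1 * (17 / D * w\<^sup>2)" using s D by (intro mult_right_mono) auto
    then show ?thesis by (simp add: distrib_left)
  qed
  moreover have "0 \<le> 48 * D - 56 * w + 17 / D * w\<^sup>2"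
  proof -
    have "0 \<le> ((17 * w - 28 * D)\<^sup>2 + 32 * D\<^sup>2) / (17 * D)" using D by simp
    also have "\<dots> = 48 * D - 56 * w + 17 / D * w\<^sup>2"
      using D by (simp add: power2_eq_square field_simps)
    finally show ?thesis .
  qed
  ultimately have "0 \<le> s * (48 * D - 56 * w) + 17 / D * w\<^sup>2" using s by (smt (verit) mult_nonneg_nonneg)
  then have "0 \<le> w\<^sup>2 * (s * (48 * D - 56 * w) + 17 / D * w\<^sup>2)" by simp
  also have "\<dots> = s * bump2 D z + 17 / D * bump D z"
    unfolding bump_def bump2_def unfolding w(2) unfolding w(3) by (simp add: power2_eq_square power3_eq_cube numeral_eq_Suc algebra_simps)
  finally show ?thesis unfolding mult_minus_left by linarith
qed (simp add: bump_outside)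

lemma one_minus_cos_le: "1 - cos z \<le> z\<^sup>2 / 2" for z :: real
proof -
  have "1 - cos z = 2 * (sin (z / 2))\<^sup>2" using cos_double_sin[of "z / 2"] by simp
  also have "(sin (z / 2))\<^sup>2 \<le> (z / 2)\<^sup>2" using abs_sin_x_le_abs_x[of "z / 2"] unfolding abs_le_square_iff .
  finally show ?thesis by (simp add: power2_eq_square)
qed

text \<open>For \<open>s = 1\<close> the tilt by \<open>exp (- \<nu> * z / 2)\<close> turns the operator \<open>\<nu> * u' + u''\<close> into
  \<open>u'' - \<nu>\<^sup>2 / 4 * u\<close>, so holding the relative phase at \<open>\<pi>\<close> against the drift costs \<open>\<nu>\<^sup>2 / 4\<close> per unit
  of time. The radius \<open>1 / sqrt \<nu>\<close> of the bump makes the other costs of order \<open>\<nu>\<close>: the confinement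
  costs a multiple of \<open>1 / D\<close>, and on the support the deficit \<open>1 - s \<le> z\<^sup>2 / 4\<close>, which enters with
  the factor \<open>\<nu>\<^sup>2 / 4\<close>, is at most \<open>1 / (4 * \<nu>)\<close>.\<close>

lemma tilted_bump_subsolution:
  assumes \<nu>: "1 \<le> \<nu>" and s: "s = (1 + cos z) / 2" and D: "D = 1 / \<nu>" and \<theta>: "\<theta> = \<nu> / 2"
  shows "- (\<nu>\<^sup>2 / 4 + 12 * \<nu> + 1) * (exp (- \<theta> * z) * bump D z) \<le>
    \<nu> * (exp (- \<theta> * z) * (bump1 D z - \<theta> * bump D z)) +
    s * (exp (- \<theta> * z) * (bump2 D z - 2 * \<theta> * bump1 D z + \<theta>\<^sup>2 * bump D z))"
proof (cases "D \<le> z\<^sup>2")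
  case False
  have D0: "0 < D" "D \<le> 1" "\<nu> * D = 1" using \<nu> D by auto
  define w where "w = D - z\<^sup>2"
  have w: "0 < w" "max 0 (D - z\<^sup>2) = w" "z\<^sup>2 = D - w" unfolding w_def using False by auto
  define d where "d = 1 - s"
  have d: "0 \<le> d" "d \<le> D / 4"
    using one_minus_cos_le[of z] False cos_le_one[of z] unfolding d_def s by (auto simp: field_simps)
  have s1: "3 / 4 \<le> s" "s \<le> 1" using d D0 unfolding d_def by auto
  have \<nu>d: "\<nu> * d \<le> 1 / 4"
  proof -
    have "\<nu> * d \<le> \<nu> * (D / 4)" using d \<nu> by (intro mult_left_mono) auto
    then show ?thesis using D0 by simp
  qed
  have nd0: "0 \<le> \<nu> * d" using d \<nu> by simp
  \<comment> \<open>the bracket splits into three nonnegative parts\<close>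
  have 1: "0 \<le> 24 * s * z\<^sup>2 - 8 * (\<nu> * d) * z * w + w\<^sup>2"
  proof -
    have "(8 * (\<nu> * d) * z * w) \<le> \<bar>8 * (\<nu> * d) * z * w\<bar>" by (rule abs_ge_self)
    also have "\<dots> = (8 * (\<nu> * d)) * \<bar>z * w\<bar>" using nd0 abs_mult[of "8 * (\<nu> * d)" "z * w"] by (simp add: mult.assoc)
    also have "\<dots> \<le> 2 * \<bar>z * w\<bar>" using \<nu>d by (intro mult_right_mono) auto
    also have "\<dots> \<le> z\<^sup>2 + w\<^sup>2" using sum_squares_bound[of "\<bar>z\<bar>" "\<bar>w\<bar>"] by (simp add: abs_mult)
    also have "z\<^sup>2 \<le> 24 * s * z\<^sup>2" using s1 mult_right_mono[of 1 "24 * s" "z\<^sup>2"] by simp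
    finally show ?thesis by simp
  qed
  have 2: "0 \<le> 24 * s * z\<^sup>2 - 8 * s * w + 11 * \<nu> * w\<^sup>2"
  proof -
    have "11 * \<nu> * w\<^sup>2 \<ge> s * (11 * \<nu> * w\<^sup>2)" using s1 \<nu> mult_right_mono[of s 1 "11 * \<nu> * w\<^sup>2"] by simp
    moreover have "0 \<le> s * (24 * D - 32 * w + 11 * \<nu> * w\<^sup>2)"
    proof -
      have "0 \<le> D * ((11 * (\<nu> * w) - 16)\<^sup>2 + 8) / 11" using D0 by simp
      also have "\<dots> = 24 * D - 32 * w * (\<nu> * D) + 11 * \<nu> * w\<^sup>2 * (\<nu> * D)" by (simp add: power2_eq_square field_simps)
      finally show ?thesis unfolding D0(3) using s1 by (intro mult_nonneg_nonneg) auto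
    qed
    ultimately show ?thesis unfolding w(3) by (simp add: algebra_simps)
  qed
  have 3: "0 \<le> (\<nu> - \<nu>\<^sup>2 * d / 4) * w\<^sup>2"
  proof -
    have "\<nu> * (\<nu> * d) \<le> \<nu> * (1 / 4)" using \<nu>d \<nu> by (intro mult_left_mono) auto
    then have "0 \<le> \<nu> - \<nu>\<^sup>2 * d / 4" using \<nu> by (simp add: power2_eq_square mult.assoc)
    then show ?thesis by simp
  qed
  have "0 \<le> exp (- \<theta> * z) * (w\<^sup>2 * ((24 * s * z\<^sup>2 - 8 * (\<nu> * d) * z * w + w\<^sup>2) + (24 * s * z\<^sup>2 - 8 * s * w + 11 * \<nu> * w\<^sup>2)
     + (\<nu> - \<nu>\<^sup>2 * d / 4) * w\<^sup>2))"
    by (intro mult_nonneg_nonneg add_nonneg_nonneg[OF add_nonneg_nonneg[OF 1 2] 3]) auto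
  also have "\<dots> = \<nu> * (exp (- \<theta> * z) * (bump1 D z - \<theta> * bump D z)) +
    s * (exp (- \<theta> * z) * (bump2 D z - 2 * \<theta> * bump1 D z + \<theta>\<^sup>2 * bump D z)) +
    (\<nu>\<^sup>2 / 4 + 12 * \<nu> + 1) * (exp (- \<theta> * z) * bump D z)"
    unfolding bump_def bump1_def bump2_def w(2) d_def \<theta> by (simp add: power2_eq_square power3_eq_cube numeral_eq_Suc field_simps)
  finally show ?thesis unfolding mult_minus_left by linarith
qed (simp add: bump_outside)

section \<open>The logistic function\<close>

definition logistic :: "real \<Rightarrow> real" where "logistic x = 1 / (1 + exp x)"

lemma logistic_bounds: "0 < logistic x" "logistic x < 1"
  unfolding logistic_def by (simp_all add: add_pos_pos)

lemma logistic_antimono: "x \<le> y \<Longrightarrow> logistic y \<le> logistic x"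
  unfolding logistic_def by (intro divide_left_mono mult_pos_pos) (auto intro: add_pos_pos)

lemma DERIV_logistic: "(logistic has_real_derivative - (logistic x * (1 - logistic x))) (at x)"
proof -
  have p: "1 + exp x \<noteq> 0" using exp_gt_zero[of x] by linarith
  have "((\<lambda>x. 1 / (1 + exp x)) has_real_derivative - exp x / (1 + exp x)\<^sup>2) (at x)"
    using p by (auto intro!: derivative_eq_intros simp: power2_eq_square)
  moreover have "- exp x / (1 + exp x)\<^sup>2 = - (logistic x * (1 - logistic x))"
    unfolding logistic_def using p by (simp add: power2_eq_square field_simps)
  ultimately show ?thesis unfolding logistic_def[abs_def] by simp
qed

lemma bounded_C3_logistic:
  "bounded_C3 (\<lambda>a. logistic (\<theta> * a + c))
    (\<lambda>a. - \<theta> * (logistic (\<theta> * a + c) * (1 - logistic (\<theta> * a + c))))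
    (\<lambda>a. \<theta>\<^sup>2 * (logistic (\<theta> * a + c) * (1 - logistic (\<theta> * a + c)) * (1 - 2 * logistic (\<theta> * a + c))))
    (\<lambda>a. \<theta> ^ 3 * (logistic (\<theta> * a + c) * (1 - logistic (\<theta> * a + c)) *
       (2 * (logistic (\<theta> * a + c) * (1 - logistic (\<theta> * a + c))) - (1 - 2 * logistic (\<theta> * a + c)) * (1 - 2 * logistic (\<theta> * a + c)))))"
  unfolding bounded_C3_def
proof (intro conjI allI)
  fix a :: real
  define g where "g a = logistic (\<theta> * a + c)" for a
  have dg: "(g has_real_derivative - (g a * (1 - g a)) * \<theta>) (at a)"
    unfolding g_def[abs_def] by (rule DERIV_chain2[OF DERIV_logistic]) (auto intro!: derivative_eq_intros)
  show "((\<lambda>a. logistic (\<theta> * a + c)) has_real_derivative - \<theta> * (logistic (\<theta> * a + c) * (1 - logistic (\<theta> * a + c)))) (at a)"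
    using dg unfolding g_def by (simp add: mult_ac)
  show "((\<lambda>a. - \<theta> * (logistic (\<theta> * a + c) * (1 - logistic (\<theta> * a + c)))) has_real_derivative
      \<theta>\<^sup>2 * (logistic (\<theta> * a + c) * (1 - logistic (\<theta> * a + c)) * (1 - 2 * logistic (\<theta> * a + c)))) (at a)"
    unfolding g_def[symmetric]
    by (rule derivative_eq_intros dg refl)+ (simp add: algebra_simps power2_eq_square)
  show "((\<lambda>a. \<theta>\<^sup>2 * (logistic (\<theta> * a + c) * (1 - logistic (\<theta> * a + c)) * (1 - 2 * logistic (\<theta> * a + c)))) has_real_derivative
      \<theta> ^ 3 * (logistic (\<theta> * a + c) * (1 - logistic (\<theta> * a + c)) *
       (2 * (logistic (\<theta> * a + c) * (1 - logistic (\<theta> * a + c))) - (1 - 2 * logistic (\<theta> * a + c)) * (1 - 2 * logistic (\<theta> * a + c))))) (at a)"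
    unfolding g_def[symmetric]
    by (rule derivative_eq_intros dg refl)+ (simp add: algebra_simps power2_eq_square power3_eq_cube)
next
  define T where "T = max 1 \<bar>\<theta>\<bar> ^ 3"
  have pw: "\<bar>\<theta>\<bar> ^ n \<le> T" if "n \<le> 3" for n
  proof -
    have "\<bar>\<theta>\<bar> ^ n \<le> max 1 \<bar>\<theta>\<bar> ^ n" by (intro power_mono) auto
    also have "\<dots> \<le> T" unfolding T_def using that by (intro power_increasing) auto
    finally show ?thesis .
  qed
  have T: "1 \<le> T" using pw[of 0] by simp
  show "\<exists>C. \<forall>a. \<bar>logistic (\<theta> * a + c)\<bar> \<le> C \<and> \<bar>- \<theta> * (logistic (\<theta> * a + c) * (1 - logistic (\<theta> * a + c)))\<bar> \<le> C \<and>
      \<bar>\<theta>\<^sup>2 * (logistic (\<theta> * a + c) * (1 - logistic (\<theta> * a + c)) * (1 - 2 * logistic (\<theta> * a + c)))\<bar> \<le> C \<and>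
      \<bar>\<theta> ^ 3 * (logistic (\<theta> * a + c) * (1 - logistic (\<theta> * a + c)) *
       (2 * (logistic (\<theta> * a + c) * (1 - logistic (\<theta> * a + c))) - (1 - 2 * logistic (\<theta> * a + c)) * (1 - 2 * logistic (\<theta> * a + c))))\<bar> \<le> C"
  proof (intro exI[of _ "T * 3"] allI)
    fix a
    define g where "g = logistic (\<theta> * a + c)"
    have g: "0 < g" "g < 1" unfolding g_def by (rule logistic_bounds)+
    have one: "\<bar>u * v\<bar> \<le> 1" if "\<bar>u\<bar> \<le> 1" "\<bar>v\<bar> \<le> 1" for u v :: real
      unfolding abs_mult using that by (intro mult_le_one) auto
    have b: "\<bar>g\<bar> \<le> 1" "\<bar>1 - g\<bar> \<le> 1" "\<bar>1 - 2 * g\<bar> \<le> 1" using g by auto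
    have v: "\<bar>g * (1 - g)\<bar> \<le> 1" "\<bar>g * (1 - g) * (1 - 2 * g)\<bar> \<le> 1" "\<bar>(1 - 2 * g) * (1 - 2 * g)\<bar> \<le> 1" by (intro one b)+
    have "\<bar>2 * (g * (1 - g)) - (1 - 2 * g) * (1 - 2 * g)\<bar> \<le> 3" using v(1,3) by linarith
    then have v3: "\<bar>g * (1 - g) * (2 * (g * (1 - g)) - (1 - 2 * g) * (1 - 2 * g))\<bar> \<le> 1 * 3"
      unfolding abs_mult[of "g * (1 - g)"] using v(1) by (intro mult_mono) auto
    have bd: "\<bar>\<theta> ^ n * v\<bar> \<le> T * 3" if "n \<le> 3" "\<bar>v\<bar> \<le> 3" for n v
      unfolding abs_mult power_abs using pw[OF that(1)] that(2) T by (intro mult_mono) auto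
    show "\<bar>logistic (\<theta> * a + c)\<bar> \<le> T * 3 \<and> \<bar>- \<theta> * (logistic (\<theta> * a + c) * (1 - logistic (\<theta> * a + c)))\<bar> \<le> T * 3 \<and>
      \<bar>\<theta>\<^sup>2 * (logistic (\<theta> * a + c) * (1 - logistic (\<theta> * a + c)) * (1 - 2 * logistic (\<theta> * a + c)))\<bar> \<le> T * 3 \<and>
      \<bar>\<theta> ^ 3 * (logistic (\<theta> * a + c) * (1 - logistic (\<theta> * a + c)) *
       (2 * (logistic (\<theta> * a + c) * (1 - logistic (\<theta> * a + c))) - (1 - 2 * logistic (\<theta> * a + c)) * (1 - 2 * logistic (\<theta> * a + c))))\<bar> \<le> T * 3"
      unfolding g_def[symmetric]
      using bd[of 0 g] bd[of 1 "g * (1 - g)"] bd[of 2 "g * (1 - g) * (1 - 2 * g)"]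
        bd[of 3 "g * (1 - g) * (2 * (g * (1 - g)) - (1 - 2 * g) * (1 - 2 * g))"] b v v3
      by (simp add: abs_mult)
  qed
qed

section \<open>Two bounds for the relative phase\<close>

context phase_pair
begin

lemma gap_shift: "gap \<sigma> t \<omega> = gap 0 t \<omega> - \<sigma> * t"
  by (simp add: gap_def)

text \<open>The function \<open>exp (- \<nu> * a / 2)\<close> of the relative phase \<open>a\<close> decays in the mean at rate at least
  \<open>\<nu>\<^sup>2 / 4\<close>, since the generator acts on it as \<open>- \<nu>\<^sup>2 / 2 + s * \<nu>\<^sup>2 / 4\<close> with \<open>s \<le> 1\<close>. The logistic
  function replaces it by a bounded one on the whole line. Shifting it by \<open>ln (\<nu>\<^sup>2)\<close> keeps it so close
  to the exponential on \<open>a \<ge> 0\<close> that the rate loses only the factor \<open>\<nu>\<^sup>2 / (1 + \<nu>\<^sup>2)\<close>. Markov's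
  inequality at \<open>2 * \<pi>\<close> then costs the prefactor.\<close>

lemma prob_gap_small_upper:
  assumes \<nu>: "\<nu> = l1 - l0" "0 < \<nu>" and \<tau>: "0 \<le> \<tau>"
    and nonneg: "\<And>t. 0 \<le> t \<Longrightarrow> t \<le> \<tau> \<Longrightarrow> AE \<omega> in M. 0 \<le> gap 0 t \<omega>"
  shows "prob {\<omega> \<in> space M. gap 0 \<tau> \<omega> < 2 * pi} \<le>
    (1 + \<nu>\<^sup>2 * exp (pi * \<nu>)) * exp (- (\<nu> ^ 4 / (4 * (1 + \<nu>\<^sup>2))) * \<tau>)"
proof -
  define \<theta> where "\<theta> = \<nu> / 2"
  define c where "c = ln (\<nu>\<^sup>2)"
  define k where "k a = logistic (\<theta> * a + c)" for a
  define v where "v a = k a * (1 - k a)" for a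
  define K where "K = \<nu> ^ 4 / (4 * (1 + \<nu>\<^sup>2))"
  have \<nu>2: "0 < 1 + \<nu>\<^sup>2" by (simp add: add_pos_nonneg)
  have \<theta>0: "0 < \<theta>" using \<nu> by (simp add: \<theta>_def)
  have kv: "k a = 1 / (1 + exp (\<theta> * a) * \<nu>\<^sup>2)" for a
    using \<nu> by (simp add: k_def logistic_def exp_add c_def)
  have K: "K = \<nu>\<^sup>2 / 4 * (1 - k 0)"
    unfolding K_def kv using \<nu>2 by (simp add: field_simps power2_eq_square numeral_eq_Suc)
  have k01: "0 < k a" "k a < 1" for a unfolding k_def by (rule logistic_bounds)+
  have mono: "k b \<le> k a" if "a \<le> b" for a b
    unfolding k_def using that \<theta>0 by (intro logistic_antimono) auto
  have K0: "0 \<le> K" unfolding K_def by simp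
  define k1 where "k1 = (\<lambda>a. - \<theta> * (logistic (\<theta> * a + c) * (1 - logistic (\<theta> * a + c))))"
  define k2 where "k2 = (\<lambda>a. \<theta>\<^sup>2 * (logistic (\<theta> * a + c) * (1 - logistic (\<theta> * a + c)) * (1 - 2 * logistic (\<theta> * a + c))))"
  obtain k3 where kC: "bounded_C3 k k1 k2 k3"
    using bounded_C3_logistic[of \<theta> c] unfolding k_def[abs_def] k1_def k2_def by blast
  have "exp (- K * (\<tau> - 0)) * (\<integral>\<omega>. - 1 * k (gap 0 0 \<omega>) \<partial>M) \<le> (\<integral>\<omega>. - 1 * k (gap 0 \<tau> \<omega>) \<partial>M)"
  proof (rule expectation_growth[OF order_refl \<tau> K0 bounded_C3_const kC])
    fix t assume t: "0 \<le> t" "t \<le> \<tau>"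
    show "AE \<omega> in M. - K * (- 1 * k (gap 0 t \<omega>)) \<le> generator 0 0 (\<lambda>_. - 1) (\<lambda>_. 0) (\<lambda>_. 0) k k1 k2 t \<omega>"
      using nonneg[OF t]
    proof eventually_elim
      case (elim \<omega>)
      define a where "a = gap 0 t \<omega>"
      define s where "s = (1 - cos a) / 2"
      have s: "0 \<le> s" "s \<le> 1" unfolding s_def using cos_le_one[of a] cos_ge_minus_one[of a] by auto
      have v: "0 \<le> v a" unfolding v_def using k01[of a] by simp
      have "s * (1 - 2 * k a) \<le> 1" using s k01[of a] mult_mono[of s 1 "1 - 2 * k a" 1] 
      proof (cases "0 \<le> 1 - 2 * k a")
        case False
        then have "s * (1 - 2 * k a) \<le> 0" using s by (intro mult_nonneg_nonpos) auto
        then show ?thesis by simp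
      qed simp
      then have 1: "\<theta>\<^sup>2 * v a * (s * (1 - 2 * k a)) \<le> \<theta>\<^sup>2 * v a * 1" using v by (intro mult_left_mono) auto
      have "(1 - k 0) * k a \<le> v a" unfolding v_def using mono[of 0 a] elim k01[of a]
        by (subst mult.commute, intro mult_left_mono) (auto simp: a_def)
      then have "\<nu>\<^sup>2 / 4 * ((1 - k 0) * k a) \<le> \<nu>\<^sup>2 / 4 * v a" by (intro mult_left_mono) auto
      then have "K * k a \<le> \<nu>\<^sup>2 / 4 * v a" unfolding K by (simp add: mult.assoc)
      also have "\<dots> = \<nu> * \<theta> * v a - \<theta>\<^sup>2 * v a * 1" unfolding \<theta>_def by (simp add: power2_eq_square field_simps)
      also have "\<dots> \<le> \<nu> * \<theta> * v a - \<theta>\<^sup>2 * v a * (s * (1 - 2 * k a))" using 1 by simp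
      also have "\<dots> = generator 0 0 (\<lambda>_. - 1) (\<lambda>_. 0) (\<lambda>_. 0) k k1 k2 t \<omega>"
        unfolding generator_def a_def[symmetric] k1_def k2_def k_def[symmetric] v_def s_def \<nu>(1)
        by (simp add: field_simps)
      finally show ?case by (simp add: a_def)
    qed
  qed
  then have E: "(\<integral>\<omega>. k (gap 0 \<tau> \<omega>) \<partial>M) \<le> exp (- K * \<tau>) * (\<integral>\<omega>. k (gap 0 0 \<omega>) \<partial>M)" by simp
  have int: "integrable M (\<lambda>\<omega>. k (gap 0 t \<omega>))" if "0 \<le> t" for t
    using rbounded_integrable[OF that rbounded_generator(2)[OF that bounded_C3_const[of 1] kC]] by simp
  have "(\<integral>\<omega>. k (gap 0 0 \<omega>) \<partial>M) \<le> 1"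
    using k01 by (intro prob_space.integral_le_const[OF prob_space_axioms int]) (auto intro: less_imp_le)
  then have "exp (- K * \<tau>) * (\<integral>\<omega>. k (gap 0 0 \<omega>) \<partial>M) \<le> exp (- K * \<tau>) * 1"
    by (rule mult_left_mono) simp
  then have E1: "(\<integral>\<omega>. k (gap 0 \<tau> \<omega>) \<partial>M) \<le> exp (- K * \<tau>)" using E by linarith
  have [measurable]: "gap 0 \<tau> \<in> borel_measurable M" by (rule F_meas_M[OF \<tau> mid_gap_F(2)[OF \<tau>]])
  let ?A = "{\<omega> \<in> space M. gap 0 \<tau> \<omega> < 2 * pi}"
  have A: "?A \<in> sets M" by measurable
  have "k (2 * pi) * prob ?A = (\<integral>\<omega>. k (2 * pi) * indicator ?A \<omega> \<partial>M)" using A by simp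
  also have "\<dots> \<le> (\<integral>\<omega>. k (gap 0 \<tau> \<omega>) \<partial>M)"
  proof (rule integral_mono[OF _ int[OF \<tau>]])
    show "integrable M (\<lambda>\<omega>. k (2 * pi) * indicator ?A \<omega>)" using A by (intro integrable_mult_right integrable_real_indicator) (auto simp: emeasure_eq_measure)
    fix \<omega> assume "\<omega> \<in> space M"
    show "k (2 * pi) * indicator ?A \<omega> \<le> k (gap 0 \<tau> \<omega>)"
      using mono[of "gap 0 \<tau> \<omega>" "2 * pi"] k01(1)[of "gap 0 \<tau> \<omega>"] by (auto simp: indicator_def)
  qed
  finally have "k (2 * pi) * prob ?A \<le> exp (- K * \<tau>)" using E1 by linarith
  moreover have "k (2 * pi) = 1 / (1 + \<nu>\<^sup>2 * exp (pi * \<nu>))"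
    unfolding kv \<theta>_def by (simp add: mult.commute)
  moreover have "0 < 1 + \<nu>\<^sup>2 * exp (pi * \<nu>)" by (simp add: add_pos_nonneg)
  ultimately show ?thesis unfolding K_def by (simp add: field_simps)
qed

text \<open>The relative phase follows its drift from \<open>0\<close> up to \<open>\<pi>\<close> and is then held there. Meanwhile the mean
  phase is confined to an arc that moves with constant speed and arrives at \<open>\<pi>\<close> modulo \<open>2 * \<pi>\<close> at time
  \<open>\<tau>\<close>. Then half the relative phase is within \<open>1 / 2\<close> of \<open>\<pi> / 2\<close> and the mean phase within
  \<open>\<pi> / 3\<close> of an odd multiple of \<open>\<pi>\<close>. Both phases are closer than \<open>\<pi>\<close> to this multiple, because
  \<open>\<pi> / 2 + 1 / 2 + \<pi> / 3 < \<pi>\<close>, and hence lie between the adjacent multiples of \<open>2 * \<pi>\<close>. As the generator has no mixed derivative, the costs of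
  the two confinements add up.\<close>

lemma prob_gap_lower:
  assumes l: "l0 = 0" "l1 = \<nu>" and \<nu>: "1 \<le> \<nu>" "pi \<le> \<nu> * \<tau>" and \<tau>: "0 < \<tau>"
    and init: "AE \<omega> in M. \<theta>0 0 \<omega> = 0" "AE \<omega> in M. \<theta>1 0 \<omega> = 0"
    and K: "K = 11 + 2 * (pi / \<tau>)\<^sup>2"
  shows "exp (- (\<nu>\<^sup>2 / 4 + 12 * \<nu> + 1 + K) * \<tau> - \<nu> - 17 * pi) / (16 * \<nu> ^ 4) \<le>
    prob {\<omega> \<in> space M. \<exists>k::int. 2 * pi * of_int k < \<theta>0 \<tau> \<omega> \<and> \<theta>1 \<tau> \<omega> < 2 * pi * of_int k + 2 * pi}"
proof -
  define D where "D = 1 / \<nu>"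
  define \<theta> where "\<theta> = \<nu> / 2"
  have D: "0 < D" "D \<le> 1" unfolding D_def using \<nu> by auto
  have \<theta>: "0 < \<theta>" unfolding \<theta>_def using \<nu> by simp
  \<comment> \<open>of the speeds with \<open>\<rho> * \<tau>\<close> equal to \<open>\<pi>\<close> modulo \<open>2 * \<pi>\<close>, one that is nearest to the drift \<open>\<nu> / 2\<close> of the mean phase\<close>
  define j where "j = \<lfloor>\<nu> * \<tau> / (4 * pi)\<rfloor>"
  define \<rho> where "\<rho> = (pi + 2 * pi * of_int j) / \<tau>"
  define R where "R = pi / \<tau>"
  have \<rho>\<tau>: "\<rho> * \<tau> = pi + 2 * pi * of_int j" unfolding \<rho>_def using \<tau> by simp
  have r: "\<bar>\<nu> / 2 - \<rho>\<bar> \<le> R"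
  proof -
    have "of_int j \<le> \<nu> * \<tau> / (4 * pi)" "\<nu> * \<tau> / (4 * pi) < of_int j + 1" unfolding j_def by linarith+
    then have "of_int j * (4 * pi) \<le> \<nu> * \<tau>" "\<nu> * \<tau> < (of_int j + 1) * (4 * pi)"
      by (simp_all add: pos_le_divide_eq pos_divide_less_eq)
    then have "\<bar>\<nu> * \<tau> / 2 - (pi + 2 * pi * of_int j)\<bar> \<le> pi" by (simp add: abs_le_iff algebra_simps)
    moreover have "\<nu> * \<tau> / 2 - (pi + 2 * pi * of_int j) = (\<nu> / 2 - \<rho>) * \<tau>" using \<rho>\<tau> by (simp add: algebra_simps)
    ultimately have "\<bar>\<nu> / 2 - \<rho>\<bar> * \<tau> \<le> pi" using \<tau> by (simp add: abs_mult)
    then show ?thesis unfolding R_def using \<tau> by (simp add: pos_le_divide_eq)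
  qed
  have K0: "0 \<le> K" unfolding K by simp
  have K': "K = 11 + 2 * R\<^sup>2" unfolding K R_def ..
  define tilt where "tilt a = exp (- \<theta> * (a - pi)) * bump D (a - pi)" for a
  define t0 where "t0 = pi / \<nu>"
  have t0: "0 \<le> t0" "t0 \<le> \<tau>" "\<nu> * t0 = pi" unfolding t0_def using \<nu> by (auto simp: pos_divide_le_eq mult.commute)
  have half: "1 / 2 \<le> (1 + (1 + cos x) / 4) / 2 \<and> (1 + (1 + cos x) / 4) / 2 \<le> 3 / 4" for x :: real
  proof -
    have "1 / 2 \<le> (1 + (1 + c) / 4) / 2 \<and> (1 + (1 + c) / 4) / 2 \<le> 3 / 4" if "- 1 \<le> c" "c \<le> 1" for c :: real
      using that by (simp add: field_simps)
    then show ?thesis using cos_le_one[of x] cos_ge_minus_one[of x] by blast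
  qed
  have bumpC: "bounded_C3 (bump D) (bump1 D) (bump2 D) (bump3 D)"
    using bounded_C3_tilted_bump[OF D(2), of 0] by simp
  \<comment> \<open>until time \<open>t0\<close> the relative phase is confined in the frame that moves with its drift\<close>
  \<comment> \<open>and so arrives near \<open>\<pi>\<close>\<close>
  have phase1: "exp (- (K + 17 * \<nu>) * (t0 - 0)) * (\<integral>\<omega>. cosbump (mid \<rho> 0 \<omega>) * bump D (gap \<nu> 0 \<omega>) \<partial>M) \<le>
     (\<integral>\<omega>. cosbump (mid \<rho> t0 \<omega>) * bump D (gap \<nu> t0 \<omega>) \<partial>M)"
  proof (rule expectation_growth[OF order_refl t0(1) _ bounded_C3_cosbump bumpC])
    show "0 \<le> K + 17 * \<nu>" using K0 \<nu> by simp
    fix t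
    show "AE \<omega> in M. - (K + 17 * \<nu>) * (cosbump (mid \<rho> t \<omega>) * bump D (gap \<nu> t \<omega>)) \<le>
        generator \<rho> \<nu> cosbump cosbump1 cosbump2 (bump D) (bump1 D) (bump2 D) t \<omega>"
    proof (rule AE_I2)
      fix \<omega>
      define c where "c = cos (gap 0 t \<omega>)"
      define x where "x = mid \<rho> t \<omega>"
      define y where "y = gap \<nu> t \<omega>"
      have c: "- 1 \<le> c" "c \<le> 1" unfolding c_def by auto
      have 1: "- K * cosbump x \<le> (\<nu> / 2 - \<rho>) * cosbump1 x + ((1 + (1 + c) / 4) / 2) * cosbump2 x"
        unfolding K' c_def using half by (intro cosbump_subsolution r) auto
      have 2: "- (17 * \<nu>) * bump D y \<le> ((1 - c) / 2) * bump2 D y"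
        using bump_subsolution[OF D(1), of "(1 - c) / 2" y] c unfolding D_def by simp
      have "- (K + 17 * \<nu>) * (cosbump x * bump D y) = (- K * cosbump x) * bump D y + cosbump x * (- (17 * \<nu>) * bump D y)"
        by (simp add: algebra_simps)
      also have "\<dots> \<le> ((\<nu> / 2 - \<rho>) * cosbump1 x + ((1 + (1 + c) / 4) / 2) * cosbump2 x) * bump D y + cosbump x * (((1 - c) / 2) * bump2 D y)"
        by (intro add_mono mult_right_mono mult_left_mono 1 2 bump_bounds cosbump_bounds D)
      also have "\<dots> = generator \<rho> \<nu> cosbump cosbump1 cosbump2 (bump D) (bump1 D) (bump2 D) t \<omega>"
        unfolding generator_def unfolding l x_def[symmetric] y_def[symmetric] c_def[symmetric] by (simp add: field_simps)
      finally show "- (K + 17 * \<nu>) * (cosbump (mid \<rho> t \<omega>) * bump D (gap \<nu> t \<omega>)) \<le>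
        generator \<rho> \<nu> cosbump cosbump1 cosbump2 (bump D) (bump1 D) (bump2 D) t \<omega>" unfolding x_def y_def .
    qed
  qed
  define tilt1 where "tilt1 = (\<lambda>a. exp (- \<theta> * (a - pi)) * (bump1 D (a - pi) - \<theta> * bump D (a - pi)))"
  define tilt2 where "tilt2 = (\<lambda>a. exp (- \<theta> * (a - pi)) * (bump2 D (a - pi) - 2 * \<theta> * bump1 D (a - pi) + \<theta>\<^sup>2 * bump D (a - pi)))"
  obtain tilt3 where tiltC: "bounded_C3 tilt tilt1 tilt2 tilt3"
    using bounded_C3_shift[OF bounded_C3_tilted_bump[OF D(2), of \<theta>], of pi] unfolding tilt_def[abs_def] tilt1_def tilt2_def by blast
  have tilt_nn: "0 \<le> tilt a" for a unfolding tilt_def using bump_bounds(1)[OF D(2)] by simp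
  define E where "E = \<nu>\<^sup>2 / 4 + 12 * \<nu> + 1"
  have E0: "0 \<le> E" unfolding E_def using \<nu> by simp
  \<comment> \<open>from time \<open>t0\<close> on the relative phase is held near \<open>\<pi>\<close>\<close>
  have phase2: "exp (- (K + E) * (\<tau> - t0)) * (\<integral>\<omega>. cosbump (mid \<rho> t0 \<omega>) * tilt (gap 0 t0 \<omega>) \<partial>M) \<le>
     (\<integral>\<omega>. cosbump (mid \<rho> \<tau> \<omega>) * tilt (gap 0 \<tau> \<omega>) \<partial>M)"
  proof (rule expectation_growth[OF t0(1,2) _ bounded_C3_cosbump tiltC])
    show "0 \<le> K + E" using K0 E0 by simp
    fix t
    show "AE \<omega> in M. - (K + E) * (cosbump (mid \<rho> t \<omega>) * tilt (gap 0 t \<omega>)) \<le>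
        generator \<rho> 0 cosbump cosbump1 cosbump2 tilt tilt1 tilt2 t \<omega>"
    proof (rule AE_I2)
      fix \<omega>
      define x where "x = mid \<rho> t \<omega>"
      define y where "y = gap 0 t \<omega>"
      define c where "c = cos y"
      have 1: "- K * cosbump x \<le> (\<nu> / 2 - \<rho>) * cosbump1 x + ((1 + (1 + c) / 4) / 2) * cosbump2 x"
        unfolding K' c_def using half by (intro cosbump_subsolution r) auto
      have "(1 - c) / 2 = (1 + cos (y - pi)) / 2" unfolding c_def by (simp add: cos_diff)
      from tilted_bump_subsolution[OF \<nu>(1) this D_def \<theta>_def]
      have 2: "- E * tilt y \<le> \<nu> * tilt1 y + ((1 - c) / 2) * tilt2 y"
        unfolding E_def tilt_def tilt1_def tilt2_def .
      have "- (K + E) * (cosbump x * tilt y) = (- K * cosbump x) * tilt y + cosbump x * (- E * tilt y)"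
        by (simp add: algebra_simps)
      also have "\<dots> \<le> ((\<nu> / 2 - \<rho>) * cosbump1 x + ((1 + (1 + c) / 4) / 2) * cosbump2 x) * tilt y + cosbump x * (\<nu> * tilt1 y + ((1 - c) / 2) * tilt2 y)"
        by (intro add_mono mult_right_mono mult_left_mono 1 2 tilt_nn cosbump_bounds)
      also have "\<dots> = generator \<rho> 0 cosbump cosbump1 cosbump2 tilt tilt1 tilt2 t \<omega>"
        unfolding generator_def unfolding l x_def[symmetric] y_def[symmetric] c_def[symmetric] by (simp add: field_simps)
      finally show "- (K + E) * (cosbump (mid \<rho> t \<omega>) * tilt (gap 0 t \<omega>)) \<le>
        generator \<rho> 0 cosbump cosbump1 cosbump2 tilt tilt1 tilt2 t \<omega>" unfolding x_def y_def .
    qed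
  qed
  have inside: "\<bar>z\<bar> \<le> 1" if "bump D z \<noteq> 0" for z
  proof (rule ccontr)
    assume "\<not> \<bar>z\<bar> \<le> 1"
    then have "1 \<le> z\<^sup>2" using power_mono[of 1 "\<bar>z\<bar>" 2] by simp
    then show False using bump_outside[of D z] D that by simp
  qed
  have tilt_lower: "exp (- \<theta>) * bump D (a - pi) \<le> tilt a" for a
  proof (cases "bump D (a - pi) = 0")
    case False
    then have "\<theta> * (a - pi) \<le> \<theta> * 1" using inside[OF False] \<theta> by (intro mult_left_mono) auto
    then show ?thesis unfolding tilt_def using bump_bounds(1)[OF D(2)] by (intro mult_right_mono) auto
  qed (simp add: tilt_def)
  have tilt_upper: "tilt a \<le> exp \<theta>" for a
  proof (cases "bump D (a - pi) = 0")
    case False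
    then have "\<theta> * (- 1) \<le> \<theta> * (a - pi)" using inside[OF False] \<theta> by (intro mult_left_mono) auto
    then have "tilt a \<le> exp \<theta> * 1" unfolding tilt_def using bump_bounds[OF D(2)] by (intro mult_mono) auto
    then show ?thesis by simp
  qed (simp add: tilt_def)
  note int1 = rbounded_integrable[OF _ rbounded_generator(2)[OF _ bounded_C3_cosbump bumpC]]
  note int2 = rbounded_integrable[OF _ rbounded_generator(2)[OF _ bounded_C3_cosbump tiltC]]
  have middle: "exp (- \<theta>) * (\<integral>\<omega>. cosbump (mid \<rho> t0 \<omega>) * bump D (gap \<nu> t0 \<omega>) \<partial>M) \<le> (\<integral>\<omega>. cosbump (mid \<rho> t0 \<omega>) * tilt (gap 0 t0 \<omega>) \<partial>M)"
  proof -
    have "exp (- \<theta>) * (\<integral>\<omega>. cosbump (mid \<rho> t0 \<omega>) * bump D (gap \<nu> t0 \<omega>) \<partial>M) = (\<integral>\<omega>. exp (- \<theta>) * (cosbump (mid \<rho> t0 \<omega>) * bump D (gap \<nu> t0 \<omega>)) \<partial>M)"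
      by simp
    also have "\<dots> \<le> (\<integral>\<omega>. cosbump (mid \<rho> t0 \<omega>) * tilt (gap 0 t0 \<omega>) \<partial>M)"
    proof (rule integral_mono[OF integrable_mult_right[OF int1[OF t0(1) t0(1)]] int2[OF t0(1) t0(1)]])
      fix \<omega>
      have "cosbump (mid \<rho> t0 \<omega>) * (exp (- \<theta>) * bump D (gap 0 t0 \<omega> - pi)) \<le> cosbump (mid \<rho> t0 \<omega>) * tilt (gap 0 t0 \<omega>)"
        by (intro mult_left_mono tilt_lower cosbump_bounds)
      then show "exp (- \<theta>) * (cosbump (mid \<rho> t0 \<omega>) * bump D (gap \<nu> t0 \<omega>)) \<le> cosbump (mid \<rho> t0 \<omega>) * tilt (gap 0 t0 \<omega>)"
        unfolding gap_shift[of \<nu>] t0(3) by (simp add: mult_ac)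
    qed
    finally show ?thesis .
  qed
  \<comment> \<open>both processes start at \<open>0\<close>, where the bumps have the values \<open>(1 / 2) ^ 4\<close> and \<open>D ^ 4\<close>\<close>
  have start: "(\<integral>\<omega>. cosbump (mid \<rho> 0 \<omega>) * bump D (gap \<nu> 0 \<omega>) \<partial>M) = 1 / (16 * \<nu> ^ 4)"
  proof -
    have "AE \<omega> in M. cosbump (mid \<rho> 0 \<omega>) * bump D (gap \<nu> 0 \<omega>) = 1 / (16 * \<nu> ^ 4)"
      using init
    proof eventually_elim
      case (elim \<omega>)
      then have "mid \<rho> 0 \<omega> = 0" "gap \<nu> 0 \<omega> = 0" by (simp_all add: mid_def gap_def)
      then show ?case using D by (simp add: cosbump_def bump_def D_def power_divide)
    qed
    then have "(\<integral>\<omega>. cosbump (mid \<rho> 0 \<omega>) * bump D (gap \<nu> 0 \<omega>) \<partial>M) = (\<integral>\<omega>. 1 / (16 * \<nu> ^ 4) \<partial>M)"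
      by (intro integral_cong_AE borel_measurable_integrable[OF int1]) auto
    then show ?thesis by (simp add: prob_space)
  qed
  let ?A = "{\<omega> \<in> space M. \<exists>k::int. 2 * pi * of_int k < \<theta>0 \<tau> \<omega> \<and> \<theta>1 \<tau> \<omega> < 2 * pi * of_int k + 2 * pi}"
  have [measurable]: "\<theta>0 \<tau> \<in> borel_measurable M" "\<theta>1 \<tau> \<in> borel_measurable M"
    using phase_F[of \<tau>] F_meas_M[of \<tau>] \<tau> by auto
  have A: "?A \<in> sets M" by measurable
  have ind: "cosbump (mid \<rho> \<tau> \<omega>) * tilt (gap 0 \<tau> \<omega>) \<le> exp \<theta> * indicator ?A \<omega>" if \<omega>: "\<omega> \<in> space M" for \<omega>
  proof (cases "cosbump (mid \<rho> \<tau> \<omega>) = 0 \<or> bump D (gap 0 \<tau> \<omega> - pi) = 0")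
    case False
    have z: "\<bar>gap 0 \<tau> \<omega> - pi\<bar> \<le> 1" using inside False by blast
    define m where "m = (\<theta>0 \<tau> \<omega> + \<theta>1 \<tau> \<omega>) / 2"
    have mid: "mid \<rho> \<tau> \<omega> = m - pi - 2 * pi * of_int j" unfolding mid_def m_def \<rho>\<tau> by simp
    have "1 / 2 < cos (mid \<rho> \<tau> \<omega>)" using False unfolding cosbump_def by (auto simp: max_def split: if_splits)
    \<comment> \<open>the mean phase lies within \<open>\<pi> / 3\<close> of \<open>\<pi>\<close> modulo \<open>2 * \<pi>\<close>\<close>
    obtain i :: int where i: "\<bar>mid \<rho> \<tau> \<omega> - 2 * pi * of_int i\<bar> < pi / 3"
    proof -
      define i where "i = \<lfloor>(mid \<rho> \<tau> \<omega> + pi) / (2 * pi)\<rfloor>"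
      define u where "u = mid \<rho> \<tau> \<omega> - 2 * pi * of_int i"
      have "of_int i \<le> (mid \<rho> \<tau> \<omega> + pi) / (2 * pi)" "(mid \<rho> \<tau> \<omega> + pi) / (2 * pi) < of_int i + 1" unfolding i_def by linarith+
      then have "of_int i * (2 * pi) \<le> mid \<rho> \<tau> \<omega> + pi" "mid \<rho> \<tau> \<omega> + pi < (of_int i + 1) * (2 * pi)"
        by (simp_all add: pos_le_divide_eq pos_divide_less_eq)
      then have u: "\<bar>u\<bar> \<le> pi" unfolding u_def by (simp add: abs_le_iff algebra_simps)
      have "cos \<bar>u\<bar> = cos (mid \<rho> \<tau> \<omega>)"
        unfolding u_def cos_abs_real using cos_int_2pin[of i] sin_int_2pin[of i] by (simp add: cos_diff)
      then have "cos (pi / 3) < cos \<bar>u\<bar>" using \<open>1 / 2 < cos (mid \<rho> \<tau> \<omega>)\<close> by (simp add: cos_60)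
      then have "\<bar>u\<bar> < pi / 3" using u by (subst (asm) cos_mono_less_eq) auto
      then show ?thesis using that[of i] unfolding u_def by simp
    qed
    have "2 * pi * of_int (i + j) < \<theta>0 \<tau> \<omega> \<and> \<theta>1 \<tau> \<omega> < 2 * pi * of_int (i + j) + 2 * pi"
    proof -
      have g: "\<theta>0 \<tau> \<omega> = m - gap 0 \<tau> \<omega> / 2" "\<theta>1 \<tau> \<omega> = m + gap 0 \<tau> \<omega> / 2" unfolding m_def gap_def by (simp_all add: field_simps)
      have "2 * pi * of_int (i + j) = 2 * pi * of_int i + 2 * pi * of_int j" by (simp add: algebra_simps)
      moreover have "- (pi / 3) < m - pi - 2 * pi * of_int j - 2 * pi * of_int i" "m - pi - 2 * pi * of_int j - 2 * pi * of_int i < pi / 3"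
        using i unfolding mid abs_less_iff by linarith+
      moreover have "gap 0 \<tau> \<omega> - pi \<le> 1" "- (gap 0 \<tau> \<omega> - pi) \<le> 1" using z unfolding abs_le_iff by auto
      ultimately show ?thesis using pi_gt3 unfolding g by linarith
    qed
    then have "\<omega> \<in> ?A" using \<omega> by blast
    then show ?thesis
      using mult_mono[OF cosbump_bounds(2) tilt_upper zero_le_one tilt_nn] by simp
  qed (auto simp: tilt_def)
  have "(\<integral>\<omega>. cosbump (mid \<rho> \<tau> \<omega>) * tilt (gap 0 \<tau> \<omega>) \<partial>M) \<le> (\<integral>\<omega>. exp \<theta> * indicator ?A \<omega> \<partial>M)"
  proof (rule integral_mono[OF int2 _ ind])
    show "integrable M (\<lambda>\<omega>. exp \<theta> * indicator ?A \<omega>)"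
      using A by (intro integrable_mult_right integrable_real_indicator) (auto simp: emeasure_eq_measure)
  qed (use \<tau> in auto)
  also have "\<dots> = exp \<theta> * prob ?A" using A by simp
  finally have final: "(\<integral>\<omega>. cosbump (mid \<rho> \<tau> \<omega>) * tilt (gap 0 \<tau> \<omega>) \<partial>M) \<le> exp \<theta> * prob ?A" .
  have "exp (- (K + E) * (\<tau> - t0)) * (exp (- \<theta>) * (exp (- (K + 17 * \<nu>) * (t0 - 0)) * (1 / (16 * \<nu> ^ 4)))) \<le>
      exp (- (K + E) * (\<tau> - t0)) * (\<integral>\<omega>. cosbump (mid \<rho> t0 \<omega>) * tilt (gap 0 t0 \<omega>) \<partial>M)"
    using order_trans[OF mult_left_mono[OF phase1] middle] unfolding start by (intro mult_left_mono) auto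
  also have "\<dots> \<le> exp \<theta> * prob ?A" using phase2 final by linarith
  finally have "exp (- \<theta>) * (exp (- (K + E) * (\<tau> - t0)) * (exp (- \<theta>) * (exp (- (K + 17 * \<nu>) * (t0 - 0)) * (1 / (16 * \<nu> ^ 4))))) \<le>
     exp (- \<theta>) * (exp \<theta> * prob ?A)" by (rule mult_left_mono) simp
  also have "exp (- \<theta>) * (exp \<theta> * prob ?A) = prob ?A" by (simp add: mult.assoc[symmetric] exp_add[symmetric])
  also have "exp (- \<theta>) * (exp (- (K + E) * (\<tau> - t0)) * (exp (- \<theta>) * (exp (- (K + 17 * \<nu>) * (t0 - 0)) * (1 / (16 * \<nu> ^ 4))))) =
     exp (- \<theta> + (- (K + E) * (\<tau> - t0)) + - \<theta> + (- (K + 17 * \<nu>) * (t0 - 0))) / (16 * \<nu> ^ 4)"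
    by (simp only: exp_add mult.assoc times_divide_eq_right mult_1_right)
  finally have *: "exp (- \<theta> + (- (K + E) * (\<tau> - t0)) + - \<theta> + (- (K + 17 * \<nu>) * (t0 - 0))) / (16 * \<nu> ^ 4) \<le> prob ?A" .
  have "- (\<nu>\<^sup>2 / 4 + 12 * \<nu> + 1 + K) * \<tau> - \<nu> - 17 * pi \<le> - \<theta> + (- (K + E) * (\<tau> - t0)) + - \<theta> + (- (K + 17 * \<nu>) * (t0 - 0))"
  proof -
    have "- \<theta> + (- (K + E) * (\<tau> - t0)) + - \<theta> + (- (K + 17 * \<nu>) * (t0 - 0)) = - (E + K) * \<tau> + E * t0 - \<nu> - 17 * (\<nu> * t0)"
      unfolding \<theta>_def by (simp add: field_simps)
    moreover have "0 \<le> E * t0" using E0 t0 by simp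
    ultimately show ?thesis unfolding t0(3) E_def by simp
  qed
  then have "exp (- (\<nu>\<^sup>2 / 4 + 12 * \<nu> + 1 + K) * \<tau> - \<nu> - 17 * pi) / (16 * \<nu> ^ 4) \<le>
    exp (- \<theta> + (- (K + E) * (\<tau> - t0)) + - \<theta> + (- (K + 17 * \<nu>) * (t0 - 0))) / (16 * \<nu> ^ 4)"
    by (intro divide_right_mono) auto
  then show ?thesis using * by linarith
qed

end

section \<open>Asymptotics of the exponents\<close>

lemma lower_exponent_limit:
  fixes \<tau> K :: real assumes \<tau>: "0 < \<tau>"
  shows "((\<lambda>\<nu>. ((\<nu>\<^sup>2 / 4 + 12 * \<nu> + 1 + K) * \<tau> + \<nu> + 17 * pi + ln (16 * \<nu> ^ 4)) * (4 / (\<tau> * \<nu>\<^sup>2)) - 1) \<longlongrightarrow> 0) at_top"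
proof -
  have a: "((\<lambda>x::real. x / x\<^sup>2) \<longlongrightarrow> 0) at_top" "((\<lambda>x::real. 1 / x\<^sup>2) \<longlongrightarrow> 0) at_top"
    "((\<lambda>x::real. ln (16 * x ^ 4) / x\<^sup>2) \<longlongrightarrow> 0) at_top"
    by real_asymp+
  have lim: "((\<lambda>x. (48 + 4 / \<tau>) * (x / x\<^sup>2) + (4 * (1 + K) + 68 * pi / \<tau>) * (1 / x\<^sup>2) + (4 / \<tau>) * (ln (16 * x ^ 4) / x\<^sup>2))
      \<longlongrightarrow> (48 + 4 / \<tau>) * 0 + (4 * (1 + K) + 68 * pi / \<tau>) * 0 + (4 / \<tau>) * 0) at_top"
    by (intro tendsto_add tendsto_mult tendsto_const a)
  have ev: "\<forall>\<^sub>F x in at_top. (48 + 4 / \<tau>) * (x / x\<^sup>2) + (4 * (1 + K) + 68 * pi / \<tau>) * (1 / x\<^sup>2) + (4 / \<tau>) * (ln (16 * x ^ 4) / x\<^sup>2) =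
      ((x\<^sup>2 / 4 + 12 * x + 1 + K) * \<tau> + x + 17 * pi + ln (16 * x ^ 4)) * (4 / (\<tau> * x\<^sup>2)) - 1"
    using eventually_gt_at_top[of 0]
  proof eventually_elim
    case (elim x)
    then show ?case using \<tau> by (simp add: field_simps)
  qed
  show ?thesis
    using Lim_transform_eventually[OF lim ev] unfolding mult_zero_right add_0_right diff_0_right diff_self .
qed

lemma upper_exponent_limit:
  fixes \<tau> :: real assumes \<tau>: "0 < \<tau>"
  shows "((\<lambda>\<nu>. (\<nu> ^ 4 / (4 * (1 + \<nu>\<^sup>2)) * \<tau> - ln (1 + \<nu>\<^sup>2 * exp (4 * \<nu>))) * (4 / (\<tau> * \<nu>\<^sup>2)) - 1) \<longlongrightarrow> 0) at_top"
proof -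
  have a: "((\<lambda>x::real. x ^ 4 / (1 + x\<^sup>2) / x\<^sup>2) \<longlongrightarrow> 1) at_top" "((\<lambda>x::real. ln (1 + x\<^sup>2 * exp (4 * x)) / x\<^sup>2) \<longlongrightarrow> 0) at_top"
    by real_asymp+
  have lim: "((\<lambda>x. x ^ 4 / (1 + x\<^sup>2) / x\<^sup>2 - (4 / \<tau>) * (ln (1 + x\<^sup>2 * exp (4 * x)) / x\<^sup>2) - 1) \<longlongrightarrow> 1 - (4 / \<tau>) * 0 - 1) at_top"
    by (intro tendsto_diff tendsto_mult tendsto_const a)
  have ev: "\<forall>\<^sub>F x in at_top. x ^ 4 / (1 + x\<^sup>2) / x\<^sup>2 - (4 / \<tau>) * (ln (1 + x\<^sup>2 * exp (4 * x)) / x\<^sup>2) - 1 =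
      (x ^ 4 / (4 * (1 + x\<^sup>2)) * \<tau> - ln (1 + x\<^sup>2 * exp (4 * x))) * (4 / (\<tau> * x\<^sup>2)) - 1"
    using eventually_gt_at_top[of 0]
  proof eventually_elim
    case (elim x)
    define N where "N = 1 + x\<^sup>2"
    define L where "L = ln (1 + x\<^sup>2 * exp (4 * x))"
    have "0 < N" unfolding N_def by (simp add: add_pos_nonneg)
    then show ?case using \<tau> elim unfolding N_def[symmetric] L_def[symmetric] by (simp add: field_simps)
  qed
  show ?thesis
    using Lim_transform_eventually[OF lim ev] unfolding mult_zero_right add_0_right diff_0_right diff_self .
qed

section \<open>The gap of the point process\<close>

lemma real_analytic_continuous:
  assumes "real_analytic f" shows "continuous_on UNIV f"
proof -
  have "isCont f x" for x
  proof -
    obtain r a where r: "r > 0" and s: "\<And>y. \<bar>y - x\<bar> < r \<Longrightarrow> (\<lambda>n. a n * (y - x) ^ n) sums f y"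
      using assms unfolding real_analytic_def by blast
    define g where "g h = (\<Sum>n. a n * h ^ n)" for h :: real
    have fg: "f (x + h) = g h" if "\<bar>h\<bar> < r" for h
      using s[of "x + h"] that unfolding g_def by (simp add: sums_unique)
    have "isCont g 0"
      unfolding g_def
    proof (rule isCont_powser)
      show "summable (\<lambda>n. a n * (r / 2) ^ n)" using s[of "x + r / 2"] r by (auto simp: sums_iff)
      show "norm (0::real) < norm (r / 2)" using r by simp
    qed
    then have "g \<midarrow>0\<rightarrow> g 0" by (simp add: isCont_def)
    moreover have "\<forall>\<^sub>F h in at 0. g h = f (x + h)"
      using eventually_at_in_open'[of "{-r<..<r}" 0] r by (auto elim!: eventually_mono simp: fg)
    ultimately have "(\<lambda>h. f (x + h)) \<midarrow>0\<rightarrow> g 0" by (rule Lim_transform_eventually)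
    then show "isCont f x" using fg[of 0] r by (simp add: isCont_iff)
  qed
  then show ?thesis by (simp add: continuous_on_eq_continuous_at)
qed

text \<open>As the parameter increases, the phase runs through all values between its end values, so it avoids the
  multiples of \<open>2 * \<pi>\<close> exactly when its end values lie strictly between two consecutive ones.\<close>

lemma Sch_count_eq_0_iff:
  assumes mono: "strict_mono (\<lambda>l. \<phi> l \<tau> \<omega>)" and cont: "continuous_on UNIV (\<lambda>l. \<phi> l \<tau> \<omega>)"
    and \<tau>: "0 < \<tau>" and l: "0 < l"
  shows "Sch_count \<phi> \<tau> 0 l \<omega> = 0 \<longleftrightarrow>
    (\<exists>k::int. 2 * pi * of_int k < \<phi> 0 \<tau> \<omega> \<and> \<phi> (l / \<tau>) \<tau> \<omega> < 2 * pi * of_int k + 2 * pi)"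
proof -
  define f where "f x = \<phi> x \<tau> \<omega>" for x
  have f_mono: "f x \<le> f y" if "x \<le> y" for x y
    using mono that unfolding f_def strict_mono_def by (cases "x = y") (auto simp: less_le)
  have "Sch_count \<phi> \<tau> 0 l \<omega> = 0 \<longleftrightarrow> Sch \<phi> \<tau> \<omega> \<inter> {0..l} = {}"
    unfolding Sch_count_def by (simp add: emeasure_count_space_eq_0)
  also have "\<dots> \<longleftrightarrow> (\<forall>x\<in>{0..l}. \<forall>k::int. f (x / \<tau>) \<noteq> 2 * pi * of_int k)"
    unfolding Sch_def f_def by auto
  also have "\<dots> \<longleftrightarrow> (\<exists>k::int. 2 * pi * of_int k < f 0 \<and> f (l / \<tau>) < 2 * pi * of_int k + 2 * pi)"
  proof
    assume none: "\<forall>x\<in>{0..l}. \<forall>k::int. f (x / \<tau>) \<noteq> 2 * pi * of_int k"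
    define k where "k = \<lfloor>f 0 / (2 * pi)\<rfloor>"
    have "of_int k \<le> f 0 / (2 * pi)" "f 0 / (2 * pi) < of_int k + 1" unfolding k_def by linarith+
    then have k: "2 * pi * of_int k \<le> f 0" "f 0 < 2 * pi * of_int k + 2 * pi"
      by (simp_all add: pos_le_divide_eq pos_divide_less_eq algebra_simps)
    have "0 \<in> {0..l}" using l by simp
    then have "f (0 / \<tau>) \<noteq> 2 * pi * of_int k" using none by blast
    then have k0: "2 * pi * of_int k < f 0" using k(1) by simp
    have "f (l / \<tau>) < 2 * pi * of_int k + 2 * pi"
    proof (rule ccontr)
      assume "\<not> f (l / \<tau>) < 2 * pi * of_int k + 2 * pi"
      moreover have "continuous_on {0..l / \<tau>} f" using cont unfolding f_def by (rule continuous_on_subset) simp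
      ultimately obtain x where x: "0 \<le> x" "x \<le> l / \<tau>" "f x = 2 * pi * of_int k + 2 * pi"
        using IVT'[of f 0 "2 * pi * of_int k + 2 * pi" "l / \<tau>"] k(2) l \<tau> by auto
      have "x * \<tau> \<in> {0..l}" using x \<tau> by (simp add: pos_le_divide_eq)
      then have "f (x * \<tau> / \<tau>) \<noteq> 2 * pi * of_int (k + 1)" using none by blast
      then show False using x(3) \<tau> by (simp add: algebra_simps)
    qed
    then show "\<exists>k::int. 2 * pi * of_int k < f 0 \<and> f (l / \<tau>) < 2 * pi * of_int k + 2 * pi" using k0 by blast
  next
    assume "\<exists>k::int. 2 * pi * of_int k < f 0 \<and> f (l / \<tau>) < 2 * pi * of_int k + 2 * pi"
    then obtain k :: int where k: "2 * pi * of_int k < f 0" "f (l / \<tau>) < 2 * pi * of_int k + 2 * pi" by blast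
    show "\<forall>x\<in>{0..l}. \<forall>k::int. f (x / \<tau>) \<noteq> 2 * pi * of_int k"
    proof (intro ballI allI notI)
      fix x and j :: int assume x: "x \<in> {0..l}" and j: "f (x / \<tau>) = 2 * pi * of_int j"
      have "f 0 \<le> f (x / \<tau>)" "f (x / \<tau>) \<le> f (l / \<tau>)" using x \<tau> by (auto intro!: f_mono divide_right_mono)
      then have 1: "2 * pi * of_int k < 2 * pi * of_int j" and 2: "2 * pi * of_int j < 2 * pi * of_int k + 2 * pi"
        unfolding j using k by linarith+
      have "2 * pi * of_int k + 2 * pi = 2 * pi * of_int (k + 1)" by (simp add: algebra_simps)
      with 2 have 2: "2 * pi * of_int j < 2 * pi * of_int (k + 1)" by simp
      have "k < j" "j < k + 1"
        using mult_less_cancel_left_pos[of "2 * pi" "of_int k" "of_int j"] 1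
          mult_less_cancel_left_pos[of "2 * pi" "of_int j" "of_int (k + 1)"] 2 unfolding of_int_less_iff by simp_all
      then show False by simp
    qed
  qed
  finally show ?thesis unfolding f_def .
qed

lemma measure_completion_eq_AE:
  assumes A: "A \<in> sets M" and eq: "AE \<omega> in M. \<omega> \<in> A \<longleftrightarrow> P \<omega>"
  shows "{\<omega> \<in> space M. P \<omega>} \<in> sets (completion M)" "measure (completion M) {\<omega> \<in> space M. P \<omega>} = measure M A"
proof -
  obtain N where N: "N \<in> null_sets M" "{\<omega> \<in> space M. \<not> (\<omega> \<in> A \<longleftrightarrow> P \<omega>)} \<subseteq> N"
    using eq unfolding eventually_ae_filter by auto
  have "A \<subseteq> space M" using A by (rule sets.sets_into_space)
  then have split: "{\<omega> \<in> space M. P \<omega>} = (A - N) \<union> ({\<omega> \<in> space M. P \<omega>} \<inter> N)" using N(2) by auto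
  have "A - N \<in> sets M" using A N(1) by auto
  then show E: "{\<omega> \<in> space M. P \<omega>} \<in> sets (completion M)"
    using N(1) by (intro sets_completionI[OF split]) auto
  have "AE \<omega> in completion M. \<omega> \<in> {\<omega> \<in> space M. P \<omega>} \<longleftrightarrow> \<omega> \<in> A"
    using AE_completion[OF eq] AE_space[of "completion M"] by eventually_elim auto
  then have "emeasure (completion M) {\<omega> \<in> space M. P \<omega>} = emeasure (completion M) A"
    using A by (intro emeasure_eq_AE E) auto
  then show "measure (completion M) {\<omega> \<in> space M. P \<omega>} = measure M A"
    using A by (simp add: measure_def)
qed

lemma schroedinger_phase_pair:
  assumes S: "schroedinger_phase M B B2 B3 \<phi>"
  shows "phase_pair M (aug_filtration M [B, B2, B3]) (\<lambda>i. [B, B2, B3] ! i) l0 l1 (\<phi> l0) (\<phi> l1)"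
proof -
  note ind = schroedinger_phase.independent[OF S]
  interpret prob_space M
    using ind unfolding independent_brownian_motions_def brownian_motion_def by auto
  interpret driving_noise M "aug_filtration M [B, B2, B3]" "\<lambda>i. [B, B2, B3] ! i"
    using brownian_noise_aug_filtration[OF ind] by (simp add: driving_noise_def numeral_3_eq_3)
  have W: "noiseW = (\<lambda>t \<omega>. (complex_of_real (B2 t \<omega>) + \<i> * complex_of_real (B3 t \<omega>)) / complex_of_real (sqrt 2))"
    by (auto simp: fun_eq_iff planar_noise_def numeral_2_eq_2)
  have "is_phase l (\<phi> l)" for l
    unfolding is_phase_def W
    using schroedinger_phase.adapted[OF S] schroedinger_phase.continuous[OF S] schroedinger_phase.sde[OF S]
    by simp
  then show ?thesis by unfold_locales
qed

text \<open>The regularity of the phase in its parameter fails at most on a null set, which the completion absorbs.\<close>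

lemma gap_event_probability:
  assumes S: "schroedinger_phase M B B2 B3 \<phi>" and \<tau>: "0 < \<tau>" and l: "0 < l"
  defines "A \<equiv> {\<omega> \<in> space M. \<exists>k::int. 2 * pi * of_int k < \<phi> 0 \<tau> \<omega> \<and> \<phi> (l / \<tau>) \<tau> \<omega> < 2 * pi * of_int k + 2 * pi}"
  shows "A \<in> sets M" "{\<omega> \<in> space M. Sch_count \<phi> \<tau> 0 l \<omega> = 0} \<in> sets (completion M)"
    "Sch_gap_prob M \<phi> \<tau> l = measure M A"
proof -
  interpret phase_pair M "aug_filtration M [B, B2, B3]" "\<lambda>i. [B, B2, B3] ! i" 0 "l / \<tau>" "\<phi> 0" "\<phi> (l / \<tau>)"
    by (rule schroedinger_phase_pair[OF S])
  have [measurable]: "\<phi> 0 \<tau> \<in> borel_measurable M" "\<phi> (l / \<tau>) \<tau> \<in> borel_measurable M"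
    using phase_F[of \<tau>] F_meas_M[of \<tau>] \<tau> by auto
  show A: "A \<in> sets M" unfolding A_def by measurable
  have "AE \<omega> in M. \<omega> \<in> A \<longleftrightarrow> Sch_count \<phi> \<tau> 0 l \<omega> = 0"
    using schroedinger_phase.regular[OF S] AE_space
  proof eventually_elim
    case (elim \<omega>)
    then have "strict_mono (\<lambda>l. \<phi> l \<tau> \<omega>)" "continuous_on UNIV (\<lambda>l. \<phi> l \<tau> \<omega>)"
      using \<tau> real_analytic_continuous by auto
    from Sch_count_eq_0_iff[of \<phi> \<tau> \<omega> l, OF this \<tau> l] show ?case using elim(2) by (simp add: A_def)
  qed
  from measure_completion_eq_AE[OF A this]
  show "{\<omega> \<in> space M. Sch_count \<phi> \<tau> 0 l \<omega> = 0} \<in> sets (completion M)" "Sch_gap_prob M \<phi> \<tau> l = measure M A"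
    by (simp_all add: Sch_gap_prob_def)
qed

text \<open>Through this, positivity of the gap probability at large \<open>l\<close> extends to all \<open>l\<close>.\<close>

lemma gap_prob_antimono:
  assumes S: "schroedinger_phase M B B2 B3 \<phi>" and \<tau>: "0 < \<tau>" and l: "0 < l" "l \<le> l'"
  shows "Sch_gap_prob M \<phi> \<tau> l' \<le> Sch_gap_prob M \<phi> \<tau> l"
proof -
  interpret phase_pair M "aug_filtration M [B, B2, B3]" "\<lambda>i. [B, B2, B3] ! i" 0 1 "\<phi> 0" "\<phi> 1"
    by (rule schroedinger_phase_pair[OF S])
  interpret C: finite_measure "completion M"
    by (rule finite_measureI) (simp add: emeasure_space_1)
  have le: "Sch_count \<phi> \<tau> 0 l \<omega> \<le> Sch_count \<phi> \<tau> 0 l' \<omega>" for \<omega>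
    unfolding Sch_count_def using l by (intro emeasure_mono) auto
  show ?thesis
    unfolding Sch_gap_prob_def
  proof (rule C.finite_measure_mono)
    show "{\<omega> \<in> space (completion M). Sch_count \<phi> \<tau> 0 l' \<omega> = 0} \<subseteq> {\<omega> \<in> space (completion M). Sch_count \<phi> \<tau> 0 l \<omega> = 0}"
    proof (rule subsetI)
      fix \<omega> assume \<omega>: "\<omega> \<in> {\<omega> \<in> space (completion M). Sch_count \<phi> \<tau> 0 l' \<omega> = 0}"
      then have "Sch_count \<phi> \<tau> 0 l \<omega> \<le> 0" using le[of \<omega>] by simp
      then show "\<omega> \<in> {\<omega> \<in> space (completion M). Sch_count \<phi> \<tau> 0 l \<omega> = 0}" using \<omega> by simp
    qed
    show "{\<omega> \<in> space (completion M). Sch_count \<phi> \<tau> 0 l \<omega> = 0} \<in> sets (completion M)"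
      using gap_event_probability(2)[OF S \<tau> l(1)] by simp
  qed
qed

lemma gap_prob_upper:
  assumes S: "schroedinger_phase M B B2 B3 \<phi>" and \<tau>: "0 < \<tau>" and \<nu>: "0 < \<nu>"
  shows "Sch_gap_prob M \<phi> \<tau> (\<nu> * \<tau>) \<le> (1 + \<nu>\<^sup>2 * exp (pi * \<nu>)) * exp (- (\<nu> ^ 4 / (4 * (1 + \<nu>\<^sup>2))) * \<tau>)"
proof -
  interpret phase_pair M "aug_filtration M [B, B2, B3]" "\<lambda>i. [B, B2, B3] ! i" 0 \<nu> "\<phi> 0" "\<phi> \<nu>"
    by (rule schroedinger_phase_pair[OF S])
  have l: "0 < \<nu> * \<tau>" "\<nu> * \<tau> / \<tau> = \<nu>" using \<nu> \<tau> by auto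
  have "AE \<omega> in M. 0 \<le> gap 0 t \<omega>" if "0 \<le> t" for t
  proof (cases "t = 0")
    case True
    show ?thesis using schroedinger_phase.initial[OF S, of 0] schroedinger_phase.initial[OF S, of \<nu>]
      by eventually_elim (simp add: True gap_def)
  next
    case False
    then have t: "0 < t" using that by simp
    show ?thesis using schroedinger_phase.regular[OF S]
    proof eventually_elim
      case (elim \<omega>)
      then have "\<phi> 0 t \<omega> < \<phi> \<nu> t \<omega>" using t \<nu> unfolding strict_mono_def by blast
      then show ?case by (simp add: gap_def)
    qed
  qed
  then have up: "prob {\<omega> \<in> space M. gap 0 \<tau> \<omega> < 2 * pi} \<le>
    (1 + \<nu>\<^sup>2 * exp (pi * \<nu>)) * exp (- (\<nu> ^ 4 / (4 * (1 + \<nu>\<^sup>2))) * \<tau>)"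
    using \<nu> \<tau> by (intro prob_gap_small_upper) auto
  have [measurable]: "gap 0 \<tau> \<in> borel_measurable M" using F_meas_M[OF _ mid_gap_F(2), of \<tau>] \<tau> by simp
  have "Sch_gap_prob M \<phi> \<tau> (\<nu> * \<tau>) = prob {\<omega> \<in> space M. \<exists>k::int. 2 * pi * of_int k < \<phi> 0 \<tau> \<omega> \<and> \<phi> \<nu> \<tau> \<omega> < 2 * pi * of_int k + 2 * pi}"
    using gap_event_probability(3)[OF S \<tau> l(1)] unfolding l(2) .
  also have "\<dots> \<le> prob {\<omega> \<in> space M. gap 0 \<tau> \<omega> < 2 * pi}"
  proof (rule finite_measure_mono)
    show "{\<omega> \<in> space M. gap 0 \<tau> \<omega> < 2 * pi} \<in> events" by measurable
  qed (auto simp: gap_def)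
  finally show ?thesis using up by simp
qed

lemma gap_prob_lower:
  assumes S: "schroedinger_phase M B B2 B3 \<phi>" and \<tau>: "0 < \<tau>" and \<nu>: "1 \<le> \<nu>" "pi \<le> \<nu> * \<tau>"
  shows "exp (- (\<nu>\<^sup>2 / 4 + 12 * \<nu> + 1 + (11 + 2 * (pi / \<tau>)\<^sup>2)) * \<tau> - \<nu> - 17 * pi) / (16 * \<nu> ^ 4) \<le> Sch_gap_prob M \<phi> \<tau> (\<nu> * \<tau>)"
proof -
  interpret phase_pair M "aug_filtration M [B, B2, B3]" "\<lambda>i. [B, B2, B3] ! i" 0 \<nu> "\<phi> 0" "\<phi> \<nu>"
    by (rule schroedinger_phase_pair[OF S])
  have l: "0 < \<nu> * \<tau>" "\<nu> * \<tau> / \<tau> = \<nu>" using \<nu> \<tau> by auto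
  show ?thesis
    unfolding gap_event_probability(3)[OF S \<tau> l(1)] l(2)
    by (rule prob_gap_lower[OF refl refl \<nu> \<tau> _ _ refl]) (rule schroedinger_phase.initial[OF S])+
qed

theorem theorem12:
  fixes M :: "'a measure"
    and B B2 B3 :: "real \<Rightarrow> 'a \<Rightarrow> real"
    and \<phi> :: "real \<Rightarrow> real \<Rightarrow> 'a \<Rightarrow> real"
    and \<tau> :: real
  assumes "schroedinger_phase M B B2 B3 \<phi>"
    and "\<tau> > 0"
  shows "\<exists>\<epsilon> :: real \<Rightarrow> real. (\<epsilon> \<longlongrightarrow> 0) at_top \<and>
    (\<forall>l>0. Sch_gap_prob M \<phi> \<tau> l = exp (- (l\<^sup>2 / (4 * \<tau>)) * (1 + \<epsilon> l)))"
proof -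
  note S = assms(1) and \<tau> = assms(2)
  define P where "P l = Sch_gap_prob M \<phi> \<tau> l" for l
  define K where "K = 11 + 2 * (pi / \<tau>)\<^sup>2"
  define low where "low \<nu> = (\<nu>\<^sup>2 / 4 + 12 * \<nu> + 1 + K) * \<tau> + \<nu> + 17 * pi + ln (16 * \<nu> ^ 4)" for \<nu>
  define up where "up \<nu> = \<nu> ^ 4 / (4 * (1 + \<nu>\<^sup>2)) * \<tau> - ln (1 + \<nu>\<^sup>2 * exp (4 * \<nu>))" for \<nu>
  \<comment> \<open>the solution of \<open>P l = exp (- (l\<^sup>2 / (4 * \<tau>)) * (1 + \<epsilon> l))\<close>\<close>
  define \<epsilon> where "\<epsilon> l = - ln (P l) * (4 * \<tau> / l\<^sup>2) - 1" for l
  have lower: "exp (- low \<nu>) \<le> P (\<nu> * \<tau>)" if \<nu>: "1 \<le> \<nu>" "pi \<le> \<nu> * \<tau>" for \<nu>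
  proof -
    have "0 < 16 * \<nu> ^ 4" using \<nu> by simp
    moreover have "- low \<nu> = (- (\<nu>\<^sup>2 / 4 + 12 * \<nu> + 1 + K) * \<tau> - \<nu> - 17 * pi) - ln (16 * \<nu> ^ 4)"
      unfolding low_def by (simp add: algebra_simps)
    ultimately have "exp (- low \<nu>) = exp (- (\<nu>\<^sup>2 / 4 + 12 * \<nu> + 1 + K) * \<tau> - \<nu> - 17 * pi) / (16 * \<nu> ^ 4)"
      by (simp only: exp_diff exp_ln)
    then show ?thesis using gap_prob_lower[OF S \<tau> \<nu>] unfolding P_def K_def by simp
  qed
  have upper: "P (\<nu> * \<tau>) \<le> exp (- up \<nu>)" if \<nu>: "0 < \<nu>" for \<nu>
  proof -
    have pos: "0 < 1 + \<nu>\<^sup>2 * exp (4 * \<nu>)" by (simp add: add_pos_nonneg)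
    have "P (\<nu> * \<tau>) \<le> (1 + \<nu>\<^sup>2 * exp (pi * \<nu>)) * exp (- (\<nu> ^ 4 / (4 * (1 + \<nu>\<^sup>2))) * \<tau>)"
      unfolding P_def by (rule gap_prob_upper[OF S \<tau> \<nu>])
    also have "\<dots> \<le> (1 + \<nu>\<^sup>2 * exp (4 * \<nu>)) * exp (- (\<nu> ^ 4 / (4 * (1 + \<nu>\<^sup>2))) * \<tau>)"
      using \<nu> pi_less_4 by (intro mult_right_mono add_left_mono mult_left_mono) auto
    also have "\<dots> = exp (- up \<nu>)"
    proof -
      have "- up \<nu> = ln (1 + \<nu>\<^sup>2 * exp (4 * \<nu>)) + - (\<nu> ^ 4 / (4 * (1 + \<nu>\<^sup>2))) * \<tau>" unfolding up_def by simp
      then show ?thesis using pos by (simp only: exp_add exp_ln)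
    qed
    finally show ?thesis .
  qed
  have pos: "0 < P l" if l: "0 < l" for l
  proof -
    define \<nu> where "\<nu> = max 1 (max (pi / \<tau>) (l / \<tau>))"
    have "pi / \<tau> \<le> \<nu>" "l / \<tau> \<le> \<nu>" unfolding \<nu>_def by auto
    then have \<nu>: "1 \<le> \<nu>" "pi \<le> \<nu> * \<tau>" "l \<le> \<nu> * \<tau>"
      using \<tau> by (auto simp: pos_divide_le_eq \<nu>_def)
    have "0 < exp (- low \<nu>)" by simp
    also have "\<dots> \<le> P (\<nu> * \<tau>)" by (rule lower[OF \<nu>(1,2)])
    also have "\<dots> \<le> P l" unfolding P_def by (rule gap_prob_antimono[OF S \<tau> l \<nu>(3)])
    finally show ?thesis .
  qed
  have scale: "4 * \<tau> / l\<^sup>2 = 4 / (\<tau> * (l / \<tau>)\<^sup>2)" for l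
    using \<tau> by (simp add: field_simps power2_eq_square)
  have at_top: "filterlim (\<lambda>l. l / \<tau>) at_top at_top"
    using filterlim_tendsto_pos_mult_at_top[OF tendsto_const[of "1 / \<tau>"] _ filterlim_ident] \<tau> by simp
  have "(\<epsilon> \<longlongrightarrow> 0) at_top"
  proof (rule tendsto_sandwich)
    show "((\<lambda>l. up (l / \<tau>) * (4 / (\<tau> * (l / \<tau>)\<^sup>2)) - 1) \<longlongrightarrow> 0) at_top"
      using filterlim_compose[OF upper_exponent_limit[OF \<tau>] at_top] unfolding up_def .
    show "((\<lambda>l. low (l / \<tau>) * (4 / (\<tau> * (l / \<tau>)\<^sup>2)) - 1) \<longlongrightarrow> 0) at_top"
      using filterlim_compose[OF lower_exponent_limit[OF \<tau>] at_top] unfolding low_def .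
    show "\<forall>\<^sub>F l in at_top. up (l / \<tau>) * (4 / (\<tau> * (l / \<tau>)\<^sup>2)) - 1 \<le> \<epsilon> l"
      using eventually_gt_at_top[of 0]
    proof eventually_elim
      case (elim l)
      have "P l \<le> exp (- up (l / \<tau>))" using upper[of "l / \<tau>"] elim \<tau> by simp
      then have "ln (P l) \<le> - up (l / \<tau>)" using pos[OF elim] by (metis ln_exp ln_le_cancel_iff exp_gt_zero)
      then have "up (l / \<tau>) * (4 * \<tau> / l\<^sup>2) \<le> - ln (P l) * (4 * \<tau> / l\<^sup>2)" using \<tau> by (intro mult_right_mono) auto
      then show ?case unfolding \<epsilon>_def scale by simp
    qed
    show "\<forall>\<^sub>F l in at_top. \<epsilon> l \<le> low (l / \<tau>) * (4 / (\<tau> * (l / \<tau>)\<^sup>2)) - 1"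
      using eventually_ge_at_top[of "max \<tau> pi"]
    proof eventually_elim
      case (elim l)
      have "exp (- low (l / \<tau>)) \<le> P l" using lower[of "l / \<tau>"] elim \<tau> by simp
      moreover have "0 < l" using elim \<tau> by simp
      ultimately have "- low (l / \<tau>) \<le> ln (P l)" using pos[of l] by (metis ln_exp ln_le_cancel_iff exp_gt_zero)
      then have "- ln (P l) * (4 * \<tau> / l\<^sup>2) \<le> low (l / \<tau>) * (4 * \<tau> / l\<^sup>2)" using \<tau> by (intro mult_right_mono) auto
      then show ?case unfolding \<epsilon>_def scale by simp
    qed
  qed
  moreover have "Sch_gap_prob M \<phi> \<tau> l = exp (- (l\<^sup>2 / (4 * \<tau>)) * (1 + \<epsilon> l))" if l: "0 < l" for l
  proof -
    have "- (l\<^sup>2 / (4 * \<tau>)) * (1 + \<epsilon> l) = ln (P l)" unfolding \<epsilon>_def using l \<tau> by simp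
    then show ?thesis using pos[OF l] by (simp add: P_def)
  qed
  ultimately show ?thesis by blast
qed

end
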